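(* Let $N\ge 2$, $\alpha\ge 0$ and let $m\ge 1$ be an integer. Let $u_p$ be a radial solution with $m$ nodal zones of $$-\Delta u=|x|^{\alpha}|u|^{p-1}u \ \text{ in } B,\qquad u=0\ \text{ on }\partial B .$$ When $p\to 1$ (with $p>1$) we have $$\|u_p\|_{\infty}^{\frac{p-1}{2}}\to \frac{2+\alpha}{2}\,z_m\left(\frac{N-2}{2+\alpha}\right),$$ $$\frac{u_p(x)}{\|u_p\|_\infty}\to \pm\,\Gamma\left(\frac{N+\alpha}{2+\alpha}\right)|x|^{-\frac{N-2}{2}}\mathcal J_{\frac{N-2}{2+\alpha}}\left(z_m\left(\frac{N-2}{2+\alpha}\right)|x|^{\frac{2+\alpha}{2}}\right)\quad\text{in } C^2(B).$$ Moreover, denoting by $0<r_{1,p}<\dots<r_{m,p}=1$ the nodal radii of $u_p$, we have $$r_{i,p}\to\left(\frac{z_i\left(\frac{N-2}{2+\alpha}\right)}{z_m\left(\frac{N-2}{2+\alpha}\right)}\right)^{\frac{2}{2+\alpha}}\qquad\text{for } i=1,\dots,m-1 .$$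
   Context: $B$ is the open unit ball of $\mathbb R^N$ and $\|\cdot\|_\infty$ is the sup norm on $B$. Nodal zones of $u$ are the connected components of $\{x\in B: u(x)\neq 0\}$; the nodal radii of a radial solution are the radii $r\in(0,1]$ of the spheres on which it vanishes. For each $m\ge1$ and each $p>1$ (with $p<\frac{N+2+2\alpha}{N-2}$ if $N\ge 3$) it is known that there is exactly one pair $\pm u_p$ of radial solutions with exactly $m$ nodal zones, and these are classical solutions; the sign $\pm$ in the limit is that of $u_p(0)$. $\Gamma$ is the Gamma function. For $\beta\ge 0$, $$\mathcal J_\beta(r)=r^\beta\sum_{k=0}^{\infty}\frac{(-1)^k}{k!\,\Gamma(k+1+\beta)}\left(\frac r2\right)^{2k},\quad r\ge 0,$$ is the Bessel function of the first kind (in this normalization), and $z_1(\beta)<z_2(\beta)<\dots$ is the increasing sequence of its positive zeros.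
   Formalization: The limit of u_p/‖u_p‖_∞ carries an extra factor z_m(β)^{-β}, β=(N-2)/(2+α) (equal to 1 for N=2); without it the printed limit tends to z_m(β)^β>1 at the origin for N≥3, which is impossible for functions of sup norm 1. *)

theory Defs
  imports "HOL-Analysis.Analysis"
begin

text \<open>Real power with the convention \<open>0\<^sup>0 = 1\<close>. The library has \<open>0 powr 0 = 0\<close>, which would make
  the weight \<open>|x|\<^sup>\<alpha>\<close> vanish at the origin for \<open>\<alpha> = 0\<close> and give the wrong value of the
  Bessel function of order 0 at 0.\<close>

definition rpow :: "real \<Rightarrow> real \<Rightarrow> real" where
  "rpow r a = (if a = 0 then 1 else r powr a)"

text \<open>Counting ranks with \<open>card\<close> is safe for \<open>k \<ge> 1\<close>: a positive cardinality forces the set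
  to be finite.\<close>

definition kth_smallest :: "real set \<Rightarrow> nat \<Rightarrow> real" where
  "kth_smallest S k = (THE s. s \<in> S \<and> card {t \<in> S. t \<le> s} = k)"

definition bessel_J :: "real \<Rightarrow> real \<Rightarrow> real" where
  "bessel_J \<beta> r = rpow r \<beta> *
     (\<Sum>k. (-1) ^ k / (fact k * Gamma (real k + 1 + \<beta>)) * (r / 2) ^ (2 * k))"

definition bessel_zero :: "real \<Rightarrow> nat \<Rightarrow> real" where
  "bessel_zero \<beta> = kth_smallest {r. 0 < r \<and> bessel_J \<beta> r = 0}"


definition grad :: "(real^'n \<Rightarrow> real) \<Rightarrow> real^'n \<Rightarrow> real^'n" where
  "grad f x = (\<chi> i. frechet_derivative f (at x) (axis i 1))"

definition hess :: "(real^'n \<Rightarrow> real) \<Rightarrow> real^'n \<Rightarrow> real^'n^'n" where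
  "hess f x = jacobian (grad f) (at x)"

definition laplacian :: "(real^'n \<Rightarrow> real) \<Rightarrow> real^'n \<Rightarrow> real" where
  "laplacian f x = trace (hess f x)"

text \<open>Meant for open \<open>S\<close>.\<close>

definition C2_on :: "(real^'n) set \<Rightarrow> (real^'n \<Rightarrow> real) \<Rightarrow> bool" where
  "C2_on S f \<longleftrightarrow> (\<forall>x\<in>S. f differentiable (at x)) \<and>
     (\<forall>x\<in>S. grad f differentiable (at x)) \<and> continuous_on S (hess f)"

text \<open>Convergence in the norm of \<open>C\<^sup>2(S)\<close>: uniform on all of \<open>S\<close> (not only on compact subsets)
  for the functions and their derivatives up to order two.\<close>

definition C2_converges ::
    "(real^'n) set \<Rightarrow> ('p \<Rightarrow> real^'n \<Rightarrow> real) \<Rightarrow> (real^'n \<Rightarrow> real) \<Rightarrow> 'p filter \<Rightarrow> bool" where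
  "C2_converges S f g F \<longleftrightarrow>
     (\<forall>\<^sub>F p in F. C2_on S (f p)) \<and> C2_on S g \<and>
     uniform_limit S f g F \<and>
     uniform_limit S (\<lambda>p. grad (f p)) (grad g) F \<and>
     uniform_limit S (\<lambda>p. hess (f p)) (hess g) F"


definition sup_norm :: "(real^'n \<Rightarrow> real) \<Rightarrow> real" where
  "sup_norm u = (SUP x\<in>ball 0 1. \<bar>u x\<bar>)"

definition nodal_zones :: "(real^'n \<Rightarrow> real) \<Rightarrow> (real^'n) set set" where
  "nodal_zones u = components {x \<in> ball 0 1. u x \<noteq> 0}"

definition nodal_radii :: "(real^'n \<Rightarrow> real) \<Rightarrow> real set" where
  "nodal_radii u = {r. 0 < r \<and> r \<le> 1 \<and> (\<forall>x. norm x = r \<longrightarrow> u x = 0)}"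

text \<open>Classical radial solutions of \<open>-\<Delta>u = |x|\<^sup>\<alpha> |u|\<^bsup>p-1\<^esup> u\<close> in the unit ball with zero boundary
  values. Only the values on the closed ball matter.\<close>

definition radial_henon_solution :: "real \<Rightarrow> real \<Rightarrow> (real^'n \<Rightarrow> real) \<Rightarrow> bool" where
  "radial_henon_solution \<alpha> p u \<longleftrightarrow>
     C2_on (ball 0 1) u \<and> continuous_on (cball 0 1) u \<and>
     (\<forall>x\<in>ball 0 1. - laplacian u x = rpow (norm x) \<alpha> * \<bar>u x\<bar> powr (p - 1) * u x) \<and>
     (\<forall>x\<in>sphere 0 1. u x = 0) \<and>
     (\<forall>x\<in>cball 0 1. \<forall>y\<in>cball 0 1. norm x = norm y \<longrightarrow> u x = u y)"

text \<open>The exponents \<open>p > 1\<close> that are subcritical for radial solutions in dimension \<open>N\<close>.\<close>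

definition henon_exponent :: "nat \<Rightarrow> real \<Rightarrow> real \<Rightarrow> bool" where
  "henon_exponent N \<alpha> p \<longleftrightarrow>
     1 < p \<and> (3 \<le> N \<longrightarrow> p < (real N + 2 + 2 * \<alpha>) / (real N - 2))"

text \<open>The limit order \<open>(N - 2) / (2 + \<alpha>)\<close> of the Bessel function.\<close>

definition henon_order :: "nat \<Rightarrow> real \<Rightarrow> real" where
  "henon_order N \<alpha> = (real N - 2) / (2 + \<alpha>)"

text \<open>The formula of the limit is meaningful for \<open>x \<noteq> 0\<close> and extends continuously to the origin;
  \<open>Lim (at 0)\<close> is that extension. With \<open>\<beta> = (N-2)/(2+\<alpha>)\<close> and \<open>z\<close> the \<open>m\<close>-th zero, the formula
  \<open>\<Gamma>(1+\<beta>) |x|\<^bsup>-(N-2)/2\<^esup> J\<^sub>\<beta>(z |x|\<^bsup>(2+\<alpha>)/2\<^esup>)\<close> alone tends to \<open>z\<^bsup>\<beta>\<^esup>\<close> at the origin, because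
  \<open>J\<^sub>\<beta>\<close> starts with \<open>r\<^bsup>\<beta>\<^esup> / \<Gamma>(1+\<beta>)\<close>. The factor \<open>z\<^bsup>-\<beta>\<^esup>\<close> (equal to 1 for \<open>N = 2\<close>) normalizes the
  value at the origin to 1, as is necessary for a limit of functions of sup norm 1.\<close>

definition henon_profile_formula :: "real \<Rightarrow> nat \<Rightarrow> real^'n \<Rightarrow> real" where
  "henon_profile_formula \<alpha> m x =
     (let N = real CARD('n); \<beta> = henon_order CARD('n) \<alpha>; z = bessel_zero \<beta> m in
      z powr (- \<beta>) * Gamma ((N + \<alpha>) / (2 + \<alpha>)) * norm x powr (- ((N - 2) / 2)) *
      bessel_J \<beta> (z * norm x powr ((2 + \<alpha>) / 2)))"

definition henon_profile :: "real \<Rightarrow> nat \<Rightarrow> real^'n \<Rightarrow> real" where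
  "henon_profile \<alpha> m x =
     (if x = 0 then Lim (at 0) (henon_profile_formula \<alpha> m :: real^'n \<Rightarrow> real)
      else henon_profile_formula \<alpha> m x)"

end

theory Submission
  imports Defs
begin

text \<open>
  Write a radial solution as \<open>u(x) = v(|x|)\<close>. Its profile solves
  \<open>v'' + (N-1)/r v' = - r\<^sup>\<alpha> |v|\<^bsup>p-1\<^esup> v\<close> with \<open>v'(0) = 0\<close>. An energy that decreases in \<open>r\<close>
  shows that \<open>|v|\<close> is largest at the centre, so \<open>\<parallel>u\<parallel>\<^sub>\<infinity> = |v(0)|\<close>. Put
  \<open>\<sigma> = \<parallel>u\<parallel>\<^sub>\<infinity>\<^bsup>(p-1)/(2+\<alpha>)\<^esup>\<close> and \<open>w(s) = v(s/\<sigma>) / v(0)\<close>. Then \<open>w\<close> solves the same equation on \<open>[0,\<sigma>]\<close>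
  with \<open>w(0) = 1\<close>: the size of \<open>u\<close> has turned into the length \<open>\<sigma>\<close> of the interval. The nodal zones
  of \<open>u\<close> are the annuli between consecutive zeros, so \<open>w\<close> has exactly \<open>m\<close> zeros in \<open>(0,\<sigma>]\<close> and
  the last of them is \<open>\<sigma>\<close> itself (\<open>normalized_solution\<close>).

  Since \<open>|w| \<le> 1\<close>, the nonlinearity differs from the identity by at most \<open>p - 1\<close>. A Gronwall argument
  (\<open>profile_comparison\<close>) therefore brings \<open>w\<close> and \<open>w'\<close> within \<open>O(p - 1)\<close> of the solution \<open>W\<close> of the linear
  equation \<open>W'' + (N-1)/s W' = - s\<^sup>\<alpha> W\<close>, \<open>W(0) = 1\<close>, uniformly on bounded intervals, as far as \<open>w\<close> is defined.
  The function \<open>W\<close> is a power series in \<open>s\<^bsup>2+\<alpha>\<^esup>\<close>; up to the change of variables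
  \<open>t = s\<^bsup>(2+\<alpha>)/2\<^esup> / ((2+\<alpha>)/2)\<close> and a power of \<open>t\<close> it is the Bessel function of order \<open>(N-2)/(2+\<alpha>)\<close>. It
  has infinitely many zeros \<open>s\<^sub>1 < s\<^sub>2 < \<dots>\<close> (\<open>linear_profile_oscillates\<close>), all of them simple.

  Near each simple zero of \<open>W\<close> a \<open>C\<^sup>1\<close>-close function has exactly one zero, and elsewhere none
  (\<open>simple_zeros_stable\<close>). If \<open>\<sigma>\<close> were larger than \<open>s\<^sub>m\<close> by a fixed amount, \<open>w\<close> would have \<open>m\<close> zeros near
  \<open>s\<^sub>1, \<dots>, s\<^sub>m\<close> and in addition the zero \<open>\<sigma>\<close>; so \<open>\<sigma> < s\<^sub>m + \<epsilon>\<close>, and then the \<open>m\<close> zeros of \<open>w\<close> must be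
  distributed one to each \<open>s\<^sub>i\<close>. Hence \<open>\<sigma> \<rightarrow> s\<^sub>m\<close> and the \<open>i\<close>-th zero of \<open>w\<close> tends to \<open>s\<^sub>i\<close>. The first limit is
  the one for \<open>\<parallel>u\<parallel>\<^sub>\<infinity>\<close>, and the quotients give the nodal radii. The same count provides the bound for \<open>\<sigma>\<close>, so the
  comparison with \<open>W\<close> has to be made on a fixed interval only.

  Finally \<open>u(x)/u(0) = w(\<sigma>|x|)\<close> tends to \<open>W(s\<^sub>m|x|)\<close> uniformly. The convergence of the first and second
  derivatives follows from the equation: gradient and Hessian of a radial function are expressed by
  \<open>v'/r\<close> and \<open>v''\<close>, and both are controlled by the right-hand side (\<open>flux_bound\<close>, \<open>radial_C2_close\<close>).
\<close>

section \<open>Ranks in sets of reals\<close>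

lemma kth_smallest_eqI:
  assumes "s \<in> T" "card {t \<in> T. t \<le> s} = k" "1 \<le> k"
  shows "kth_smallest T k = s"
  unfolding kth_smallest_def
proof (rule the_equality)
  show "s \<in> T \<and> card {t \<in> T. t \<le> s} = k"
    using assms by simp
next
  have no_smaller: False
    if "a \<in> T" "b \<in> T" "a < b" "card {t \<in> T. t \<le> a} = k" "card {t \<in> T. t \<le> b} = k" for a b
  proof -
    have "finite {t \<in> T. t \<le> b}"
      using that(5) assms(3) by (intro card_ge_0_finite) simp
    moreover have "{t \<in> T. t \<le> a} \<subset> {t \<in> T. t \<le> b}"
      using that by force
    ultimately have "card {t \<in> T. t \<le> a} < card {t \<in> T. t \<le> b}"
      by (rule psubset_card_mono)
    then show False
      using that by simp
  qed
  fix s' assume "s' \<in> T \<and> card {t \<in> T. t \<le> s'} = k"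
  then show "s' = s"
    using no_smaller[of s s'] no_smaller[of s' s] assms by (cases s s' rule: linorder_cases) auto
qed

text \<open>Induction on the rank: the element of rank \<open>k + 1\<close> is the least one above the element of rank \<open>k\<close>.\<close>

lemma kth_smallest_exists:
  fixes T :: "real set"
  assumes fin: "\<And>x. finite {t \<in> T. t \<le> x}" and large: "k \<le> card {t \<in> T. t \<le> x}" and "1 \<le> k"
  shows "\<exists>s\<in>T. s \<le> x \<and> card {t \<in> T. t \<le> s} = k"
  using \<open>1 \<le> k\<close> large
proof (induction k rule: dec_induct)
  case base
  let ?A = "{t \<in> T. t \<le> x}"
  have ne: "?A \<noteq> {}"
    using base by (intro notI) simp
  obtain a where a: "a \<in> T" "a \<le> x" and least: "\<And>t. t \<in> T \<Longrightarrow> t \<le> x \<Longrightarrow> a \<le> t"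
    using Min_in[OF fin ne] Min_le[OF fin, of _ x] by auto
  have "{t \<in> T. t \<le> a} = {a}"
    using a least by (force intro: antisym)
  then show ?case
    using a by (intro bexI[of _ a]) auto
next
  case (step k)
  then obtain s where s: "s \<in> T" "s \<le> x" "card {t \<in> T. t \<le> s} = k"
    by auto
  let ?A = "{t \<in> T. s < t \<and> t \<le> x}"
  have finA: "finite ?A"
    by (rule finite_subset[OF _ fin[of x]]) auto
  have "?A \<noteq> {}"
  proof
    assume "?A = {}"
    then have "{t \<in> T. t \<le> x} = {t \<in> T. t \<le> s}"
      using s by force
    then show False
      using s step.prems by simp
  qed
  then obtain a where a: "a \<in> T" "s < a" "a \<le> x"
    and least: "\<And>t. t \<in> T \<Longrightarrow> s < t \<Longrightarrow> t \<le> x \<Longrightarrow> a \<le> t"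
    using Min_in[OF finA] Min_le[OF finA] by auto
  have "{t \<in> T. t \<le> a} = insert a {t \<in> T. t \<le> s}"
  proof (intro equalityI subsetI)
    fix t assume t: "t \<in> {t \<in> T. t \<le> a}"
    show "t \<in> insert a {t \<in> T. t \<le> s}"
    proof (cases "t \<le> s")
      case False
      then have "a \<le> t"
        using least[of t] t a by simp
      then show ?thesis using t by simp
    qed (use t in simp)
  qed (use a in auto)
  moreover have "a \<notin> {t \<in> T. t \<le> s}"
    using a by auto
  ultimately have "card {t \<in> T. t \<le> a} = Suc k"
    using s fin by simp
  then show ?case
    using a by (intro bexI[of _ a]) auto
qed

lemma kth_smallest_properties:
  fixes T :: "real set"
  assumes fin: "\<And>x. finite {t \<in> T. t \<le> x}" and large: "k \<le> card {t \<in> T. t \<le> x}" and "1 \<le> k"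
  shows "kth_smallest T k \<in> T" "kth_smallest T k \<le> x"
    "card {t \<in> T. t \<le> kth_smallest T k} = k"
proof -
  obtain s where s: "s \<in> T" "s \<le> x" "card {t \<in> T. t \<le> s} = k"
    using kth_smallest_exists[OF assms] by blast
  then have "kth_smallest T k = s"
    using \<open>1 \<le> k\<close> by (intro kth_smallest_eqI)
  with s show "kth_smallest T k \<in> T" "kth_smallest T k \<le> x"
    "card {t \<in> T. t \<le> kth_smallest T k} = k"
    by auto
qed

lemma kth_smallest_image:
  fixes f :: "real \<Rightarrow> real"
  assumes mono: "\<And>s t. s \<in> T \<Longrightarrow> t \<in> T \<Longrightarrow> s < t \<Longrightarrow> f s < f t"
    and "s \<in> T" "card {t \<in> T. t \<le> s} = k" "1 \<le> k"
  shows "kth_smallest (f ` T) k = f s"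
proof (rule kth_smallest_eqI)
  have le: "f t \<le> f s \<longleftrightarrow> t \<le> s" if "t \<in> T" for t
    using mono[of t s] mono[of s t] that assms(2) by (cases t s rule: linorder_cases) auto
  have "{t \<in> f ` T. t \<le> f s} = f ` {t \<in> T. t \<le> s}"
    using le by auto
  moreover have "inj_on f {t \<in> T. t \<le> s}"
  proof (rule inj_onI)
    fix a b assume "a \<in> {t \<in> T. t \<le> s}" "b \<in> {t \<in> T. t \<le> s}" "f a = f b"
    then show "a = b"
      using mono[of a b] mono[of b a] by (cases a b rule: linorder_cases) auto
  qed
  ultimately show "card {t \<in> f ` T. t \<le> f s} = k"
    using assms(3) by (simp add: card_image)
qed (use assms in auto)

lemma kth_smallest_truncate:
  assumes "s \<in> T" "s \<le> x" "card {t \<in> T. t \<le> s} = k" "1 \<le> k"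
  shows "kth_smallest {t \<in> T. t \<le> x} k = s"
proof (rule kth_smallest_eqI)
  have "{t \<in> {t \<in> T. t \<le> x}. t \<le> s} = {t \<in> T. t \<le> s}"
    using assms by auto
  then show "card {t \<in> {t \<in> T. t \<le> x}. t \<le> s} = k"
    using assms by simp
qed (use assms in auto)

section \<open>Stability of simple zeros\<close>

lemma simple_zero_sign_change:
  fixes V :: "real \<Rightarrow> real"
  assumes der: "(V has_real_derivative l) (at t)" and "V t = 0" "l \<noteq> 0"
  shows "\<exists>e>0. \<forall>h. 0 < h \<and> h \<le> e \<longrightarrow> V (t - h) * V (t + h) < 0"
proof -
  have pos: "\<exists>e>0. \<forall>h. 0 < h \<and> h \<le> e \<longrightarrow> U (t - h) * U (t + h) < 0"
    if U: "(U has_real_derivative k) (at t)" "U t = 0" "0 < k" for U :: "real \<Rightarrow> real" and k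
  proof -
    obtain d1 where d1: "d1 > 0" "\<And>h. 0 < h \<Longrightarrow> h < d1 \<Longrightarrow> U t < U (t + h)"
      using DERIV_pos_inc_right[OF U(1,3)] by blast
    obtain d2 where d2: "d2 > 0" "\<And>h. 0 < h \<Longrightarrow> h < d2 \<Longrightarrow> U (t - h) < U t"
      using DERIV_pos_inc_left[OF U(1,3)] by blast
    show ?thesis
      using d1 d2 U(2) by (intro exI[of _ "min d1 d2 / 2"]) (auto intro!: mult_neg_pos)
  qed
  show ?thesis
  proof (cases "0 < l")
    case True
    then show ?thesis using pos[OF der] assms by simp
  next
    case False
    then show ?thesis using pos[OF DERIV_minus[OF der]] assms by simp
  qed
qed

text \<open>
  Choose \<open>h\<close> so small that the intervals of radius \<open>h\<close> around the zeros of \<open>V\<close> are disjoint, that \<open>V\<close> changes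
  sign across each of them, and that \<open>V'\<close> does not vanish there. If \<open>w\<close> is \<open>C\<^sup>1\<close>-close to \<open>V\<close>, it has no zero outside
  these intervals, at most one in each by Rolle's theorem, and at least one in each interval inside its domain by
  the intermediate value theorem. Comparing the number \<open>m\<close> of zeros of \<open>w\<close> with that of the intervals pins
  down the right end \<open>S\<close> of the domain, which is itself a zero of \<open>w\<close>.
\<close>

lemma simple_zeros_stable:
  fixes V V1 :: "real \<Rightarrow> real" and sm \<epsilon> :: real
  defines "T \<equiv> {s. 0 < s \<and> V s = 0}"
  assumes V0: "V 0 \<noteq> 0" and fin: "\<And>x. finite {s \<in> T. s \<le> x}"
    and simple: "\<And>s. s \<in> T \<Longrightarrow> V1 s \<noteq> 0"
    and derV: "\<And>s. 0 < s \<Longrightarrow> (V has_real_derivative V1 s) (at s)"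
    and contV: "continuous_on {0..} V" and contV1: "continuous_on {0..} V1"
    and sm: "sm \<in> T" "card {s \<in> T. s \<le> sm} = m" and \<epsilon>: "0 < \<epsilon>"
  shows "\<exists>\<delta>>0. \<forall>S w w1. 0 < S \<longrightarrow> continuous_on {0..S} w \<longrightarrow>
      (\<forall>r. 0 < r \<and> r < S \<longrightarrow> (w has_real_derivative w1 r) (at r)) \<longrightarrow> w S = 0 \<longrightarrow>
      card {r. 0 < r \<and> r \<le> S \<and> w r = 0} = m \<longrightarrow>
      (\<forall>r. 0 \<le> r \<and> r \<le> S \<and> r \<le> sm + 1 \<longrightarrow> \<bar>w r - V r\<bar> < \<delta>) \<longrightarrow>
      (\<forall>r. 0 \<le> r \<and> r < S \<and> r \<le> sm + 1 \<longrightarrow> \<bar>w1 r - V1 r\<bar> < \<delta>) \<longrightarrow>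
      (\<forall>i\<in>{1..m}. \<bar>kth_smallest {r. 0 < r \<and> r \<le> S \<and> w r = 0} i - kth_smallest T i\<bar> < \<epsilon>)"
proof -
  have sm_pos: "0 < sm" using sm(1) by (simp add: T_def)
  have local: "\<exists>e>0. e < t \<and> (\<forall>h. 0 < h \<and> h \<le> e \<longrightarrow> V (t - h) * V (t + h) < 0) \<and>
      (\<forall>x. \<bar>x - t\<bar> \<le> e \<longrightarrow> V1 x \<noteq> 0)" if t: "t \<in> T" for t
  proof -
    have t': "0 < t" "V t = 0" using t by (auto simp: T_def)
    obtain e1 where e1: "0 < e1" "\<And>h. 0 < h \<Longrightarrow> h \<le> e1 \<Longrightarrow> V (t - h) * V (t + h) < 0"
      using simple_zero_sign_change[OF derV[OF t'(1)] t'(2) simple[OF t]] by blast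
    obtain e2 where e2: "0 < e2" "\<And>x. x \<in> {0..} \<Longrightarrow> dist x t < e2 \<Longrightarrow> dist (V1 x) (V1 t) < \<bar>V1 t\<bar>"
      using contV1 t' simple[OF t] unfolding continuous_on_iff
      by (metis atLeast_iff less_imp_le zero_less_abs_iff)
    define e where "e = min e1 (min (e2 / 2) (t / 2))"
    have e: "0 < e" "e \<le> e1" "e < e2" "e < t"
      using e1 e2 t' by (auto simp: e_def)
    have "V1 x \<noteq> 0" if "\<bar>x - t\<bar> \<le> e" for x
      using e2(2)[of x] that e by (auto simp: dist_real_def abs_le_iff)
    then show ?thesis
      using e e1 by (intro exI[of _ e]) auto
  qed
  define T' where "T' = {s \<in> T. s \<le> sm + 1}"
  define Tm where "Tm = {s \<in> T. s \<le> sm}"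
  have finT': "finite T'" and finTm: "finite Tm"
    using fin by (auto simp: T'_def Tm_def)
  have Tm_sub: "Tm \<subseteq> T'" by (auto simp: T'_def Tm_def)
  have smT: "sm \<in> Tm" "sm \<in> T'" using sm by (auto simp: T'_def Tm_def)
  obtain e where e: "\<And>t. t \<in> T' \<Longrightarrow> 0 < e t \<and> e t < t \<and>
      (\<forall>h. 0 < h \<and> h \<le> e t \<longrightarrow> V (t - h) * V (t + h) < 0) \<and>
      (\<forall>x. \<bar>x - t\<bar> \<le> e t \<longrightarrow> V1 x \<noteq> 0)"
    using local unfolding T'_def by (metis (no_types, lifting) mem_Collect_eq)
  \<comment> \<open>Half of the common radius, so that distinct zeros have distance greater than \<open>2 h\<close>; the bound 1 keeps all intervals below \<open>sm + 1\<close>.\<close>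
  define h where "h = Min (insert 1 (insert \<epsilon> (e ` T'))) / 2"
  have "0 < Min (insert 1 (insert \<epsilon> (e ` T')))"
    using finT' e \<epsilon> by (subst Min_gr_iff) auto
  then have h0: "0 < h" by (simp add: h_def)
  have h_le: "2 * h \<le> x" if "x \<in> insert 1 (insert \<epsilon> (e ` T'))" for x
    using Min_le[of "insert 1 (insert \<epsilon> (e ` T'))" x] finT' that by (simp add: h_def)
  have h: "2 * h \<le> 1" "2 * h \<le> \<epsilon>" "\<And>t. t \<in> T' \<Longrightarrow> 2 * h \<le> e t"
    using h_le by auto
  have separated: "2 * h < \<bar>t - t'\<bar>" if t: "t \<in> T'" "t' \<in> T'" "t \<noteq> t'" for t t'
  proof (rule ccontr)
    assume "\<not> 2 * h < \<bar>t - t'\<bar>"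
    then have "V (t - \<bar>t - t'\<bar>) * V (t + \<bar>t - t'\<bar>) < 0"
      using e[OF t(1)] h(3)[OF t(1)] t(3) by auto
    moreover have "V t' = 0" using t by (simp add: T'_def T_def)
    ultimately show False
      by (cases "t \<le> t'") auto
  qed
  define K where "K = {0..sm + h} - (\<Union>t\<in>T'. ball t h)"
  have V_nz: "V x \<noteq> 0" if x: "x \<in> K" for x
  proof
    assume "V x = 0"
    then have "x \<in> T'"
      using x V0 h by (auto simp: K_def T'_def T_def less_le)
    then show False using x h0 by (auto simp: K_def)
  qed
  have cK: "compact K"
    unfolding K_def by (intro compact_diff compact_Icc open_UN ballI open_ball)
  have "0 \<in> K"
  proof -
    have "h < t" if "t \<in> T'" for t
      using e[OF that] h(3)[OF that] h0 by linarith
    then have "0 \<notin> ball t h" if "t \<in> T'" for t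
      using that by (force simp: dist_real_def)
    then show ?thesis
      using sm_pos h0 by (auto simp: K_def)
  qed
  then obtain k where k: "k \<in> K" "\<And>x. x \<in> K \<Longrightarrow> \<bar>V k\<bar> \<le> \<bar>V x\<bar>"
    using continuous_attains_inf[OF cK, of "\<lambda>x. \<bar>V x\<bar>"]
      continuous_on_subset[OF contV, of K] by (force simp: K_def intro: continuous_intros)
  define J where "J = (\<Union>t\<in>T'. cball t h)"
  have V1_nz: "V1 x \<noteq> 0" if x: "x \<in> J" for x
  proof -
    obtain t where t: "t \<in> T'" "dist t x \<le> h"
      using x by (auto simp: J_def)
    then show ?thesis
      using e[OF t(1)] h(3)[OF t(1)] h0 by (auto simp: dist_real_def abs_minus_commute)
  qed
  have cJ: "compact J"
    unfolding J_def using finT' by (intro compact_UN compact_cball)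
  have J_sub: "J \<subseteq> {0..}"
  proof
    fix x assume "x \<in> J"
    then obtain t where t: "t \<in> T'" "dist t x \<le> h"
      by (auto simp: J_def)
    then show "x \<in> {0..}"
      using e[OF t(1)] h(3)[OF t(1)] h0 by (auto simp: dist_real_def)
  qed
  have "sm \<in> J" using smT h0 by (force simp: J_def)
  then obtain k1 where k1: "k1 \<in> J" "\<And>x. x \<in> J \<Longrightarrow> \<bar>V1 k1\<bar> \<le> \<bar>V1 x\<bar>"
    using continuous_attains_inf[OF cJ, of "\<lambda>x. \<bar>V1 x\<bar>"]
      continuous_on_subset[OF contV1 J_sub] by (force intro: continuous_intros)
  define \<delta> where "\<delta> = min \<bar>V k\<bar> \<bar>V1 k1\<bar>"
  have \<delta>: "0 < \<delta>" "\<And>x. x \<in> K \<Longrightarrow> \<delta> \<le> \<bar>V x\<bar>" "\<And>x. x \<in> J \<Longrightarrow> \<delta> \<le> \<bar>V1 x\<bar>"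
    using V_nz[OF k(1)] V1_nz[OF k1(1)] k(2) k1(2) by (auto simp: \<delta>_def min_le_iff_disj)
  show ?thesis
  proof (intro exI[of _ \<delta>] conjI allI impI ballI)
    show "0 < \<delta>" by (rule \<delta>(1))
  next
    fix S :: real and w w1 :: "real \<Rightarrow> real" and i
    assume S: "0 < S" and contw: "continuous_on {0..S} w"
      and derw: "\<forall>r. 0 < r \<and> r < S \<longrightarrow> (w has_real_derivative w1 r) (at r)" and wS: "w S = 0"
      and cardZ: "card {r. 0 < r \<and> r \<le> S \<and> w r = 0} = m"
      and near: "\<forall>r. 0 \<le> r \<and> r \<le> S \<and> r \<le> sm + 1 \<longrightarrow> \<bar>w r - V r\<bar> < \<delta>"
      and near1: "\<forall>r. 0 \<le> r \<and> r < S \<and> r \<le> sm + 1 \<longrightarrow> \<bar>w1 r - V1 r\<bar> < \<delta>"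
      and i: "i \<in> {1..m}"
    define Z where "Z = {r. 0 < r \<and> r \<le> S \<and> w r = 0}"
    have m: "0 < m" using i by simp
    have finZ: "finite Z"
      using cardZ m unfolding Z_def by (intro card_ge_0_finite) simp
    have same_sign: "w x * V x > 0" if "x \<in> K" "x \<le> S" for x
    proof -
      have "\<bar>w x - V x\<bar> < \<bar>V x\<bar>"
        using near \<delta>(2)[OF that(1)] that h unfolding K_def by fastforce
      then show ?thesis by (cases "0 < V x") (auto simp: zero_less_mult_iff)
    qed
    have near_Tm: "\<exists>t\<in>Tm. \<bar>x - t\<bar> < h" if x: "x \<in> Z" "x \<le> sm + h" for x
    proof -
      have "x \<notin> K" using same_sign[of x] x by (auto simp: Z_def)
      then obtain t where t: "t \<in> T'" "dist t x < h"
        using x by (auto simp: K_def Z_def)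
      have "t \<le> sm"
      proof (rule ccontr)
        assume "\<not> t \<le> sm"
        then show False
          using separated[OF t(1) smT(2)] t(2) x(2) by (auto simp: dist_real_def)
      qed
      then show ?thesis
        using t by (intro bexI[of _ t]) (auto simp: Tm_def T'_def dist_real_def)
    qed
    have unique: "x = y" if xy: "x \<in> Z" "y \<in> Z" and t: "t \<in> Tm" "\<bar>x - t\<bar> < h" "\<bar>y - t\<bar> < h" for x y t
    proof -
      have False if ab: "a \<in> Z" "b \<in> Z" "\<bar>a - t\<bar> < h" "\<bar>b - t\<bar> < h" "a < b" for a b
      proof -
        have "\<exists>c>a. c < b \<and> (\<lambda>y. w1 c * y) = (\<lambda>v. 0)"
        proof (rule Rolle_deriv[where f = w])
          show "continuous_on {a..b} w"
            by (rule continuous_on_subset[OF contw]) (use ab in \<open>auto simp: Z_def\<close>)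
          fix x assume "a < x" "x < b"
          then have "0 < x \<and> x < S" using ab by (auto simp: Z_def)
          then show "(w has_derivative (\<lambda>y. w1 x * y)) (at x)"
            using derw by (simp add: has_field_derivative_def)
        qed (use ab in \<open>auto simp: Z_def\<close>)
        then obtain c where c: "a < c" "c < b" "w1 c = 0"
          by (metis mult_1_right)
        have "c \<in> J"
          using c ab t(1) Tm_sub by (auto simp: J_def dist_real_def intro!: bexI[of _ t])
        moreover have "0 \<le> c \<and> c < S \<and> c \<le> sm + 1"
          using c ab t(1) h h0 by (auto simp: Z_def Tm_def)
        then have "\<bar>w1 c - V1 c\<bar> < \<delta>"
          using near1 by blast
        ultimately show False
          using \<delta>(3)[of c] c(3) by simp
      qed
      then show ?thesis
        using xy t by (cases x y rule: linorder_cases) auto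
    qed
    \<comment> \<open>Otherwise each of the \<open>m\<close> intervals contains a zero of \<open>w\<close> below \<open>S\<close>, and \<open>S\<close> is one more.\<close>
    have S_lt: "S < sm + h"
    proof (rule ccontr)
      assume "\<not> S < sm + h"
      then have S_ge: "sm + h \<le> S" by simp
      have "\<exists>z\<in>Z - {S}. \<bar>z - t\<bar> < h" if t: "t \<in> Tm" for t
      proof -
        have tT': "t \<in> T'" using t Tm_sub by auto
        have ht: "h < t" "t \<le> sm"
          using e[OF tT'] h(3)[OF tT'] h0 t by (auto simp: Tm_def)
        have inK: "t - h \<in> K" "t + h \<in> K"
          using ht h0 separated[OF tT'] by (auto simp: K_def dist_real_def) force+
        have V: "V (t - h) * V (t + h) < 0"
          using e[OF tT'] h(3)[OF tT'] h0 by auto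
        have "w (t - h) * V (t - h) > 0" "w (t + h) * V (t + h) > 0"
          using same_sign inK ht S_ge h0 by auto
        then have sgn: "w (t - h) < 0 \<and> 0 < w (t + h) \<or> 0 < w (t - h) \<and> w (t + h) < 0"
          using V by (auto simp: zero_less_mult_iff mult_less_0_iff)
        have cont: "continuous_on {t - h..t + h} w"
          by (rule continuous_on_subset[OF contw]) (use ht S_ge in auto)
        obtain z where z: "t - h \<le> z" "z \<le> t + h" "w z = 0"
          using sgn IVT'[of w "t - h" 0 "t + h"] IVT2'[of w "t + h" 0 "t - h"] cont h0 by fastforce
        moreover have "z \<noteq> t - h" "z \<noteq> t + h" using sgn z(3) by auto
        ultimately show ?thesis
          using ht S_ge by (intro bexI[of _ z]) (auto simp: Z_def)
      qed
      then obtain f where f: "\<And>t. t \<in> Tm \<Longrightarrow> f t \<in> Z - {S} \<and> \<bar>f t - t\<bar> < h"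
        by metis
      have "inj_on f Tm"
      proof (rule inj_onI)
        fix t t' assume tt: "t \<in> Tm" "t' \<in> Tm" "f t = f t'"
        then show "t = t'"
          using f[OF tt(1)] f[OF tt(2)] separated[of t t'] Tm_sub by force
      qed
      moreover have "f ` Tm \<subseteq> Z - {S}" using f by auto
      ultimately have "card Tm \<le> card (Z - {S})"
        using finZ by (intro card_inj_on_le) auto
      moreover have "S \<in> Z" using S wS by (simp add: Z_def)
      ultimately show False
        using m finZ cardZ sm(2) by (simp add: Z_def Tm_def)
    qed
    have "\<exists>t\<in>Tm. \<bar>z - t\<bar> < h" if "z \<in> Z" for z
      using near_Tm[OF that] that S_lt by (simp add: Z_def)
    then obtain j where j: "\<And>z. z \<in> Z \<Longrightarrow> j z \<in> Tm \<and> \<bar>z - j z\<bar> < h"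
      by metis
    \<comment> \<open>The zeros of \<open>w\<close> are in an increasing bijection with the first \<open>m\<close> zeros of \<open>V\<close>.\<close>
    have j_mono: "j x < j y" if xy: "x \<in> Z" "y \<in> Z" "x < y" for x y
    proof (rule ccontr)
      assume not_less: "\<not> j x < j y"
      have "j x \<noteq> j y"
        using unique[of x y "j x"] j xy by fastforce
      then have "2 * h < \<bar>j x - j y\<bar>"
        using separated j xy Tm_sub by blast
      then show False
        using j[OF xy(1)] j[OF xy(2)] not_less xy(3) by auto
    qed
    have "inj_on j Z"
    proof (rule inj_onI)
      fix x y assume "x \<in> Z" "y \<in> Z" "j x = j y"
      then show "x = y"
        using j_mono[of x y] j_mono[of y x] by (cases x y rule: linorder_cases) auto
    qed
    then have "card (j ` Z) = card Tm"
      using cardZ sm(2) by (simp add: card_image Z_def Tm_def)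
    then have jZ: "j ` Z = Tm"
      using j finTm by (intro card_subset_eq) auto
    let ?z = "kth_smallest Z i" and ?s = "kth_smallest T i"
    have i': "1 \<le> i" "i \<le> card {t \<in> T. t \<le> sm}" using i sm(2) by auto
    have "{t \<in> Z. t \<le> S} = Z" by (auto simp: Z_def)
    then have "i \<le> card {t \<in> Z. t \<le> S}"
      using i cardZ unfolding Z_def by simp
    moreover have "finite {t \<in> Z. t \<le> x}" for x
      by (rule finite_subset[OF _ finZ]) auto
    ultimately have z: "?z \<in> Z" "card {t \<in> Z. t \<le> ?z} = i"
      using kth_smallest_properties[of Z i S] i'(1) by blast+
    have s: "?s \<in> T" "?s \<le> sm" "card {t \<in> T. t \<le> ?s} = i"
      using kth_smallest_properties[OF fin i'(2) i'(1)] by blast+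
    have "kth_smallest (j ` Z) i = j ?z"
      using j_mono z i by (intro kth_smallest_image) auto
    moreover have "kth_smallest Tm i = ?s"
      unfolding Tm_def using s i by (intro kth_smallest_truncate) auto
    ultimately have "j ?z = ?s" using jZ by simp
    then show "\<bar>kth_smallest {r. 0 < r \<and> r \<le> S \<and> w r = 0} i - kth_smallest T i\<bar> < \<epsilon>"
      using j[OF z(1)] h0 h(2) by (simp add: Z_def)
  qed
qed

section \<open>Radial Emden equations\<close>

text \<open>
  The equation says \<open>(r\<^bsup>n-1\<^esup> h)' = - r\<^bsup>n-1+\<alpha>\<^esup> k\<close>. So \<open>\<plusminus>r\<^bsup>n-1\<^esup> h - M r\<^bsup>n+\<alpha>\<^esup>/(n+\<alpha>)\<close> is decreasing, and it vanishes at 0.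
\<close>

lemma flux_bound:
  fixes h k :: "real \<Rightarrow> real" and n \<alpha> M S :: real
  assumes n: "1 < n" and \<alpha>: "0 \<le> \<alpha>"
    and cont: "continuous_on {0..<S} h" and h0: "h 0 = 0"
    and der: "\<And>r. 0 < r \<Longrightarrow> r < S \<Longrightarrow>
      (h has_real_derivative (- (n - 1) / r * h r - r powr \<alpha> * k r)) (at r)"
    and k: "\<And>r. 0 < r \<Longrightarrow> r < S \<Longrightarrow> \<bar>k r\<bar> \<le> M"
    and r: "0 \<le> r" "r < S"
  shows "\<bar>h r\<bar> \<le> M * r powr (1 + \<alpha>) / (n + \<alpha>)"
proof (cases "r = 0")
  case True
  then show ?thesis using h0 by simp
next
  case False
  then have rpos: "0 < r" using r by simp
  have main: "c * h r \<le> M * r powr (1 + \<alpha>) / (n + \<alpha>)" if c: "c = 1 \<or> c = -1" for c :: real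
  proof -
    let ?F = "\<lambda>t. c * (t powr (n - 1) * h t) - M * t powr (n + \<alpha>) / (n + \<alpha>)"
    have "?F 0 \<ge> ?F r"
    proof (rule DERIV_nonpos_imp_decreasing_open[where f = ?F and a = 0 and b = r])
      show "0 \<le> r" by fact
    next
      fix x assume x: "0 < x" "x < r"
      have xS: "x < S" using x r by simp
      have p1: "x powr (n - 1 - 1) = x powr (n - 1) / x"
        using x by (simp add: powr_diff power2_eq_square)
      have p2: "x powr (n + \<alpha> - 1) = x powr (n - 1) * x powr \<alpha>"
        using x by (simp flip: powr_add add: algebra_simps)
      have D: "(?F has_real_derivative
          c * ((n - 1) * x powr (n - 1 - 1) * h x
             + x powr (n - 1) * (- (n - 1) / x * h x - x powr \<alpha> * k x))
          - M * ((n + \<alpha>) * x powr (n + \<alpha> - 1)) / (n + \<alpha>)) (at x)"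
        using x n \<alpha> by (auto intro!: derivative_eq_intros der[OF x(1) xS])
      have "c * ((n - 1) * x powr (n - 1 - 1) * h x
             + x powr (n - 1) * (- (n - 1) / x * h x - x powr \<alpha> * k x))
          - M * ((n + \<alpha>) * x powr (n + \<alpha> - 1)) / (n + \<alpha>)
          = - (x powr (n - 1) * x powr \<alpha>) * (c * k x + M)"
        using x n \<alpha> unfolding p1 p2 by (simp add: field_simps)
      also have "\<dots> \<le> 0"
        using k[OF x(1) xS] c by (auto simp: abs_le_iff mult_nonneg_nonneg)
      finally show "\<exists>y. (?F has_real_derivative y) (at x) \<and> y \<le> 0"
        using D by blast
    next
      have ch: "continuous_on {0..r} h"
        by (rule continuous_on_subset[OF cont]) (use r in auto)
      show "continuous_on {0..r} ?F"
        by (intro continuous_intros ch continuous_on_powr') (use n \<alpha> in auto)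
    qed
    then have "r powr (n - 1) * (c * h r) \<le> M * r powr (n + \<alpha>) / (n + \<alpha>)"
      by (simp add: h0 mult.left_commute)
    also have "r powr (n + \<alpha>) = r powr (n - 1) * r powr (1 + \<alpha>)"
      by (simp flip: powr_add)
    also have "M * (r powr (n - 1) * r powr (1 + \<alpha>)) / (n + \<alpha>)
      = r powr (n - 1) * (M * r powr (1 + \<alpha>) / (n + \<alpha>))"
      by simp
    finally show ?thesis
      using rpos by (simp only: mult_le_cancel_left_pos powr_gt_zero)
  qed
  from main[of 1] main[of "-1"] show ?thesis by auto
qed

text \<open>The nonlinearity \<open>|y|\<^bsup>p-1\<^esup> y\<close>. For \<open>p = 1\<close> it is the identity also at \<open>y = 0\<close>, where \<open>0 powr 0 = 0\<close> does no
  harm; thus the linear limit equation is the instance \<open>p = 1\<close> of the nonlinear one.\<close>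

definition spow :: "real \<Rightarrow> real \<Rightarrow> real" where
  "spow p y = \<bar>y\<bar> powr (p - 1) * y"

lemma spow_one [simp]: "spow 1 y = y"
  by (simp add: spow_def)

lemma abs_spow_le:
  assumes "1 \<le> p" "\<bar>y\<bar> \<le> B"
  shows "\<bar>spow p y\<bar> \<le> B powr (p - 1) * B"
proof -
  have "\<bar>y\<bar> powr (p - 1) \<le> B powr (p - 1)"
    using assms by (intro powr_mono2) auto
  then show ?thesis
    unfolding spow_def abs_mult using assms by (intro mult_mono) auto
qed

lemma spow_mult: "spow p (c * y) = \<bar>c\<bar> powr (p - 1) * c * spow p y"
  by (simp add: spow_def abs_mult powr_mult)

text \<open>With \<open>a = |y|\<close> the difference is \<open>a (1 - a\<^bsup>p-1\<^esup>) \<le> (p - 1) a ln (1/a)\<close>, and \<open>a ln (1/a) \<le> 1 - a\<close>.\<close>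

lemma spow_near_identity:
  assumes "1 \<le> p" "\<bar>y\<bar> \<le> 1"
  shows "\<bar>spow p y - y\<bar> \<le> p - 1"
proof (cases "y = 0")
  case False
  let ?a = "\<bar>y\<bar>"
  have a: "0 < ?a" using False by simp
  have "1 + (p - 1) * ln ?a \<le> exp ((p - 1) * ln ?a)"
    by (rule exp_ge_add_one_self)
  then have e: "1 - ?a powr (p - 1) \<le> (p - 1) * (- ln ?a)"
    unfolding powr_def using False by (simp only: abs_eq_0 if_False)
  have "ln (1 / ?a) \<le> 1 / ?a - 1"
    using a by (intro ln_le_minus_one) simp
  then have "?a * (- ln ?a) \<le> ?a * (1 / ?a - 1)"
    using a by (intro mult_left_mono) (auto simp: ln_div)
  also have "\<dots> \<le> 1" using a by (simp add: field_simps)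
  finally have l: "?a * (- ln ?a) \<le> 1" .
  have "?a powr (p - 1) \<le> 1 powr (p - 1)"
    using assms by (intro powr_mono2) auto
  then have le1: "?a powr (p - 1) \<le> 1" by simp
  have "\<bar>spow p y - y\<bar> = ?a * (1 - ?a powr (p - 1))"
  proof -
    have "spow p y - y = - (y * (1 - ?a powr (p - 1)))"
      by (simp add: spow_def algebra_simps)
    then show ?thesis using le1 by (simp add: abs_mult)
  qed
  also have "\<dots> \<le> ?a * ((p - 1) * (- ln ?a))"
    using e by (intro mult_left_mono) auto
  also have "\<dots> = (p - 1) * (?a * (- ln ?a))" by simp
  also have "\<dots> \<le> (p - 1) * 1"
    using l assms by (intro mult_left_mono) auto
  finally show ?thesis by simp
qed (use assms in \<open>simp add: spow_def\<close>)

lemma DERIV_abs_powr: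
  assumes "1 \<le> p"
  shows "((\<lambda>y. \<bar>y\<bar> powr (p + 1) / (p + 1)) has_real_derivative spow p y) (at y)"
proof (cases y "0::real" rule: linorder_cases)
  case greater
  have "((\<lambda>y. y powr (p + 1) / (p + 1)) has_real_derivative spow p y) (at y)"
    using greater assms by (auto intro!: derivative_eq_intros simp: spow_def powr_diff)
  then show ?thesis
    by (rule has_field_derivative_transform_within_open[where S="{0<..}"]) (use greater in auto)
next
  case less
  have "((\<lambda>y. (- y) powr (p + 1) / (p + 1)) has_real_derivative spow p y) (at y)"
    using less assms by (auto intro!: derivative_eq_intros simp: spow_def powr_diff)
  then show ?thesis
    by (rule has_field_derivative_transform_within_open[where S="{..<0}"]) (use less in auto)
next
  case equal
  have "((\<lambda>h::real. \<bar>h\<bar> powr p / (p + 1)) \<longlongrightarrow> \<bar>0\<bar> powr p / (p + 1)) (at 0)"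
    using assms by (intro tendsto_intros) auto
  then have "((\<lambda>h::real. \<bar>h\<bar> powr p / (p + 1)) \<longlongrightarrow> 0) (at 0)"
    by simp
  then have "((\<lambda>h::real. \<bar>0 + h\<bar> powr (p + 1) / (p + 1) / h) \<longlongrightarrow> 0) (at 0)"
  proof (rule Lim_null_comparison[rotated])
    show "\<forall>\<^sub>F h in at 0. norm (\<bar>0 + h\<bar> powr (p + 1) / (p + 1) / h) \<le> \<bar>h::real\<bar> powr p / (p + 1)"
      unfolding eventually_at_topological
    proof (intro exI[of _ UNIV] conjI ballI impI)
      fix h :: real assume "h \<noteq> 0"
      then have "norm (\<bar>0 + h\<bar> powr (p + 1) / (p + 1) / h) = \<bar>h\<bar> powr p / (p + 1)"
        using assms by (simp add: powr_add abs_mult)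
      then show "norm (\<bar>0 + h\<bar> powr (p + 1) / (p + 1) / h) \<le> \<bar>h\<bar> powr p / (p + 1)"
        by simp
    qed auto
  qed
  then show ?thesis
    using equal assms by (simp add: DERIV_def spow_def)
qed

text \<open>
  A profile \<open>w\<close> with derivative \<open>w1\<close>, for a real dimension \<open>n\<close>. Continuity up to \<open>S\<close> is required only of \<open>w\<close>,
  because a classical solution is \<open>C\<^sup>2\<close> in the open ball but merely continuous on the closed one.
\<close>

locale emden_profile =
  fixes n \<alpha> l p S :: real and w w1 :: "real \<Rightarrow> real"
  assumes n_ge: "2 \<le> n" and \<alpha>_nonneg: "0 \<le> \<alpha>" and l_pos: "0 < l" and p_ge: "1 \<le> p" and S_pos: "0 < S"
    and w_cont: "continuous_on {0..S} w" and w1_cont: "continuous_on {0..<S} w1" and w1_0: "w1 0 = 0"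
    and w_der: "\<And>r. 0 < r \<Longrightarrow> r < S \<Longrightarrow> (w has_real_derivative w1 r) (at r)"
    and w1_der: "\<And>r. 0 < r \<Longrightarrow> r < S \<Longrightarrow>
      (w1 has_real_derivative (- (n - 1) / r * w1 r - r powr \<alpha> * (l * spow p (w r)))) (at r)"
begin

text \<open>The decay of \<open>w1\<close> at 0 that makes the kinetic term of the energy vanish there.\<close>

lemma w1_bound: "\<exists>M. \<forall>r. 0 \<le> r \<and> r < S \<longrightarrow> \<bar>w1 r\<bar> \<le> M * r powr (1 + \<alpha>)"
proof -
  have "bounded (w ` {0..S})"
    by (intro compact_imp_bounded compact_continuous_image w_cont compact_Icc)
  then obtain B where B: "\<And>r. 0 \<le> r \<Longrightarrow> r \<le> S \<Longrightarrow> \<bar>w r\<bar> \<le> B"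
    unfolding bounded_iff by (force simp: real_norm_def)
  let ?M = "l * (B powr (p - 1) * B)"
  have "\<bar>w1 r\<bar> \<le> ?M / (n + \<alpha>) * r powr (1 + \<alpha>)" if r: "0 \<le> r" "r < S" for r
  proof -
    have "\<bar>w1 r\<bar> \<le> ?M * r powr (1 + \<alpha>) / (n + \<alpha>)"
    proof (rule flux_bound[OF _ \<alpha>_nonneg w1_cont w1_0 w1_der _ r])
      fix t assume t: "0 < t" "t < S"
      have "\<bar>spow p (w t)\<bar> \<le> B powr (p - 1) * B"
        using t by (intro abs_spow_le p_ge B) auto
      then show "\<bar>l * spow p (w t)\<bar> \<le> ?M"
        using l_pos by (simp add: abs_mult)
    qed (use n_ge in auto)
    then show ?thesis by simp
  qed
  then show ?thesis by blast
qed

text \<open>The kinetic term is divided by \<open>r\<^sup>\<alpha>\<close>; the two contributions of the nonlinearity to the derivative then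
  cancel, and what remains is damping. At \<open>r = 0\<close> only the potential term is left, since \<open>w1 0 = 0\<close>.\<close>

definition energy :: "real \<Rightarrow> real" where
  "energy r = (w1 r)\<^sup>2 * r powr (- \<alpha>) / 2 + l * (\<bar>w r\<bar> powr (p + 1) / (p + 1))"

lemma energy_nonneg: "0 \<le> energy r"
  using l_pos p_ge by (simp add: energy_def)

lemma energy_der:
  assumes r: "0 < r" "r < S"
  shows "(energy has_real_derivative - (n - 1 + \<alpha> / 2) * ((w1 r)\<^sup>2 * r powr (- \<alpha>)) / r) (at r)"
proof -
  have G: "((\<lambda>t. \<bar>w t\<bar> powr (p + 1) / (p + 1)) has_real_derivative spow p (w r) * w1 r) (at r)"
    by (rule DERIV_chain2[OF DERIV_abs_powr[OF p_ge] w_der[OF r]])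
  have P: "((\<lambda>t. t powr (- \<alpha>)) has_real_derivative - \<alpha> * r powr (- \<alpha>) / r) (at r)"
    using r by (auto intro!: derivative_eq_intros simp: powr_diff)
  have Q: "((\<lambda>t. (w1 t)\<^sup>2) has_real_derivative
      2 * w1 r * (- (n - 1) / r * w1 r - r powr \<alpha> * (l * spow p (w r)))) (at r)"
    using DERIV_power[OF w1_der[OF r], of 2] by (simp add: mult_ac)
  have "((\<lambda>r. (w1 r)\<^sup>2 * r powr (- \<alpha>) / 2 + l * (\<bar>w r\<bar> powr (p + 1) / (p + 1))) has_real_derivative
      (2 * w1 r * (- (n - 1) / r * w1 r - r powr \<alpha> * (l * spow p (w r))) * r powr (- \<alpha>)
        + (w1 r)\<^sup>2 * (- \<alpha> * r powr (- \<alpha>) / r)) / 2 + l * (spow p (w r) * w1 r)) (at r)"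
    using DERIV_add[OF DERIV_cdivide[OF DERIV_mult[OF Q P], of 2] DERIV_cmult[OF G, of l]]
    by (simp add: algebra_simps)
  moreover have "r powr \<alpha> * r powr (- \<alpha>) = 1"
    using r by (simp flip: powr_add)
  then have "(2 * w1 r * (- (n - 1) / r * w1 r - r powr \<alpha> * (l * spow p (w r))) * r powr (- \<alpha>)
        + (w1 r)\<^sup>2 * (- \<alpha> * r powr (- \<alpha>) / r)) / 2 + l * (spow p (w r) * w1 r)
      = - (n - 1 + \<alpha> / 2) * ((w1 r)\<^sup>2 * r powr (- \<alpha>)) / r"
    using r by (simp add: field_simps power2_eq_square)
  ultimately show ?thesis by (simp add: energy_def[abs_def])
qed

lemma energy_cont: "continuous_on {0..<S} energy"
proof (unfold continuous_on_eq_continuous_within, intro ballI)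
  fix r assume "r \<in> {0..<S}"
  then consider "r = 0" | "0 < r" "r < S" by force
  then show "continuous (at r within {0..<S}) energy"
  proof cases
    case 2
    then show ?thesis
      using energy_der[of r] DERIV_isCont continuous_at_imp_continuous_at_within by blast
  next
    case 1
    obtain M where M: "\<And>r. 0 \<le> r \<Longrightarrow> r < S \<Longrightarrow> \<bar>w1 r\<bar> \<le> M * r powr (1 + \<alpha>)"
      using w1_bound by blast
    have "((\<lambda>r. M\<^sup>2 * r powr (2 + \<alpha>)) \<longlongrightarrow> M\<^sup>2 * 0 powr (2 + \<alpha>)) (at 0 within {0..<S})"
      using \<alpha>_nonneg by (intro tendsto_intros) (auto simp: eventually_at_filter)
    then have lim: "((\<lambda>r. M\<^sup>2 * r powr (2 + \<alpha>)) \<longlongrightarrow> 0) (at 0 within {0..<S})"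
      by simp
    have kinetic: "((\<lambda>r. (w1 r)\<^sup>2 * r powr (- \<alpha>)) \<longlongrightarrow> 0) (at 0 within {0..<S})"
    proof (rule Lim_null_comparison[OF _ lim])
      have "norm ((w1 r)\<^sup>2 * r powr (- \<alpha>)) \<le> M\<^sup>2 * r powr (2 + \<alpha>)" if "0 < r" "r < S" for r
      proof -
        have "(w1 r)\<^sup>2 \<le> (M * r powr (1 + \<alpha>))\<^sup>2"
          using M[of r] that by (subst abs_le_square_iff[symmetric]) auto
        then have "(w1 r)\<^sup>2 * r powr (- \<alpha>) \<le> (M * r powr (1 + \<alpha>))\<^sup>2 * r powr (- \<alpha>)"
          by (rule mult_right_mono) simp
        also have "\<dots> = M\<^sup>2 * (r powr (1 + \<alpha>) * r powr (1 + \<alpha>) * r powr (- \<alpha>))"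
          by (simp add: power2_eq_square)
        also have "r powr (1 + \<alpha>) * r powr (1 + \<alpha>) * r powr (- \<alpha>) = r powr (2 + \<alpha>)"
          by (simp add: add.commute flip: powr_add)
        finally show ?thesis by simp
      qed
      then show "\<forall>\<^sub>F r in at 0 within {0..<S}. norm ((w1 r)\<^sup>2 * r powr (- \<alpha>)) \<le> M\<^sup>2 * r powr (2 + \<alpha>)"
        unfolding eventually_at_topological by (intro exI[of _ UNIV]) auto
    qed
    have "(w \<longlongrightarrow> w 0) (at 0 within {0..S})"
      using w_cont S_pos by (simp add: continuous_on_def)
    then have "(w \<longlongrightarrow> w 0) (at 0 within {0..<S})"
      by (rule tendsto_within_subset) auto
    then have "(energy \<longlongrightarrow> 0 / 2 + l * (\<bar>w 0\<bar> powr (p + 1) / (p + 1))) (at 0 within {0..<S})"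
      unfolding energy_def[abs_def] using p_ge by (intro tendsto_intros kinetic) auto
    then show ?thesis
      using 1 by (simp add: continuous_within energy_def w1_0)
  qed
qed

text \<open>The energy decreases, and at the centre it is purely potential.\<close>

lemma abs_w_le:
  assumes r: "0 \<le> r" "r < S"
  shows "\<bar>w r\<bar> \<le> \<bar>w 0\<bar>"
proof -
  have "energy r \<le> energy 0"
  proof (rule DERIV_nonpos_imp_decreasing_open[where f = energy, OF r(1)])
    fix x assume x: "0 < x" "x < r"
    have "- (n - 1 + \<alpha> / 2) * ((w1 x)\<^sup>2 * x powr (- \<alpha>)) / x \<le> 0"
      using x n_ge \<alpha>_nonneg by (intro divide_nonpos_pos mult_nonpos_nonneg) auto
    then show "\<exists>y. (energy has_real_derivative y) (at x) \<and> y \<le> 0"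
      using energy_der[of x] x r by auto
  qed (rule continuous_on_subset[OF energy_cont], use r in auto)
  moreover have "energy r \<ge> l * (\<bar>w r\<bar> powr (p + 1) / (p + 1))"
    by (simp add: energy_def)
  moreover have "energy 0 = l * (\<bar>w 0\<bar> powr (p + 1) / (p + 1))"
    by (simp add: energy_def w1_0)
  ultimately have "l * (\<bar>w r\<bar> powr (p + 1) / (p + 1)) \<le> l * (\<bar>w 0\<bar> powr (p + 1) / (p + 1))"
    by linarith
  then have "\<bar>w r\<bar> powr (p + 1) \<le> \<bar>w 0\<bar> powr (p + 1)"
    using l_pos p_ge by (simp add: divide_le_cancel)
  then show ?thesis
    using powr_less_mono2[of "p + 1" "\<bar>w 0\<bar>" "\<bar>w r\<bar>"] p_ge by force
qed

text \<open>The damping takes away the kinetic energy at the relative rate \<open>K/r\<close> only, so the factor \<open>r\<^sup>K\<close> outweighs it. This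
  is the backward estimate behind unique continuation.\<close>

lemma weighted_energy_mono:
  assumes ab: "0 < a" "a \<le> b" "b < S"
  defines "K \<equiv> 2 * (n - 1) + \<alpha>"
  shows "a powr K * energy a \<le> b powr K * energy b"
proof (rule DERIV_nonneg_imp_increasing_open[where f = "\<lambda>r. r powr K * energy r", OF ab(2)])
  fix x assume x: "a < x" "x < b"
  then have x': "0 < x" "x < S" using ab by auto
  have "((\<lambda>r. r powr K * energy r) has_real_derivative
      (K * x powr K / x) * energy x
      + x powr K * (- (n - 1 + \<alpha> / 2) * ((w1 x)\<^sup>2 * x powr (- \<alpha>)) / x)) (at x)"
    using x' by (auto intro!: derivative_eq_intros energy_der simp: powr_diff)
  moreover have "(K * x powr K / x) * energy x
      + x powr K * (- (n - 1 + \<alpha> / 2) * ((w1 x)\<^sup>2 * x powr (- \<alpha>)) / x)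
      = x powr K / x * (K * (l * (\<bar>w x\<bar> powr (p + 1) / (p + 1))))"
  proof -
    define P where "P = \<bar>w x\<bar> powr (p + 1) / (p + 1)"
    define X where "X = x powr K"
    define Q where "Q = (w1 x)\<^sup>2 * x powr (- \<alpha>)"
    have K2: "n - 1 + \<alpha> / 2 = K / 2" by (simp add: K_def)
    show ?thesis
      using x' unfolding K2 energy_def P_def[symmetric] X_def[symmetric] Q_def[symmetric]
      by (simp add: field_simps)
  qed
  moreover have "\<dots> \<ge> 0"
    using x' n_ge \<alpha>_nonneg l_pos p_ge by (simp add: K_def)
  ultimately show "\<exists>y. ((\<lambda>r. r powr K * energy r) has_real_derivative y) (at x) \<and> 0 \<le> y"
    by metis
next
  have "continuous_on {a..b} energy"
    by (rule continuous_on_subset[OF energy_cont]) (use ab in auto)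
  then show "continuous_on {a..b} (\<lambda>r. r powr K * energy r)"
    using ab by (intro continuous_intros) auto
qed

text \<open>
  At a critical point with a small value the energy is small, hence by the weighted monotonicity it is small
  everywhere to the left. Stated for a family of critical points with arbitrarily small values, this covers a double zero
  as well as an accumulation of zeros, also at the end \<open>S\<close>, where \<open>w1\<close> is not under control.
\<close>

lemma small_critical_values_imp_zero:
  assumes t: "0 < t" "t \<le> S"
    and crit: "\<And>r e. 0 < r \<Longrightarrow> r < t \<Longrightarrow> 0 < e \<Longrightarrow> \<exists>c. r < c \<and> c < S \<and> w1 c = 0 \<and> \<bar>w c\<bar> < e"
  shows "w 0 = 0"
proof -
  define K where "K = 2 * (n - 1) + \<alpha>"
  have zero: "w r = 0" if r: "0 < r" "r < t" for r
  proof -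
    have bound: "r powr K * energy r \<le> S powr K * l * e" if e: "0 < e" "e < 1" for e
    proof -
      obtain c where c: "r < c" "c < S" "w1 c = 0" "\<bar>w c\<bar> < e"
        using crit[OF r e(1)] by blast
      have "r powr K * energy r \<le> c powr K * energy c"
        unfolding K_def using weighted_energy_mono[of r c] c r by simp
      also have "\<dots> \<le> S powr K * (l * e)"
      proof (rule mult_mono)
        show "c powr K \<le> S powr K"
          using c r n_ge \<alpha>_nonneg by (intro powr_mono2) (auto simp: K_def)
        have "\<bar>w c\<bar> powr (p + 1) \<le> e powr (p + 1)"
          using c p_ge by (intro powr_mono2) auto
        also have "\<dots> \<le> e powr 1"
          using e p_ge by (intro powr_mono') auto
        finally have "\<bar>w c\<bar> powr (p + 1) \<le> e" using e by simp
        then have "\<bar>w c\<bar> powr (p + 1) / (p + 1) \<le> e / 1"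
          using p_ge e by (intro frac_le) auto
        then show "energy c \<le> l * e"
          using l_pos c(3) by (simp add: energy_def times_divide_eq_right[symmetric] del: times_divide_eq_right)
      qed (use energy_nonneg in auto)
      finally show ?thesis by (simp add: mult.assoc)
    qed
    have "((\<lambda>e. S powr K * l * e) \<longlongrightarrow> S powr K * l * 0) (at_right 0)"
      by (intro tendsto_intros)
    moreover have "\<forall>\<^sub>F e in at_right 0. r powr K * energy r \<le> S powr K * l * e"
      unfolding eventually_at_right_field using bound by (intro exI[of _ 1]) auto
    ultimately have "r powr K * energy r \<le> S powr K * l * 0"
      by (rule tendsto_lowerbound) simp
    then have "energy r \<le> 0"
      using r by (simp add: mult_le_0_iff)
    moreover have "energy r \<ge> l * (\<bar>w r\<bar> powr (p + 1) / (p + 1))"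
      by (simp add: energy_def)
    ultimately have "l * (\<bar>w r\<bar> powr (p + 1) / (p + 1)) \<le> 0" by linarith
    then have "\<bar>w r\<bar> powr (p + 1) \<le> 0"
      using l_pos p_ge by (simp add: mult_le_0_iff divide_le_0_iff)
    then show ?thesis by simp
  qed
  have "(w \<longlongrightarrow> w 0) (at 0 within {0..S})"
    using w_cont S_pos by (simp add: continuous_on_def)
  then have "(w \<longlongrightarrow> w 0) (at_right 0)"
    using S_pos at_within_Icc_at_right by metis
  moreover have "(w \<longlongrightarrow> 0) (at_right 0)"
  proof (rule tendsto_eventually)
    show "\<forall>\<^sub>F r in at_right 0. w r = 0"
      unfolding eventually_at_right_field using zero t by (intro exI[of _ t]) auto
  qed
  ultimately show ?thesis
    using tendsto_unique trivial_limit_at_right_real by blast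
qed

lemma zeros_simple:
  assumes "w 0 \<noteq> 0" "0 < c" "c < S" "w c = 0"
  shows "w1 c \<noteq> 0"
proof
  assume "w1 c = 0"
  then have "w 0 = 0"
    using assms by (intro small_critical_values_imp_zero[of c]) auto
  then show False using assms by simp
qed

text \<open>Between two zeros close to an accumulation point of zeros there is a critical point, by Rolle's theorem,
  and its value is small by continuity.\<close>

lemma finite_zeros:
  assumes "w 0 \<noteq> 0"
  shows "finite {r. 0 \<le> r \<and> r \<le> S \<and> w r = 0}"
proof (rule ccontr)
  let ?Z = "{r. 0 \<le> r \<and> r \<le> S \<and> w r = 0}"
  assume inf: "infinite ?Z"
  have "?Z \<subseteq> {0..S}" by auto
  then obtain t where t: "t \<in> {0..S}" "t islimpt ?Z"
    using compact_Icc[of 0 S] inf unfolding compact_eq_Bolzano_Weierstrass by blast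
  \<comment> \<open>A neighbourhood of a limit point contains infinitely many zeros; two of them allow Rolle's theorem.\<close>
  have two_zeros: "\<exists>a b. a \<in> ?Z \<and> b \<in> ?Z \<and> a < b \<and> \<bar>a - t\<bar> < d \<and> \<bar>b - t\<bar> < d" if "0 < d" for d
  proof -
    have "infinite (?Z \<inter> ball t d)"
      using t(2) \<open>0 < d\<close> by (simp add: islimpt_eq_infinite_ball)
    then obtain a b where "a \<in> ?Z \<inter> ball t d" "b \<in> ?Z \<inter> ball t d" "a < b"
    proof -
      obtain B where "card B = 2" "B \<subseteq> ?Z \<inter> ball t d"
        using infinite_arbitrarily_large[OF \<open>infinite (?Z \<inter> ball t d)\<close>] by blast
      then obtain x y where "x \<noteq> y" "x \<in> ?Z \<inter> ball t d" "y \<in> ?Z \<inter> ball t d"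
        by (auto simp: card_2_iff)
      then show ?thesis
        using that[of x y] that[of y x] by (cases x y rule: linorder_cases) auto
    qed
    then show ?thesis
      by (intro exI[of _ a] exI[of _ b]) (auto simp: dist_real_def abs_minus_commute)
  qed
  have wt: "w t = 0"
  proof (rule ccontr)
    assume "w t \<noteq> 0"
    then obtain d where "0 < d" "\<And>x. x \<in> {0..S} \<Longrightarrow> dist x t < d \<Longrightarrow> dist (w x) (w t) < \<bar>w t\<bar>"
      using w_cont t(1) unfolding continuous_on_iff by (metis zero_less_abs_iff)
    then show False
      using two_zeros[of d] by (fastforce simp: dist_real_def)
  qed
  have "w 0 = 0"
  proof (rule small_critical_values_imp_zero)
    show "0 < t" "t \<le> S" using t wt assms by (auto simp: less_le)
  next
    fix r e :: real assume r: "0 < r" "r < t" and e: "0 < e"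
    obtain d where d: "0 < d" "\<And>x. x \<in> {0..S} \<Longrightarrow> dist x t < d \<Longrightarrow> dist (w x) (w t) < e"
      using w_cont t(1) e unfolding continuous_on_iff by metis
    obtain a b where ab: "a \<in> ?Z" "b \<in> ?Z" "a < b" "\<bar>a - t\<bar> < min d (t - r)" "\<bar>b - t\<bar> < min d (t - r)"
      using two_zeros[of "min d (t - r)"] d r by auto
    have "\<exists>c>a. c < b \<and> (\<lambda>y. w1 c * y) = (\<lambda>v. 0)"
    proof (rule Rolle_deriv[where f = w])
      show "continuous_on {a..b} w"
        by (rule continuous_on_subset[OF w_cont]) (use ab in auto)
      fix x assume "a < x" "x < b"
      then show "(w has_derivative (\<lambda>y. w1 x * y)) (at x)"
        using w_der[of x] ab r by (auto simp: has_field_derivative_def)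
    qed (use ab in auto)
    then obtain c where c: "a < c" "c < b" "w1 c = 0"
      by (metis mult_1_right)
    then show "\<exists>c>r. c < S \<and> w1 c = 0 \<and> \<bar>w c\<bar> < e"
      using ab d(2)[of c] wt by (intro exI[of _ c]) (auto simp: dist_real_def)
  qed
  with assms show False by simp
qed

end

text \<open>Stretching the radius by \<open>\<sigma>\<close> and dividing by \<open>c\<close> changes only the coefficient and the length of the interval.\<close>

lemma emden_profile_scale:
  assumes prof: "emden_profile n \<alpha> l p S w w1" and c: "c \<noteq> 0" and \<sigma>: "0 < \<sigma>"
  shows "emden_profile n \<alpha> (l * \<bar>c\<bar> powr (p - 1) / \<sigma> powr (2 + \<alpha>)) p (\<sigma> * S)
    (\<lambda>s. w (s / \<sigma>) / c) (\<lambda>s. w1 (s / \<sigma>) / (\<sigma> * c))"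
proof -
  interpret emden_profile n \<alpha> l p S w w1 by fact
  show ?thesis
  proof
    show "2 \<le> n" "0 \<le> \<alpha>" "1 \<le> p" "w1 (0 / \<sigma>) / (\<sigma> * c) = 0" "0 < \<sigma> * S"
      "0 < l * \<bar>c\<bar> powr (p - 1) / \<sigma> powr (2 + \<alpha>)"
      using n_ge \<alpha>_nonneg p_ge w1_0 S_pos l_pos c \<sigma> by auto
    have in_range: "(\<lambda>s. s / \<sigma>) ` {0..\<sigma> * S} \<subseteq> {0..S}" "(\<lambda>s. s / \<sigma>) ` {0..<\<sigma> * S} \<subseteq> {0..<S}"
      using \<sigma> by (auto simp: field_simps)
    have "continuous_on {0..\<sigma> * S} (\<lambda>s. w (s / \<sigma>))"
      using \<sigma> by (intro continuous_on_compose2[OF w_cont _ in_range(1)] continuous_intros) auto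
    then show "continuous_on {0..\<sigma> * S} (\<lambda>s. w (s / \<sigma>) / c)"
      using c by (intro continuous_intros) auto
    have "continuous_on {0..<\<sigma> * S} (\<lambda>s. w1 (s / \<sigma>))"
      using \<sigma> by (intro continuous_on_compose2[OF w1_cont _ in_range(2)] continuous_intros) auto
    then show "continuous_on {0..<\<sigma> * S} (\<lambda>s. w1 (s / \<sigma>) / (\<sigma> * c))"
      using c \<sigma> by (intro continuous_intros) auto
  next
    fix s assume s: "0 < s" "s < \<sigma> * S"
    then have s': "0 < s / \<sigma>" "s / \<sigma> < S"
      using \<sigma> by (auto simp: field_simps)
    have inner: "((\<lambda>s. s / \<sigma>) has_real_derivative 1 / \<sigma>) (at s)"
      using \<sigma> by (auto intro!: derivative_eq_intros)
    show "((\<lambda>s. w (s / \<sigma>) / c) has_real_derivative w1 (s / \<sigma>) / (\<sigma> * c)) (at s)"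
      using DERIV_cdivide[OF DERIV_chain2[OF w_der[OF s'] inner], of c] by simp
    have "((\<lambda>s. w1 (s / \<sigma>) / (\<sigma> * c)) has_real_derivative
        (- (n - 1) / (s / \<sigma>) * w1 (s / \<sigma>) - (s / \<sigma>) powr \<alpha> * (l * spow p (w (s / \<sigma>)))) * (1 / \<sigma>)
          / (\<sigma> * c)) (at s)"
      by (rule DERIV_cdivide[OF DERIV_chain2[OF w1_der[OF s'] inner]])
    moreover have "spow p (w (s / \<sigma>)) = \<bar>c\<bar> powr (p - 1) * c * spow p (w (s / \<sigma>) / c)"
      using spow_mult[of p c "w (s / \<sigma>) / c"] c by simp
    then have "(- (n - 1) / (s / \<sigma>) * w1 (s / \<sigma>) - (s / \<sigma>) powr \<alpha> * (l * spow p (w (s / \<sigma>)))) * (1 / \<sigma>)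
          / (\<sigma> * c)
        = - (n - 1) / s * (w1 (s / \<sigma>) / (\<sigma> * c)) - s powr \<alpha> *
           (l * \<bar>c\<bar> powr (p - 1) / \<sigma> powr (2 + \<alpha>) * spow p (w (s / \<sigma>) / c))"
      using \<sigma> c s by (simp add: powr_divide powr_add divide_simps) (simp add: algebra_simps power2_eq_square)
    ultimately show "((\<lambda>s. w1 (s / \<sigma>) / (\<sigma> * c)) has_real_derivative
        - (n - 1) / s * (w1 (s / \<sigma>) / (\<sigma> * c)) - s powr \<alpha> *
           (l * \<bar>c\<bar> powr (p - 1) / \<sigma> powr (2 + \<alpha>) * spow p (w (s / \<sigma>) / c))) (at s)"
      by simp
  qed
qed

lemma emden_profile_unit:
  assumes prof: "emden_profile n \<alpha> 1 p \<sigma> w w1"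
  shows "emden_profile n \<alpha> (\<sigma> powr (2 + \<alpha>)) p 1 (\<lambda>r. w (\<sigma> * r)) (\<lambda>r. \<sigma> * w1 (\<sigma> * r))"
proof -
  have \<sigma>: "0 < \<sigma>" using prof by (rule emden_profile.S_pos)
  have "1 * \<bar>1\<bar> powr (p - 1) / (1 / \<sigma>) powr (2 + \<alpha>) = \<sigma> powr (2 + \<alpha>)"
    using \<sigma> by (simp add: powr_divide)
  moreover have "1 / \<sigma> * \<sigma> = 1" "\<And>s. s / (1 / \<sigma>) = \<sigma> * s" "\<And>y. y / (1 / \<sigma> * 1) = \<sigma> * y" "\<And>y. y / 1 = (y::real)"
    using \<sigma> by auto
  ultimately show ?thesis
    using emden_profile_scale[OF prof, of 1 "1 / \<sigma>"] \<sigma> by (simp only:) simp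
qed

text \<open>
  Gronwall's inequality for \<open>H = (w - W)\<^sup>2 + (w1 - W1)\<^sup>2\<close>: the difference solves the linear equation up to the error
  \<open>spow p w - w\<close>, which is at most \<open>\<eta> = p - 1\<close>, and the singular first-order term has the good sign. With
  \<open>C = 2 T\<^sup>\<alpha> + 1\<close> this gives \<open>H' \<le> C (H + \<eta>\<^sup>2)\<close>, and \<open>H(0) = 0\<close>.
\<close>

lemma profile_comparison:
  assumes prof: "emden_profile n \<alpha> 1 p S w w1" and lin: "emden_profile n \<alpha> 1 1 S' W W1"
    and w0: "w 0 = 1" and W0: "W 0 = 1" and T: "T \<le> S" "T \<le> S'"
    and r: "0 \<le> r" "r < T"
  shows "(w r - W r)\<^sup>2 + (w1 r - W1 r)\<^sup>2 \<le> (p - 1)\<^sup>2 * exp ((2 * T powr \<alpha> + 1) * T)"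
proof -
  interpret A: emden_profile n \<alpha> 1 p S w w1 by fact
  interpret B: emden_profile n \<alpha> 1 1 S' W W1 by fact
  define C where "C = 2 * T powr \<alpha> + 1"
  define \<eta> where "\<eta> = p - 1"
  have \<eta>: "0 \<le> \<eta>" using A.p_ge by (simp add: \<eta>_def)
  let ?H = "\<lambda>t. (w t - W t)\<^sup>2 + (w1 t - W1 t)\<^sup>2"
  let ?F = "\<lambda>t. (?H t + \<eta>\<^sup>2) * exp (- C * t)"
  have "?F r \<le> ?F 0"
  proof (rule DERIV_nonpos_imp_decreasing_open[where f = ?F and a = 0 and b = r])
    fix t assume t: "0 < t" "t < r"
    have tS: "t < S" "t < S'" using t r T by auto
    define D where "D = w t - W t"
    define E where "E = w1 t - W1 t"
    define g where "g = spow p (w t) - w t"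
    define V where "V = 2 * D * E + 2 * E * (- (n - 1) / t * E - t powr \<alpha> * (D + g))"
    have d1: "((\<lambda>t. w t - W t) has_real_derivative E) (at t)"
      unfolding E_def by (intro DERIV_diff A.w_der B.w_der t tS)
    have "((\<lambda>t. w1 t - W1 t) has_real_derivative
        (- (n - 1) / t * w1 t - t powr \<alpha> * (1 * spow p (w t)))
        - (- (n - 1) / t * W1 t - t powr \<alpha> * (1 * spow 1 (W t)))) (at t)"
      by (intro DERIV_diff A.w1_der B.w1_der t tS)
    then have d2: "((\<lambda>t. w1 t - W1 t) has_real_derivative - (n - 1) / t * E - t powr \<alpha> * (D + g)) (at t)"
      by (simp add: D_def E_def g_def algebra_simps diff_divide_distrib add_divide_distrib)
    have dH: "(?H has_real_derivative V) (at t)"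
      using DERIV_add[OF DERIV_power[OF d1, of 2] DERIV_power[OF d2, of 2]]
      by (simp add: V_def D_def E_def algebra_simps)
    have dF: "(?F has_real_derivative (V - C * (?H t + \<eta>\<^sup>2)) * exp (- C * t)) (at t)"
      by (rule derivative_eq_intros dH refl)+ (simp add: algebra_simps)
    have "\<bar>w t\<bar> \<le> 1" using A.abs_w_le[of t] t tS w0 by simp
    then have g: "\<bar>g\<bar> \<le> \<eta>"
      unfolding g_def \<eta>_def by (intro spow_near_identity A.p_ge)
    have tT: "t powr \<alpha> \<le> T powr \<alpha>" "0 \<le> t powr \<alpha>"
      using t r A.\<alpha>_nonneg by (auto intro!: powr_mono2)
    have H: "?H t = D\<^sup>2 + E\<^sup>2" by (simp add: D_def E_def)
    have drift: "2 * E * (- (n - 1) / t * E) \<le> 0"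
    proof -
      have "2 * E * (- (n - 1) / t * E) = - (2 * (n - 1) / t * E\<^sup>2)"
        using t by (simp add: power2_eq_square field_simps)
      also have "\<dots> \<le> 0"
        using A.n_ge t by simp
      finally show ?thesis .
    qed
    have ab: "2 * (\<bar>a\<bar> * \<bar>b\<bar>) \<le> a\<^sup>2 + b\<^sup>2" for a b :: real
      using sum_squares_bound[of "\<bar>a\<bar>" "\<bar>b\<bar>"] by simp
    have "2 * D * E \<le> 2 * (\<bar>D\<bar> * \<bar>E\<bar>)"
      by (metis abs_ge_self abs_mult mult.assoc mult_le_cancel_left_pos zero_less_numeral)
    then have 1: "2 * D * E \<le> D\<^sup>2 + E\<^sup>2"
      using ab[of D E] by linarith
    have "- (2 * E * (D + g)) \<le> 2 * (\<bar>E\<bar> * (\<bar>D\<bar> + \<bar>g\<bar>))"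
    proof -
      have "- (E * (D + g)) \<le> \<bar>E\<bar> * \<bar>D + g\<bar>"
        by (metis abs_ge_minus_self abs_mult)
      also have "\<dots> \<le> \<bar>E\<bar> * (\<bar>D\<bar> + \<bar>g\<bar>)"
        by (intro mult_left_mono) auto
      finally show ?thesis by simp
    qed
    also have "\<dots> \<le> 2 * (\<bar>E\<bar> * (\<bar>D\<bar> + \<eta>))"
      using g by (intro mult_left_mono) auto
    also have "\<dots> \<le> (D\<^sup>2 + E\<^sup>2) + (E\<^sup>2 + \<eta>\<^sup>2)"
      using ab[of E D] ab[of E \<eta>] \<eta> by (simp add: algebra_simps)
    finally have "t powr \<alpha> * (- (2 * E * (D + g))) \<le> t powr \<alpha> * ((D\<^sup>2 + E\<^sup>2) + (E\<^sup>2 + \<eta>\<^sup>2))"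
      using tT by (intro mult_left_mono)
    also have "\<dots> \<le> T powr \<alpha> * ((D\<^sup>2 + E\<^sup>2) + (E\<^sup>2 + \<eta>\<^sup>2))"
      using tT by (intro mult_right_mono) auto
    also have "\<dots> \<le> T powr \<alpha> * (2 * (D\<^sup>2 + E\<^sup>2 + \<eta>\<^sup>2))"
      by (intro mult_left_mono) auto
    finally have 2: "2 * E * (- (t powr \<alpha> * (D + g))) \<le> 2 * T powr \<alpha> * (D\<^sup>2 + E\<^sup>2 + \<eta>\<^sup>2)"
      by (simp add: algebra_simps)
    have "V = 2 * D * E + 2 * E * (- (n - 1) / t * E) + 2 * E * (- (t powr \<alpha> * (D + g)))"
      by (simp add: V_def algebra_simps)
    also have "\<dots> \<le> (D\<^sup>2 + E\<^sup>2) + 2 * T powr \<alpha> * (D\<^sup>2 + E\<^sup>2 + \<eta>\<^sup>2)"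
      using 1 2 drift by linarith
    also have "\<dots> \<le> C * (D\<^sup>2 + E\<^sup>2 + \<eta>\<^sup>2)"
      by (simp add: C_def algebra_simps)
    finally have "V - C * (?H t + \<eta>\<^sup>2) \<le> 0"
      by (simp add: H)
    then have "(V - C * (?H t + \<eta>\<^sup>2)) * exp (- C * t) \<le> 0"
      by (intro mult_nonpos_nonneg) auto
    with dF show "\<exists>y. (?F has_real_derivative y) (at t) \<and> y \<le> 0" by blast
  next
    have sub: "{0..r} \<subseteq> {0..S}" "{0..r} \<subseteq> {0..<S}" "{0..r} \<subseteq> {0..S'}" "{0..r} \<subseteq> {0..<S'}"
      using r T by auto
    show "continuous_on {0..r} ?F"
      by (intro continuous_intros continuous_on_subset[OF A.w_cont sub(1)]
          continuous_on_subset[OF A.w1_cont sub(2)] continuous_on_subset[OF B.w_cont sub(3)]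
          continuous_on_subset[OF B.w1_cont sub(4)])
  qed fact
  then have "(?H r + \<eta>\<^sup>2) * exp (- C * r) \<le> \<eta>\<^sup>2"
    by (simp add: w0 W0 A.w1_0 B.w1_0)
  then have "(?H r + \<eta>\<^sup>2) * exp (- C * r) * exp (C * r) \<le> \<eta>\<^sup>2 * exp (C * r)"
    by (intro mult_right_mono) auto
  then have "?H r + \<eta>\<^sup>2 \<le> \<eta>\<^sup>2 * exp (C * r)"
    by (simp add: mult.assoc flip: exp_add)
  also have "\<dots> \<le> \<eta>\<^sup>2 * exp (C * T)"
    using r by (intro mult_left_mono) (auto simp: C_def add_nonneg_nonneg intro!: mult_left_mono)
  finally have "?H r + \<eta>\<^sup>2 \<le> \<eta>\<^sup>2 * exp (C * T)" .
  moreover have "0 \<le> \<eta>\<^sup>2" by simp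
  ultimately show ?thesis unfolding C_def \<eta>_def by linarith
qed

text \<open>
  Where \<open>W\<close> has no zero, \<open>z = - W'/W\<close> solves the Riccati equation \<open>z' = s\<^sup>\<alpha> + z\<^sup>2 - (n-1)/s z\<close>. For \<open>s \<ge> 1\<close> and
  \<open>s \<ge> n - 1\<close> this gives \<open>z' \<ge> (1 + z\<^sup>2)/2\<close>, that is \<open>(arctan z)' \<ge> 1/2\<close>. But \<open>arctan\<close> varies by less than
  \<open>\<pi> < 4\<close>, so the interval is shorter than 8.
\<close>

lemma linear_profile_oscillates:
  assumes lin: "emden_profile n \<alpha> 1 1 S W W1" and a: "1 \<le> a" "n - 1 \<le> a" "a + 8 < S"
  shows "\<exists>s. a \<le> s \<and> s \<le> a + 8 \<and> W s = 0"
proof (rule ccontr)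
  assume nz: "\<not> ?thesis"
  interpret emden_profile n \<alpha> 1 1 S W W1 by fact
  define z where "z = (\<lambda>s. - W1 s / W s)"
  have nonzero: "W s \<noteq> 0" if "a \<le> s" "s \<le> a + 8" for s
    using nz that by blast
  let ?F = "\<lambda>s. arctan (z s) - s / 2"
  have deriv: "\<exists>y. (?F has_real_derivative y) (at s) \<and> y \<ge> 0" if s: "a \<le> s" "s \<le> a + 8" for s
  proof -
    have s': "0 < s" "s < S" using s a by auto
    let ?D = "s powr \<alpha> + (z s)\<^sup>2 - (n - 1) / s * z s"
    have "(z has_real_derivative
       ((- (- (n - 1) / s * W1 s - s powr \<alpha> * (1 * spow 1 (W s)))) * W s - (- W1 s) * W1 s)
         / (W s * W s)) (at s)"
      unfolding z_def
      using DERIV_divide[OF DERIV_minus[OF w1_der[OF s']] w_der[OF s'] nonzero[OF s]] by simp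
    moreover have "((- (- (n - 1) / s * W1 s - s powr \<alpha> * (1 * spow 1 (W s)))) * W s - (- W1 s) * W1 s)
         / (W s * W s) = ?D"
      using nonzero[OF s] s' by (simp add: z_def divide_simps) (simp add: algebra_simps power2_eq_square)
    ultimately have dz: "(z has_real_derivative ?D) (at s)" by simp
    have "1 \<le> s powr \<alpha>"
      using s a \<alpha>_nonneg by (intro ge_one_powr_ge_zero) auto
    moreover have "(n - 1) / s * z s \<le> (1 + (z s)\<^sup>2) / 2"
    proof -
      have q: "0 \<le> (n - 1) / s" "(n - 1) / s \<le> 1"
        using s a n_ge by (auto simp: field_simps)
      have "(n - 1) / s * z s \<le> (n - 1) / s * \<bar>z s\<bar>"
        using q by (intro mult_left_mono) auto
      also have "\<dots> \<le> 1 * \<bar>z s\<bar>"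
        using q by (intro mult_right_mono) auto
      also have "\<dots> \<le> (1 + (z s)\<^sup>2) / 2"
        using sum_squares_bound[of 1 "\<bar>z s\<bar>"] by simp
      finally show ?thesis .
    qed
    ultimately have D: "?D \<ge> (1 + (z s)\<^sup>2) / 2"
      by (simp add: field_simps)
    have "(?F has_real_derivative ?D * inverse (1 + (z s)\<^sup>2) - 1 / 2) (at s)"
      by (auto intro!: derivative_eq_intros dz)
    moreover have "0 < 1 + (z s)\<^sup>2"
      by (simp add: add_pos_nonneg)
    then have "1 / 2 \<le> ?D * inverse (1 + (z s)\<^sup>2)"
      using D by (simp add: field_simps)
    ultimately show ?thesis by force
  qed
  have "?F a \<le> ?F (a + 8)"
    using deriv by (intro DERIV_nonneg_imp_nondecreasing[of a "a + 8" ?F]) auto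
  then have "arctan (z a) + 4 \<le> arctan (z (a + 8))"
    by (simp add: add_divide_distrib)
  moreover have "- pi < 2 * arctan (z a)" "2 * arctan (z (a + 8)) < pi"
    using arctan_lbound[of "z a"] arctan_ubound[of "z (a + 8)"] by simp_all
  ultimately show False
    using pi_less_4 by linarith
qed

section \<open>The linear profile and the zeros of Bessel functions\<close>

text \<open>The coefficients of the Bessel function without its factor \<open>r\<^sup>\<beta>\<close>, as a power series in \<open>r\<^sup>2/4\<close>, normalized to the value
  1 at 0. This is the confluent limit function \<open>\<^sub>0F\<^sub>1(; 1 + \<beta>; -y)\<close>.\<close>

definition bessel_coeff :: "real \<Rightarrow> nat \<Rightarrow> real" where
  "bessel_coeff \<beta> k = Gamma (1 + \<beta>) * (-1) ^ k / (fact k * Gamma (real k + 1 + \<beta>))"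

lemma bessel_coeff_0: "0 \<le> \<beta> \<Longrightarrow> bessel_coeff \<beta> 0 = 1"
  using Gamma_real_pos[of "1 + \<beta>"] by (simp add: bessel_coeff_def less_imp_neq[symmetric])

lemma bessel_coeff_Suc:
  assumes "0 \<le> \<beta>"
  shows "bessel_coeff \<beta> (Suc k) * (real (Suc k) * (real (Suc k) + \<beta>)) = - bessel_coeff \<beta> k"
proof -
  have "real k + 1 + \<beta> \<notin> \<int>\<^sub>\<le>\<^sub>0"
    using assms by (auto dest: nonpos_Ints_nonpos)
  then have "Gamma (real (Suc k) + 1 + \<beta>) = (real k + 1 + \<beta>) * Gamma (real k + 1 + \<beta>)"
    using Gamma_plus1[of "real k + 1 + \<beta>"] by (simp add: add_ac)
  moreover have "Gamma (real k + 1 + \<beta>) > 0"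
    using assms by (intro Gamma_real_pos) auto
  moreover have "real k + 1 + \<beta> > 0" using assms by linarith
  ultimately show ?thesis
    unfolding bessel_coeff_def
    by (simp add: divide_simps add_ac)
qed

lemma abs_bessel_coeff_le:
  assumes "0 \<le> \<beta>"
  shows "\<bar>bessel_coeff \<beta> k\<bar> \<le> 1 / fact k"
proof (induction k)
  case (Suc k)
  let ?m = "real (Suc k) * (real (Suc k) + \<beta>)"
  have "\<bar>bessel_coeff \<beta> (Suc k)\<bar> * ?m = \<bar>bessel_coeff \<beta> k\<bar>"
    using arg_cong[OF bessel_coeff_Suc[OF assms, of k], of abs] assms
    by (simp add: abs_mult)
  moreover have "\<bar>bessel_coeff \<beta> (Suc k)\<bar> * real (Suc k) \<le> \<bar>bessel_coeff \<beta> (Suc k)\<bar> * ?m"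
    using assms by (intro mult_left_mono) auto
  ultimately have "\<bar>bessel_coeff \<beta> (Suc k)\<bar> * real (Suc k) \<le> 1 / fact k"
    using Suc by linarith
  then have "\<bar>bessel_coeff \<beta> (Suc k)\<bar> \<le> 1 / fact k / real (Suc k)"
    by (simp only: pos_le_divide_eq of_nat_0_less_iff zero_less_Suc)
  then show ?case
    by (simp add: mult.commute)
qed (use assms bessel_coeff_0 in simp)

lemma summable_bessel:
  assumes "0 \<le> \<beta>"
  shows "summable (\<lambda>k. bessel_coeff \<beta> k * y ^ k)"
proof (rule summable_comparison_test')
  show "summable (\<lambda>k. inverse (fact k) * \<bar>y\<bar> ^ k)"
    by (rule summable_exp)
  show "norm (bessel_coeff \<beta> k * y ^ k) \<le> inverse (fact k) * \<bar>y\<bar> ^ k" if "0 \<le> k" for k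
    using mult_right_mono[OF abs_bessel_coeff_le[OF assms, of k], of "\<bar>y\<bar> ^ k"]
    by (simp add: abs_mult power_abs inverse_eq_divide)
qed

definition bessel_series :: "real \<Rightarrow> real \<Rightarrow> real" where
  "bessel_series \<beta> y = (\<Sum>k. bessel_coeff \<beta> k * y ^ k)"

definition bessel_series' :: "real \<Rightarrow> real \<Rightarrow> real" where
  "bessel_series' \<beta> y = (\<Sum>k. diffs (bessel_coeff \<beta>) k * y ^ k)"

definition bessel_series'' :: "real \<Rightarrow> real \<Rightarrow> real" where
  "bessel_series'' \<beta> y = (\<Sum>k. diffs (diffs (bessel_coeff \<beta>)) k * y ^ k)"

lemma bessel_series_0: "0 \<le> \<beta> \<Longrightarrow> bessel_series \<beta> 0 = 1"
  using powser_zero[of "bessel_coeff \<beta>"] by (simp add: bessel_series_def bessel_coeff_0)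

lemma summable_diffs_bessel:
  assumes "0 \<le> \<beta>"
  shows "summable (\<lambda>k. diffs (bessel_coeff \<beta>) k * y ^ k)"
  by (rule termdiff_converges_all) (rule summable_bessel[OF assms])

lemma DERIV_bessel_series:
  assumes "0 \<le> \<beta>"
  shows "(bessel_series \<beta> has_real_derivative bessel_series' \<beta> y) (at y)"
    "(bessel_series' \<beta> has_real_derivative bessel_series'' \<beta> y) (at y)"
  unfolding bessel_series_def[abs_def] bessel_series'_def[abs_def] bessel_series''_def[abs_def]
  by (intro termdiffs_strong_converges_everywhere summable_bessel summable_diffs_bessel assms)+

text \<open>Comparison of coefficients; this is Bessel's equation in the variable \<open>y = r\<^sup>2/4\<close>.\<close>

lemma bessel_series_ode:
  assumes "0 \<le> \<beta>"
  shows "y * bessel_series'' \<beta> y + (1 + \<beta>) * bessel_series' \<beta> y + bessel_series \<beta> y = 0"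
proof -
  let ?c = "bessel_coeff \<beta>"
  have "(\<lambda>k. of_nat k * diffs ?c k * y ^ (k - Suc 0)) sums bessel_series'' \<beta> y"
    unfolding bessel_series''_def
    by (intro diffs_equiv termdiff_converges_all summable_diffs_bessel assms)
  then have "(\<lambda>k. y * (of_nat k * diffs ?c k * y ^ (k - Suc 0))) sums (y * bessel_series'' \<beta> y)"
    by (rule sums_mult)
  moreover have "y * (of_nat k * diffs ?c k * y ^ (k - Suc 0)) = of_nat k * diffs ?c k * y ^ k" for k
    by (cases k) auto
  ultimately have s2: "(\<lambda>k. of_nat k * diffs ?c k * y ^ k) sums (y * bessel_series'' \<beta> y)"
    by simp
  have s1: "(\<lambda>k. (1 + \<beta>) * (diffs ?c k * y ^ k)) sums ((1 + \<beta>) * bessel_series' \<beta> y)"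
    unfolding bessel_series'_def by (intro sums_mult summable_sums summable_diffs_bessel assms)
  have s0: "(\<lambda>k. ?c k * y ^ k) sums bessel_series \<beta> y"
    unfolding bessel_series_def by (intro summable_sums summable_bessel assms)
  have "of_nat k * diffs ?c k * y ^ k + (1 + \<beta>) * (diffs ?c k * y ^ k) + ?c k * y ^ k = 0" for k
  proof -
    have "of_nat k * diffs ?c k + (1 + \<beta>) * diffs ?c k + ?c k = 0"
      using bessel_coeff_Suc[OF assms, of k] by (simp add: diffs_def algebra_simps)
    then have "(of_nat k * diffs ?c k + (1 + \<beta>) * diffs ?c k + ?c k) * y ^ k = 0"
      by simp
    then show ?thesis by (simp add: algebra_simps)
  qed
  then have "(\<lambda>k. 0) sums (y * bessel_series'' \<beta> y + (1 + \<beta>) * bessel_series' \<beta> y + bessel_series \<beta> y)"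
    using sums_add[OF sums_add[OF s2 s1] s0] by simp
  then show ?thesis
    using sums_unique2 sums_zero by blast
qed

lemma bessel_J_series:
  assumes "0 \<le> \<beta>"
  shows "bessel_J \<beta> r = rpow r \<beta> / Gamma (1 + \<beta>) * bessel_series \<beta> (r\<^sup>2 / 4)"
proof -
  have G: "Gamma (1 + \<beta>) > 0" using assms by (intro Gamma_real_pos) auto
  have "(r / 2) ^ (2 * k) = (r\<^sup>2 / 4) ^ k" for k
    by (simp add: power_mult power_divide)
  then have "(- 1) ^ k / (fact k * Gamma (real k + 1 + \<beta>)) * (r / 2) ^ (2 * k)
      = (1 / Gamma (1 + \<beta>)) * (bessel_coeff \<beta> k * (r\<^sup>2 / 4) ^ k)" for k
    using G unfolding bessel_coeff_def by simp
  then have "bessel_J \<beta> r = rpow r \<beta> *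
     (\<Sum>k. (1 / Gamma (1 + \<beta>)) * (bessel_coeff \<beta> k * (r\<^sup>2 / 4) ^ k))"
    unfolding bessel_J_def by simp
  also have "\<dots> = rpow r \<beta> * ((1 / Gamma (1 + \<beta>)) * bessel_series \<beta> (r\<^sup>2 / 4))"
    unfolding bessel_series_def by (subst suminf_mult) (auto intro: summable_bessel assms)
  finally show ?thesis by simp
qed

text \<open>The solution of the linear equation with value 1 at the centre; it is smooth in \<open>s\<^bsup>2+\<alpha>\<^esup>\<close>.\<close>

definition linear_profile :: "real \<Rightarrow> real \<Rightarrow> real \<Rightarrow> real" where
  "linear_profile n \<alpha> s = bessel_series ((n - 2) / (2 + \<alpha>)) (s powr (2 + \<alpha>) / (2 + \<alpha>)\<^sup>2)"

definition linear_profile' :: "real \<Rightarrow> real \<Rightarrow> real \<Rightarrow> real" where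
  "linear_profile' n \<alpha> s =
     bessel_series' ((n - 2) / (2 + \<alpha>)) (s powr (2 + \<alpha>) / (2 + \<alpha>)\<^sup>2) * (s powr (1 + \<alpha>) / (2 + \<alpha>))"

lemma linear_profile_0: "2 \<le> n \<Longrightarrow> 0 \<le> \<alpha> \<Longrightarrow> linear_profile n \<alpha> 0 = 1"
  by (simp add: linear_profile_def bessel_series_0)

lemma continuous_linear_profile:
  assumes n: "2 \<le> n" and \<alpha>: "0 \<le> \<alpha>"
  shows "continuous_on {0..} (linear_profile n \<alpha>)" "continuous_on {0..} (linear_profile' n \<alpha>)"
proof -
  let ?\<beta> = "(n - 2) / (2 + \<alpha>)" and ?b = "2 + \<alpha>"
  have \<beta>: "0 \<le> ?\<beta>" using n \<alpha> by simp
  have cont: "continuous_on UNIV (bessel_series ?\<beta>)" "continuous_on UNIV (bessel_series' ?\<beta>)"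
    by (rule DERIV_continuous_on, rule has_field_derivative_at_within, rule DERIV_bessel_series[OF \<beta>])+
  have y: "continuous_on {0..} (\<lambda>s. s powr ?b / ?b\<^sup>2)"
    using \<alpha> by (intro continuous_intros continuous_on_powr') auto
  show "continuous_on {0..} (linear_profile n \<alpha>)"
    unfolding linear_profile_def[abs_def]
    by (rule continuous_on_compose2[OF cont(1) y]) auto
  have "continuous_on {0..} (\<lambda>s. bessel_series' ?\<beta> (s powr ?b / ?b\<^sup>2))"
    by (rule continuous_on_compose2[OF cont(2) y]) auto
  moreover have "continuous_on {0..} (\<lambda>s. s powr (1 + \<alpha>) / ?b)"
    using \<alpha> by (intro continuous_intros continuous_on_powr') auto
  ultimately show "continuous_on {0..} (linear_profile' n \<alpha>)"
    unfolding linear_profile'_def[abs_def] by (rule continuous_on_mult)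
qed

lemma emden_linear_profile:
  assumes n: "2 \<le> n" and \<alpha>: "0 \<le> \<alpha>" and S: "0 < S"
  shows "emden_profile n \<alpha> 1 1 S (linear_profile n \<alpha>) (linear_profile' n \<alpha>)"
proof
  let ?\<beta> = "(n - 2) / (2 + \<alpha>)" and ?b = "2 + \<alpha>"
  have \<beta>: "0 \<le> ?\<beta>" using n \<alpha> by simp
  show "continuous_on {0..S} (linear_profile n \<alpha>)"
    by (rule continuous_on_subset[OF continuous_linear_profile(1)[OF n \<alpha>]]) auto
  show "continuous_on {0..<S} (linear_profile' n \<alpha>)"
    by (rule continuous_on_subset[OF continuous_linear_profile(2)[OF n \<alpha>]]) auto
  fix s assume s: "0 < s" "s < S"
  let ?y = "s powr ?b / ?b\<^sup>2"
  have dy: "((\<lambda>s. s powr ?b / ?b\<^sup>2) has_real_derivative s powr (1 + \<alpha>) / ?b) (at s)"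
  proof -
    have "?b * s powr (?b - 1) / ?b\<^sup>2 = s powr (1 + \<alpha>) / ?b"
      using \<alpha> by (simp add: power2_eq_square)
    then show ?thesis
      using DERIV_cdivide[OF has_real_derivative_powr[OF s(1), of ?b], of "?b\<^sup>2"] by simp
  qed
  show "(linear_profile n \<alpha> has_real_derivative linear_profile' n \<alpha> s) (at s)"
    unfolding linear_profile_def[abs_def] linear_profile'_def
    by (rule DERIV_chain2[OF DERIV_bessel_series(1)[OF \<beta>] dy])
  have db: "((\<lambda>s. s powr (1 + \<alpha>) / ?b) has_real_derivative (1 + \<alpha>) * s powr \<alpha> / ?b) (at s)"
    using s \<alpha> by (auto intro!: derivative_eq_intros)
  have "(linear_profile' n \<alpha> has_real_derivative
     bessel_series'' ?\<beta> ?y * (s powr (1 + \<alpha>) / ?b) * (s powr (1 + \<alpha>) / ?b)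
      + (1 + \<alpha>) * s powr \<alpha> / ?b * bessel_series' ?\<beta> ?y) (at s)"
    unfolding linear_profile'_def[abs_def]
    by (rule DERIV_mult[OF DERIV_chain2[OF DERIV_bessel_series(2)[OF \<beta>] dy] db])
  moreover have "bessel_series'' ?\<beta> ?y * (s powr (1 + \<alpha>) / ?b) * (s powr (1 + \<alpha>) / ?b)
      + (1 + \<alpha>) * s powr \<alpha> / ?b * bessel_series' ?\<beta> ?y
     = - (n - 1) / s * linear_profile' n \<alpha> s - s powr \<alpha> * (1 * spow 1 (linear_profile n \<alpha> s))"
  proof -
    define F0 F1 F2 where "F0 = bessel_series ?\<beta> ?y" and "F1 = bessel_series' ?\<beta> ?y"
      and "F2 = bessel_series'' ?\<beta> ?y"
    have ode: "?y * F2 + (1 + ?\<beta>) * F1 + F0 = 0"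
      unfolding F0_def F1_def F2_def by (rule bessel_series_ode[OF \<beta>])
    have p1: "s powr (1 + \<alpha>) = s * s powr \<alpha>" and p2: "s powr ?b = s * s * s powr \<alpha>"
      using s by (simp_all add: powr_add power2_eq_square)
    have b: "?b \<noteq> 0" using \<alpha> by simp
    have "F2 * (s powr (1 + \<alpha>) / ?b) * (s powr (1 + \<alpha>) / ?b) = s powr \<alpha> * (?y * F2)"
      unfolding p1 p2 by (simp add: power2_eq_square)
    also have "?y * F2 = - (1 + ?\<beta>) * F1 - F0"
      using ode by (simp add: algebra_simps)
    finally have "F2 * (s powr (1 + \<alpha>) / ?b) * (s powr (1 + \<alpha>) / ?b) + (1 + \<alpha>) * s powr \<alpha> / ?b * F1
      = s powr \<alpha> * (- (1 + ?\<beta>) * F1 - F0 + (1 + \<alpha>) / ?b * F1)"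
      by (simp add: algebra_simps)
    also have "- (1 + ?\<beta>) * F1 - F0 + (1 + \<alpha>) / ?b * F1 = - ((n - 1) / ?b) * F1 - F0"
      using b by (simp add: divide_simps) (simp add: algebra_simps)
    also have "s powr \<alpha> * (- ((n - 1) / ?b) * F1 - F0)
       = - (n - 1) / s * (F1 * (s powr (1 + \<alpha>) / ?b)) - s powr \<alpha> * F0"
      using s b unfolding p1 by (simp add: divide_simps) (simp add: algebra_simps)
    finally show ?thesis
      unfolding linear_profile_def linear_profile'_def F0_def F1_def F2_def by simp
  qed
  ultimately show "(linear_profile' n \<alpha> has_real_derivative
      - (n - 1) / s * linear_profile' n \<alpha> s - s powr \<alpha> * (1 * spow 1 (linear_profile n \<alpha> s))) (at s)"
    by simp
qed (use assms in \<open>auto simp: linear_profile'_def\<close>)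

definition linear_zeros :: "real \<Rightarrow> real \<Rightarrow> real set" where
  "linear_zeros n \<alpha> = {s. 0 < s \<and> linear_profile n \<alpha> s = 0}"

lemma finite_linear_zeros:
  assumes n: "2 \<le> n" and \<alpha>: "0 \<le> \<alpha>"
  shows "finite {s \<in> linear_zeros n \<alpha>. s \<le> x}"
proof -
  interpret emden_profile n \<alpha> 1 1 "max x 1" "linear_profile n \<alpha>" "linear_profile' n \<alpha>"
    by (rule emden_linear_profile) (use assms in auto)
  show ?thesis
    by (rule finite_subset[OF _ finite_zeros]) (auto simp: linear_zeros_def linear_profile_0 assms)
qed

lemma linear_zeros_simple:
  assumes n: "2 \<le> n" and \<alpha>: "0 \<le> \<alpha>" and s: "s \<in> linear_zeros n \<alpha>"
  shows "linear_profile' n \<alpha> s \<noteq> 0"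
proof -
  have "0 < s" using s by (simp add: linear_zeros_def)
  then interpret emden_profile n \<alpha> 1 1 "s + 1" "linear_profile n \<alpha>" "linear_profile' n \<alpha>"
    by (intro emden_linear_profile) (use assms in auto)
  show ?thesis
    using s by (intro zeros_simple) (auto simp: linear_zeros_def linear_profile_0 assms)
qed

lemma many_linear_zeros:
  assumes n: "2 \<le> n" and \<alpha>: "0 \<le> \<alpha>"
  shows "\<exists>x. k \<le> card {s \<in> linear_zeros n \<alpha>. s \<le> x}"
proof -
  have "infinite (linear_zeros n \<alpha>)"
  proof
    assume fin: "finite (linear_zeros n \<alpha>)"
    define a where "a = Max (insert n (linear_zeros n \<alpha>)) + 1"
    have "s \<le> Max (insert n (linear_zeros n \<alpha>))" if "s \<in> insert n (linear_zeros n \<alpha>)" for s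
      using fin that by (intro Max_ge) auto
    then have a: "n + 1 \<le> a" "\<And>s. s \<in> linear_zeros n \<alpha> \<Longrightarrow> s < a"
      unfolding a_def by (force simp: less_eq_real_def)+
    obtain s where "a \<le> s" "linear_profile n \<alpha> s = 0"
      using linear_profile_oscillates[OF emden_linear_profile[OF n \<alpha>, of "a + 9"], of a] a n by auto
    then have "s \<in> linear_zeros n \<alpha>"
      using a(1) n by (simp add: linear_zeros_def)
    then show False
      using a(2)[of s] \<open>a \<le> s\<close> by simp
  qed
  then obtain B where B: "finite B" "card B = k" "B \<subseteq> linear_zeros n \<alpha>"
    using infinite_arbitrarily_large by blast
  show ?thesis
  proof (intro exI[of _ "Max (insert 0 B)"])
    show "k \<le> card {s \<in> linear_zeros n \<alpha>. s \<le> Max (insert 0 B)}"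
      unfolding B(2)[symmetric] using B by (intro card_mono finite_linear_zeros n \<alpha>) auto
  qed
qed

lemma kth_linear_zero:
  assumes "2 \<le> n" "0 \<le> \<alpha>" "1 \<le> k"
  shows "kth_smallest (linear_zeros n \<alpha>) k \<in> linear_zeros n \<alpha>"
    "card {s \<in> linear_zeros n \<alpha>. s \<le> kth_smallest (linear_zeros n \<alpha>) k} = k"
proof -
  obtain x where "k \<le> card {s \<in> linear_zeros n \<alpha>. s \<le> x}"
    using many_linear_zeros assms by blast
  then show "kth_smallest (linear_zeros n \<alpha>) k \<in> linear_zeros n \<alpha>"
    "card {s \<in> linear_zeros n \<alpha>. s \<le> kth_smallest (linear_zeros n \<alpha>) k} = k"
    using kth_smallest_properties[OF finite_linear_zeros] assms by blast+
qed

text \<open>The map \<open>s \<mapsto> s\<^bsup>(2+\<alpha>)/2\<^esup> / ((2+\<alpha>)/2)\<close> increases and carries the zeros of the linear profile onto those of the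
  Bessel function, so it preserves their ranks.\<close>

lemma bessel_zero_eq:
  assumes n: "2 \<le> n" and \<alpha>: "0 \<le> \<alpha>" and k: "1 \<le> k"
  shows "bessel_zero ((n - 2) / (2 + \<alpha>)) k
    = kth_smallest (linear_zeros n \<alpha>) k powr ((2 + \<alpha>) / 2) / ((2 + \<alpha>) / 2)"
proof -
  let ?\<beta> = "(n - 2) / (2 + \<alpha>)" and ?b = "2 + \<alpha>"
  let ?f = "\<lambda>s::real. s powr (?b / 2) / (?b / 2)"
  have \<beta>: "0 \<le> ?\<beta>" using n \<alpha> by simp
  have sq: "(?f s)\<^sup>2 / 4 = s powr ?b / ?b\<^sup>2" if "0 < s" for s
  proof -
    have "(s powr (?b / 2))\<^sup>2 = s powr ?b"
      using powr_add[of s "?b / 2" "?b / 2"] by (simp only: field_sum_of_halves power2_eq_square)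
    then show ?thesis by (simp only: power_divide) simp
  qed
  have zero: "bessel_J ?\<beta> r = 0 \<longleftrightarrow> bessel_series ?\<beta> (r\<^sup>2 / 4) = 0" if "0 < r" for r
  proof -
    have "rpow r ?\<beta> > 0" using that by (simp add: rpow_def)
    moreover have "Gamma (1 + ?\<beta>) > 0" using \<beta> by (intro Gamma_real_pos) auto
    ultimately show ?thesis unfolding bessel_J_series[OF \<beta>] by simp
  qed
  have img: "{r. 0 < r \<and> bessel_J ?\<beta> r = 0} = ?f ` linear_zeros n \<alpha>"
  proof (intro equalityI subsetI)
    fix r assume r: "r \<in> {r. 0 < r \<and> bessel_J ?\<beta> r = 0}"
    define s where "s = (?b / 2 * r) powr (2 / ?b)"
    have s: "0 < s" using r \<alpha> by (simp add: s_def)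
    have fs: "?f s = r"
    proof -
      have "2 / ?b * (?b / 2) = 1" using \<alpha> by simp
      then have "s powr (?b / 2) = ?b / 2 * r"
        unfolding s_def powr_powr using r \<alpha> by (simp del: times_divide_eq_left times_divide_eq_right)
      then show ?thesis using \<alpha> by simp
    qed
    then have "linear_profile n \<alpha> s = 0"
      using r zero[of r] sq[OF s] by (simp add: linear_profile_def)
    then show "r \<in> ?f ` linear_zeros n \<alpha>"
      using s fs by (force simp: linear_zeros_def)
  next
    fix r assume "r \<in> ?f ` linear_zeros n \<alpha>"
    then obtain s where s: "0 < s" "linear_profile n \<alpha> s = 0" "r = ?f s"
      by (auto simp: linear_zeros_def)
    then show "r \<in> {r. 0 < r \<and> bessel_J ?\<beta> r = 0}"
      using zero[of r] sq[OF s(1)] \<alpha> by (simp add: linear_profile_def)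
  qed
  show ?thesis
    unfolding bessel_zero_def img
  proof (rule kth_smallest_image)
    fix s t assume "s \<in> linear_zeros n \<alpha>" "t \<in> linear_zeros n \<alpha>" "s < t"
    then show "?f s < ?f t"
      using \<alpha> by (intro divide_strict_right_mono powr_less_mono2) (auto simp: linear_zeros_def)
  qed (use kth_linear_zero assms in auto)
qed

lemma linear_profile_lipschitz:
  assumes n: "2 \<le> n" and \<alpha>: "0 \<le> \<alpha>"
  shows "\<exists>L. \<forall>a\<in>{0..R}. \<forall>b\<in>{0..R}. \<bar>linear_profile n \<alpha> a - linear_profile n \<alpha> b\<bar> \<le> L * \<bar>a - b\<bar>"
proof -
  have "continuous_on {0..R} (linear_profile' n \<alpha>)"
    by (rule continuous_on_subset[OF continuous_linear_profile(2)[OF n \<alpha>]]) auto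
  then have "bounded (linear_profile' n \<alpha> ` {0..R})"
    by (intro compact_imp_bounded compact_continuous_image compact_Icc)
  then obtain L where L: "\<And>x. x \<in> {0..R} \<Longrightarrow> \<bar>linear_profile' n \<alpha> x\<bar> \<le> L"
    unfolding bounded_iff by (force simp: real_norm_def)
  have less: "\<bar>linear_profile n \<alpha> b - linear_profile n \<alpha> a\<bar> \<le> L * \<bar>b - a\<bar>"
    if ab: "0 \<le> a" "a < b" "b \<le> R" for a b
  proof -
    interpret emden_profile n \<alpha> 1 1 "b + 1" "linear_profile n \<alpha>" "linear_profile' n \<alpha>"
      by (rule emden_linear_profile[OF n \<alpha>]) (use ab in auto)
    have "continuous_on {a..b} (linear_profile n \<alpha>)"
      by (rule continuous_on_subset[OF w_cont]) (use ab in auto)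
    then have "\<exists>l z. a < z \<and> z < b \<and> (linear_profile n \<alpha> has_real_derivative l) (at z) \<and>
        linear_profile n \<alpha> b - linear_profile n \<alpha> a = (b - a) * l"
    proof (rule MVT[OF ab(2)])
      fix x assume "a < x" "x < b"
      then have "(linear_profile n \<alpha> has_real_derivative linear_profile' n \<alpha> x) (at x)"
        using ab by (intro w_der) auto
      then show "linear_profile n \<alpha> differentiable (at x)"
        unfolding real_differentiable_def by blast
    qed
    then obtain l z where z: "a < z" "z < b" "(linear_profile n \<alpha> has_real_derivative l) (at z)"
        "linear_profile n \<alpha> b - linear_profile n \<alpha> a = (b - a) * l"
      by blast
    have "(linear_profile n \<alpha> has_real_derivative linear_profile' n \<alpha> z) (at z)"
      using ab z by (intro w_der) auto
    then have "l = linear_profile' n \<alpha> z"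
      using z(3) by (intro DERIV_unique)
    then have "\<bar>l\<bar> \<le> L" using L[of z] z ab by simp
    then have "\<bar>b - a\<bar> * \<bar>l\<bar> \<le> \<bar>b - a\<bar> * L"
      by (rule mult_left_mono) simp
    then show ?thesis
      unfolding z(4) abs_mult by (simp only: mult.commute)
  qed
  show ?thesis
  proof (intro exI[of _ L] ballI)
    fix a b assume "a \<in> {0..R}" "b \<in> {0..R}"
    then show "\<bar>linear_profile n \<alpha> a - linear_profile n \<alpha> b\<bar> \<le> L * \<bar>a - b\<bar>"
      using less[of a b] less[of b a] by (cases a b rule: linorder_cases) (auto simp: abs_minus_commute)
  qed
qed

text \<open>The constant does not depend on \<open>\<sigma>\<close>: profiles of different lengths are compared as far
  as they reach into \<open>[0,R]\<close>.\<close>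

lemma profile_comparison_uniform:
  assumes prof: "emden_profile n \<alpha> 1 p \<sigma> w w1" and w0: "w 0 = 1" and R: "0 < R"
  defines "K \<equiv> exp ((2 * (R + 1) powr \<alpha> + 1) * (R + 1))"
  shows "\<And>r. 0 \<le> r \<Longrightarrow> r \<le> \<sigma> \<Longrightarrow> r \<le> R \<Longrightarrow> \<bar>w r - linear_profile n \<alpha> r\<bar> \<le> (p - 1) * K"
    and "\<And>r. 0 \<le> r \<Longrightarrow> r < \<sigma> \<Longrightarrow> r \<le> R \<Longrightarrow> \<bar>w1 r - linear_profile' n \<alpha> r\<bar> \<le> (p - 1) * K"
proof -
  let ?V = "linear_profile n \<alpha>" and ?V1 = "linear_profile' n \<alpha>"
  interpret A: emden_profile n \<alpha> 1 p \<sigma> w w1 by fact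
  have lin: "emden_profile n \<alpha> 1 1 (R + 1) ?V ?V1"
    using A.n_ge A.\<alpha>_nonneg R by (intro emden_linear_profile) auto
  interpret B: emden_profile n \<alpha> 1 1 "R + 1" ?V ?V1 by (rule lin)
  have K: "1 \<le> K" using R unfolding K_def by simp
  have sq: "\<bar>a\<bar> \<le> (p - 1) * K" if "a\<^sup>2 \<le> (p - 1)\<^sup>2 * K" for a
  proof -
    have "K * 1 \<le> K * K" using K by (intro mult_left_mono) auto
    then have "(p - 1)\<^sup>2 * K \<le> (p - 1)\<^sup>2 * K\<^sup>2"
      by (intro mult_left_mono) (auto simp: power2_eq_square)
    then have "a\<^sup>2 \<le> ((p - 1) * K)\<^sup>2"
      using that by (simp add: power_mult_distrib)
    then show ?thesis
      using A.p_ge K abs_le_square_iff[of a "(p - 1) * K"] by simp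
  qed
  have main: "(w r - ?V r)\<^sup>2 + (w1 r - ?V1 r)\<^sup>2 \<le> (p - 1)\<^sup>2 * K" if r: "0 \<le> r" "r < \<sigma>" "r \<le> R" for r
  proof -
    let ?T = "min \<sigma> (R + 1)"
    have V0: "?V 0 = 1" by (rule linear_profile_0[OF A.n_ge A.\<alpha>_nonneg])
    have "(w r - ?V r)\<^sup>2 + (w1 r - ?V1 r)\<^sup>2 \<le> (p - 1)\<^sup>2 * exp ((2 * ?T powr \<alpha> + 1) * ?T)"
      by (rule profile_comparison[OF prof lin w0 V0]) (use r in auto)
    also have "\<dots> \<le> (p - 1)\<^sup>2 * K"
    proof -
      have "?T powr \<alpha> \<le> (R + 1) powr \<alpha>"
        using A.S_pos R A.\<alpha>_nonneg by (intro powr_mono2) auto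
      then have "(2 * ?T powr \<alpha> + 1) * ?T \<le> (2 * (R + 1) powr \<alpha> + 1) * (R + 1)"
        using A.S_pos R by (intro mult_mono add_nonneg_nonneg) auto
      then show ?thesis
        unfolding K_def by (intro mult_left_mono) auto
    qed
    finally show ?thesis .
  qed
  have value_bound: "\<bar>w r - ?V r\<bar> \<le> (p - 1) * K" if r: "0 \<le> r" "r < \<sigma>" "r \<le> R" for r
    by (rule sq) (use main[OF r] zero_le_power2[of "w1 r - ?V1 r"] in linarith)
  show "\<bar>w1 r - ?V1 r\<bar> \<le> (p - 1) * K" if r: "0 \<le> r" "r < \<sigma>" "r \<le> R" for r
    by (rule sq) (use main[OF r] zero_le_power2[of "w r - ?V r"] in linarith)
  show "\<bar>w r - ?V r\<bar> \<le> (p - 1) * K" if r: "0 \<le> r" "r \<le> \<sigma>" "r \<le> R" for r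
  proof (cases "r < \<sigma>")
    case False
    then have \<sigma>R: "r = \<sigma>" "\<sigma> \<le> R" using r by auto
    have "norm (w r - ?V r) \<le> (p - 1) * K"
    proof (rule continuous_on_closure_norm_le[where s = "{0..<\<sigma>}" and f = "\<lambda>r. w r - ?V r" and x = r])
      have "continuous_on {0..\<sigma>} ?V"
        by (rule continuous_on_subset[OF B.w_cont]) (use \<sigma>R in auto)
      then show "continuous_on (closure {0..<\<sigma>}) (\<lambda>r. w r - ?V r)"
        using A.S_pos by (auto intro!: continuous_intros A.w_cont)
      show "\<forall>y\<in>{0..<\<sigma>}. norm (w y - ?V y) \<le> (p - 1) * K"
        using value_bound \<sigma>R by auto
      show "r \<in> closure {0..<\<sigma>}" using \<sigma>R A.S_pos by simp
    qed
    then show ?thesis by simp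
  qed (use value_bound r in auto)
qed

section \<open>Radial functions\<close>

lemma has_derivative_grad:
  fixes f :: "real^'n \<Rightarrow> real"
  assumes "f differentiable (at x)"
  shows "(f has_derivative (\<lambda>h. grad f x \<bullet> h)) (at x)"
proof -
  let ?D = "frechet_derivative f (at x)"
  have D: "(f has_derivative ?D) (at x)"
    using assms frechet_derivative_works by blast
  then have lin: "linear ?D" by (rule has_derivative_linear)
  have "?D h = grad f x \<bullet> h" for h
  proof -
    have "h = (\<Sum>i\<in>UNIV. (h $ i) *\<^sub>R axis i 1)"
      using basis_expansion[of h] by (simp add: scalar_mult_eq_scaleR)
    then have "?D h = (\<Sum>i\<in>UNIV. ?D ((h $ i) *\<^sub>R axis i 1))"
      using linear_sum[OF lin, of "\<lambda>i. (h $ i) *\<^sub>R axis i 1" UNIV] by simp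
    also have "\<dots> = grad f x \<bullet> h"
      by (simp add: linear_cmul[OF lin] grad_def inner_vec_def mult.commute)
    finally show ?thesis .
  qed
  then have "?D = (\<lambda>h. grad f x \<bullet> h)" by auto
  with D show ?thesis by simp
qed

lemma grad_eqI:
  fixes f :: "real^'n \<Rightarrow> real"
  assumes "(f has_derivative (\<lambda>h. g \<bullet> h)) (at x)"
  shows "grad f x = g"
  unfolding grad_def frechet_derivative_at[OF assms, symmetric]
  by (simp add: inner_axis vec_eq_iff)

lemma hess_eqI:
  fixes f :: "real^'n \<Rightarrow> real"
  assumes "(grad f has_derivative (\<lambda>h. A *v h)) (at x)"
  shows "hess f x = A"
  unfolding hess_def jacobian_def frechet_derivative_at[OF assms, symmetric] by simp

definition outer_square :: "real^'n \<Rightarrow> real^'n^'n" where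
  "outer_square x = (\<chi> i j. x $ i * x $ j)"

lemma outer_square_mult: "outer_square x *v h = (x \<bullet> h) *\<^sub>R x"
  by (simp add: outer_square_def matrix_vector_mult_def inner_vec_def vec_eq_iff
      sum_distrib_left sum_distrib_right mult_ac)

lemma trace_outer_square: "trace (outer_square x) = (norm x)\<^sup>2"
  by (simp add: trace_def outer_square_def power2_norm_eq_inner inner_vec_def)

lemma norm_outer_square: "norm (outer_square x) = (norm x)\<^sup>2"
proof -
  have N: "(norm x)\<^sup>2 = (\<Sum>i\<in>UNIV. x $ i * x $ i)"
    by (simp add: power2_norm_eq_inner inner_vec_def)
  have "(norm (outer_square x))\<^sup>2 = (\<Sum>i\<in>UNIV. \<Sum>j\<in>UNIV. (x $ i * x $ j) * (x $ i * x $ j))"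
    by (simp add: power2_norm_eq_inner inner_vec_def outer_square_def)
  also have "\<dots> = (\<Sum>i\<in>UNIV. x $ i * x $ i) * (\<Sum>j\<in>UNIV. x $ j * x $ j)"
    by (simp add: sum_product mult_ac)
  also have "\<dots> = ((norm x)\<^sup>2)\<^sup>2"
    by (simp only: N[symmetric] power2_eq_square)
  finally show ?thesis
    using power2_eq_iff_nonneg by (metis norm_ge_zero zero_le_power2)
qed

text \<open>The Hessian of \<open>v(|x|)\<close> at \<open>x \<noteq> 0\<close>, where \<open>q = v'(|x|)/|x|\<close> is its eigenvalue in the directions orthogonal to \<open>x\<close> and
  \<open>s = v''(|x|)\<close> the one in the direction of \<open>x\<close>.\<close>

definition radial_hess :: "real \<Rightarrow> real \<Rightarrow> real^'n \<Rightarrow> real^'n^'n" where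
  "radial_hess q s x = q *\<^sub>R mat 1 + ((s - q) / (norm x)\<^sup>2) *\<^sub>R outer_square x"

lemma trace_radial_hess:
  fixes x :: "real^'n"
  assumes "x \<noteq> 0"
  shows "trace (radial_hess q s x) = s + (real CARD('n) - 1) * q"
proof -
  have "trace (radial_hess q s x) = q * trace (mat 1 :: real^'n^'n) + ((s - q) / (norm x)\<^sup>2) * trace (outer_square x)"
    by (simp add: radial_hess_def trace_def sum.distrib sum_distrib_left)
  also have "trace (mat 1 :: real^'n^'n) = real CARD('n)"
    by (simp add: trace_def mat_def)
  also have "((s - q) / (norm x)\<^sup>2) * trace (outer_square x) = s - q"
    using assms by (simp add: trace_outer_square)
  finally show ?thesis
    by (simp add: algebra_simps)
qed

lemma radial_derivatives:
  fixes f :: "real^'n \<Rightarrow> real" and x :: "real^'n"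
  assumes f: "\<And>y. y \<in> ball 0 1 \<Longrightarrow> f y = v (norm y)"
    and v: "\<And>r. 0 < r \<Longrightarrow> r < 1 \<Longrightarrow> (v has_real_derivative v1 r) (at r)"
    and v1: "\<And>r. 0 < r \<Longrightarrow> r < 1 \<Longrightarrow> (v1 has_real_derivative v2 r) (at r)"
    and x: "x \<in> ball 0 1" "x \<noteq> 0"
  shows "f differentiable (at x)"
    and "grad f x = (v1 (norm x) / norm x) *\<^sub>R x"
    and "grad f differentiable (at x)"
    and "hess f x = radial_hess (v1 (norm x) / norm x) (v2 (norm x)) x"
proof -
  have first: "(f has_derivative (\<lambda>h. ((v1 (norm y) / norm y) *\<^sub>R y) \<bullet> h)) (at y)"
    if y: "y \<in> ball 0 1" "y \<noteq> 0" for y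
  proof -
    have ny: "0 < norm y" "norm y < 1" using y by auto
    have "((\<lambda>z. v (norm z)) has_derivative (\<lambda>h. v1 (norm y) * (h \<bullet> sgn y))) (at y)"
      using has_derivative_compose[OF has_derivative_norm[OF y(2)]
          v[OF ny, unfolded has_field_derivative_def]] by simp
    then have "(f has_derivative (\<lambda>h. v1 (norm y) * (h \<bullet> sgn y))) (at y)"
      by (rule has_derivative_transform_within_open[where s = "ball 0 1"]) (use y f in auto)
    moreover have "v1 (norm y) * (h \<bullet> sgn y) = ((v1 (norm y) / norm y) *\<^sub>R y) \<bullet> h" for h
      by (simp add: sgn_div_norm inner_commute divide_inverse)
    ultimately show ?thesis by simp
  qed
  then show "f differentiable (at x)"
    using x differentiableI by blast
  have grad: "grad f y = (v1 (norm y) / norm y) *\<^sub>R y" if "y \<in> ball 0 1 - {0}" for y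
    using first that by (intro grad_eqI) auto
  then show "grad f x = (v1 (norm x) / norm x) *\<^sub>R x"
    using x by simp
  have nx: "0 < norm x" "norm x < 1" using x by auto
  let ?q = "v1 (norm x) / norm x"
  have "((\<lambda>r. v1 r / r) has_real_derivative (v2 (norm x) * norm x - v1 (norm x) * 1) / (norm x * norm x)) (at (norm x))"
    using nx by (intro DERIV_divide v1 DERIV_ident) auto
  also have "(v2 (norm x) * norm x - v1 (norm x) * 1) / (norm x * norm x) = (v2 (norm x) - ?q) / norm x"
    using nx by (simp add: field_simps)
  finally have "((\<lambda>z. v1 (norm z) / norm z) has_derivative
      (\<lambda>h. (v2 (norm x) - ?q) / norm x * (h \<bullet> sgn x))) (at x)"
    using has_derivative_compose[OF has_derivative_norm[OF x(2)], of "\<lambda>r. v1 r / r"]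
    unfolding has_field_derivative_def by blast
  then have "((\<lambda>z. (v1 (norm z) / norm z) *\<^sub>R z) has_derivative
      (\<lambda>h. ?q *\<^sub>R h + ((v2 (norm x) - ?q) / norm x * (h \<bullet> sgn x)) *\<^sub>R x)) (at x)"
    by (rule has_derivative_scaleR) (rule has_derivative_ident)
  then have "(grad f has_derivative
      (\<lambda>h. ?q *\<^sub>R h + ((v2 (norm x) - ?q) / norm x * (h \<bullet> sgn x)) *\<^sub>R x)) (at x)"
    by (rule has_derivative_transform_within_open[where s = "ball 0 1 - {0}"]) (use x grad in auto)
  moreover have "?q *\<^sub>R h + ((v2 (norm x) - ?q) / norm x * (h \<bullet> sgn x)) *\<^sub>R x
      = radial_hess ?q (v2 (norm x)) x *v h" for h
    by (simp add: radial_hess_def matrix_vector_mult_add_rdistrib scaleR_matrix_vector_assoc[symmetric]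
        outer_square_mult sgn_div_norm inner_commute divide_inverse power2_eq_square mult_ac)
  ultimately have second: "(grad f has_derivative (\<lambda>h. radial_hess ?q (v2 (norm x)) x *v h)) (at x)"
    by simp
  then show "grad f differentiable (at x)" by (rule differentiableI)
  show "hess f x = radial_hess ?q (v2 (norm x)) x"
    by (rule hess_eqI) (rule second)
qed

lemma radial_emden_derivatives:
  fixes f :: "real^'n \<Rightarrow> real" and x :: "real^'n"
  assumes prof: "emden_profile (real CARD('n)) \<alpha> l p 1 v v1"
    and f: "\<And>y. y \<in> ball 0 1 \<Longrightarrow> f y = v (norm y)"
    and x: "x \<in> ball 0 1" "x \<noteq> 0"
  shows "f differentiable (at x)"
    and "grad f x = (v1 (norm x) / norm x) *\<^sub>R x"
    and "grad f differentiable (at x)"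
    and "hess f x = radial_hess (v1 (norm x) / norm x)
      (- (real CARD('n) - 1) * (v1 (norm x) / norm x) - norm x powr \<alpha> * (l * spow p (v (norm x)))) x"
proof -
  interpret emden_profile "real CARD('n)" \<alpha> l p 1 v v1 by fact
  note D = radial_derivatives[OF f w_der w1_der x]
  show "f differentiable (at x)" by (rule D(1))
  show "grad f x = (v1 (norm x) / norm x) *\<^sub>R x" by (rule D(2))
  show "grad f differentiable (at x)" by (rule D(3))
  show "hess f x = radial_hess (v1 (norm x) / norm x)
      (- (real CARD('n) - 1) * (v1 (norm x) / norm x) - norm x powr \<alpha> * (l * spow p (v (norm x)))) x"
    using D(4) by simp
qed

text \<open>The formulas for the derivatives of a radial function hold away from the origin only; by continuity the estimates
  derived from them extend to the origin.\<close>

lemma limit_bound_at_puncture: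
  fixes F :: "real^'n \<Rightarrow> 'a :: real_normed_vector"
  assumes cont: "continuous_on (ball 0 1) F" and bound: "\<And>x. x \<in> ball 0 1 \<Longrightarrow> x \<noteq> 0 \<Longrightarrow> norm (F x) \<le> c"
    and x: "x \<in> ball 0 1"
  shows "norm (F x) \<le> c"
proof (cases "x = 0")
  case True
  have "isCont F 0"
    using cont by (simp add: continuous_on_eq_continuous_at)
  then have "((\<lambda>x. norm (F x)) \<longlongrightarrow> norm (F 0)) (at 0)"
    unfolding isCont_def by (rule tendsto_norm)
  moreover have "\<forall>\<^sub>F x in at 0. norm (F x) \<le> c"
    unfolding eventually_at using bound by (intro exI[of _ 1]) (auto simp: dist_norm)
  ultimately show ?thesis
    using True tendsto_upperbound by fastforce
qed (use bound x in auto)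

text \<open>
  If the right-hand sides of the two equations differ by at most \<open>\<delta>\<close>, then by the flux bound the quotients
  \<open>v'/r\<close> differ by at most \<open>\<delta>\<close>, and the equation itself carries this over to \<open>v''\<close>. Thus uniform closeness of the
  profiles and of the coefficients implies closeness of the first and second derivatives.
\<close>

lemma radial_C2_close:
  fixes f g :: "real^'n \<Rightarrow> real"
  assumes F: "emden_profile (real CARD('n)) \<alpha> l p 1 v v1" "\<And>y. y \<in> ball 0 1 \<Longrightarrow> f y = v (norm y)"
    and G: "emden_profile (real CARD('n)) \<alpha> k q 1 V V1" "\<And>y. y \<in> ball 0 1 \<Longrightarrow> g y = V (norm y)"
    and C2: "C2_on (ball 0 1) f" "C2_on (ball 0 1) g"
    and close: "\<And>r. 0 < r \<Longrightarrow> r < 1 \<Longrightarrow> \<bar>l * spow p (v r) - k * spow q (V r)\<bar> \<le> \<delta>"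
    and x: "x \<in> ball 0 1"
  shows "norm (grad f x - grad g x) \<le> \<delta>"
    and "norm (hess f x - hess g x) \<le> (norm (mat 1 :: real^'n^'n) + real CARD('n) + 1) * \<delta>"
proof -
  interpret A: emden_profile "real CARD('n)" \<alpha> l p 1 v v1 by fact
  interpret B: emden_profile "real CARD('n)" \<alpha> k q 1 V V1 by fact
  let ?N = "real CARD('n)"
  let ?d = "\<lambda>r. l * spow p (v r) - k * spow q (V r)"
  have \<delta>0: "0 \<le> \<delta>"
    using close[of "1/2"] by linarith
  have d1: "\<bar>v1 r - V1 r\<bar> \<le> \<delta> * r" if r: "0 < r" "r < 1" for r
  proof -
    have "\<bar>v1 r - V1 r\<bar> \<le> \<delta> * r powr (1 + \<alpha>) / (?N + \<alpha>)"
    proof (rule flux_bound[where h = "\<lambda>r. v1 r - V1 r" and k = ?d and S = 1])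
      show "1 < ?N" "0 \<le> \<alpha>" "v1 0 - V1 0 = 0" "0 \<le> r" "r < 1"
        using A.n_ge A.\<alpha>_nonneg A.w1_0 B.w1_0 r by auto
      show "continuous_on {0..<1} (\<lambda>r. v1 r - V1 r)"
        by (intro continuous_intros A.w1_cont B.w1_cont)
      show "\<bar>?d t\<bar> \<le> \<delta>" if "0 < t" "t < 1" for t
        using close that by blast
      show "((\<lambda>r. v1 r - V1 r) has_real_derivative - (?N - 1) / t * (v1 t - V1 t) - t powr \<alpha> * ?d t) (at t)"
        if t: "0 < t" "t < 1" for t
        using DERIV_diff[OF A.w1_der[OF t] B.w1_der[OF t]]
        by (simp add: algebra_simps diff_divide_distrib add_divide_distrib)
    qed
    also have "\<dots> \<le> \<delta> * r powr (1 + \<alpha>) / 1"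
      using A.n_ge A.\<alpha>_nonneg \<delta>0 by (intro divide_left_mono) auto
    also have "r powr (1 + \<alpha>) \<le> r powr 1"
      using r A.\<alpha>_nonneg by (intro powr_mono') auto
    finally show ?thesis
      using r \<delta>0 by (simp add: mult_left_mono)
  qed
  have grad_bound: "norm (grad f y - grad g y) \<le> \<delta>" and hess_bound: "norm (hess f y - hess g y) \<le> (norm (mat 1 :: real^'n^'n) + ?N + 1) * \<delta>"
    if y: "y \<in> ball 0 1" "y \<noteq> 0" for y
  proof -
    let ?r = "norm y"
    have r: "0 < ?r" "?r < 1" using y by auto
    define Q where "Q = v1 ?r / ?r - V1 ?r / ?r"
    define D where "D = ?r powr \<alpha> * ?d ?r"
    have Q: "\<bar>Q\<bar> \<le> \<delta>"
      using d1[OF r] r by (simp add: Q_def field_simps flip: diff_divide_distrib)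
    have "?r powr \<alpha> \<le> 1"
      using r A.\<alpha>_nonneg by (intro powr_le1) auto
    then have "?r powr \<alpha> * \<bar>?d ?r\<bar> \<le> 1 * \<delta>"
      using close[OF r] by (intro mult_mono) auto
    then have D: "\<bar>D\<bar> \<le> \<delta>"
      by (simp add: D_def abs_mult)
    have df: "grad f y = (v1 ?r / ?r) *\<^sub>R y"
        "hess f y = radial_hess (v1 ?r / ?r) (- (?N - 1) * (v1 ?r / ?r) - ?r powr \<alpha> * (l * spow p (v ?r))) y"
      using radial_emden_derivatives(2,4)[of \<alpha> l p v v1 f y] F y by blast+
    have dg: "grad g y = (V1 ?r / ?r) *\<^sub>R y"
        "hess g y = radial_hess (V1 ?r / ?r) (- (?N - 1) * (V1 ?r / ?r) - ?r powr \<alpha> * (k * spow q (V ?r))) y"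
      using radial_emden_derivatives(2,4)[of \<alpha> k q V V1 g y] G y by blast+
    have "grad f y - grad g y = Q *\<^sub>R y"
      unfolding df dg Q_def by (simp add: scaleR_left_diff_distrib)
    moreover have "\<bar>Q\<bar> * ?r \<le> \<delta> * 1"
      using Q r \<delta>0 by (intro mult_mono) auto
    ultimately show "norm (grad f y - grad g y) \<le> \<delta>" by simp
    have "hess f y - hess g y = Q *\<^sub>R mat 1 + ((- ?N * Q - D) / ?r\<^sup>2) *\<^sub>R outer_square y"
      unfolding df dg radial_hess_def Q_def D_def
      by (simp add: algebra_simps diff_divide_distrib add_divide_distrib)
    then have "norm (hess f y - hess g y)
       \<le> \<bar>Q\<bar> * norm (mat 1 :: real^'n^'n) + \<bar>(- ?N * Q - D) / ?r\<^sup>2\<bar> * ?r\<^sup>2"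
      using norm_triangle_ineq[of "Q *\<^sub>R (mat 1 :: real^'n^'n)" "((- ?N * Q - D) / ?r\<^sup>2) *\<^sub>R outer_square y"]
      by (simp add: norm_outer_square)
    also have "\<bar>(- ?N * Q - D) / ?r\<^sup>2\<bar> * ?r\<^sup>2 = \<bar>- ?N * Q - D\<bar>"
      using r by (simp add: abs_divide)
    also have "\<bar>- ?N * Q - D\<bar> \<le> ?N * \<bar>Q\<bar> + \<bar>D\<bar>"
      using abs_triangle_ineq4[of "- ?N * Q" D] by (simp add: abs_mult)
    also have "\<bar>Q\<bar> * norm (mat 1 :: real^'n^'n) + (?N * \<bar>Q\<bar> + \<bar>D\<bar>)
       \<le> \<delta> * norm (mat 1 :: real^'n^'n) + (?N * \<delta> + \<delta>)"
      using Q D by (intro add_mono mult_mono) auto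
    finally show "norm (hess f y - hess g y) \<le> (norm (mat 1 :: real^'n^'n) + ?N + 1) * \<delta>"
      by (simp add: algebra_simps)
  qed
  have "continuous_on (ball 0 1) (grad f)" "continuous_on (ball 0 1) (grad g)"
    using C2 by (auto simp: C2_on_def intro!: continuous_at_imp_continuous_on differentiable_imp_continuous_within)
  then have "continuous_on (ball 0 1) (\<lambda>x. grad f x - grad g x)"
    by (intro continuous_intros)
  then show "norm (grad f x - grad g x) \<le> \<delta>"
    using limit_bound_at_puncture[of "\<lambda>x. grad f x - grad g x"] grad_bound x by blast
  have "continuous_on (ball 0 1) (\<lambda>x. hess f x - hess g x)"
    using C2 by (auto simp: C2_on_def intro!: continuous_intros)
  then show "norm (hess f x - hess g x) \<le> (norm (mat 1 :: real^'n^'n) + real CARD('n) + 1) * \<delta>"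
    using limit_bound_at_puncture[of "\<lambda>x. hess f x - hess g x"] hess_bound x by blast
qed

text \<open>
  At the origin the two eigenvalues \<open>v'/r\<close> and \<open>v''\<close> of the Hessian must have the same limit \<open>q0\<close>. By the equation this
  means that \<open>r\<^sup>\<alpha> l v\<close> tends to \<open>- N q0\<close>.
\<close>

lemma radial_linear_C2:
  fixes g :: "real^'n \<Rightarrow> real"
  assumes prof: "emden_profile (real CARD('n)) \<alpha> l 1 1 v v1"
    and g: "\<And>y. y \<in> ball 0 1 \<Longrightarrow> g y = v (norm y)"
    and q: "((\<lambda>r. v1 r / r) \<longlongrightarrow> q0) (at_right 0)"
    and k: "((\<lambda>r. r powr \<alpha> * (l * v r)) \<longlongrightarrow> - real CARD('n) * q0) (at_right 0)"
  shows "C2_on (ball 0 1) g"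
proof -
  interpret emden_profile "real CARD('n)" \<alpha> l 1 1 v v1 by fact
  let ?N = "real CARD('n)"
  note D = radial_emden_derivatives[OF prof g]
  have at0: "filterlim norm (at_right 0) (at (0::real^'n))"
    unfolding filterlim_at
    by (auto simp: eventually_at_filter intro!: tendsto_norm_zero tendsto_ident_at)
  obtain M where M: "\<And>r. 0 \<le> r \<Longrightarrow> r < 1 \<Longrightarrow> \<bar>v1 r\<bar> \<le> M * r powr (1 + \<alpha>)"
    using w1_bound by blast
  have M0: "0 \<le> M"
  proof -
    have "0 \<le> M * (1/2) powr (1 + \<alpha>)" using M[of "1/2"] by linarith
    then show ?thesis by (simp add: zero_le_mult_iff)
  qed
  have quadratic: "\<bar>v r - v 0\<bar> \<le> M * r\<^sup>2" if r: "0 < r" "r < 1" for r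
  proof -
    obtain \<xi> where \<xi>: "0 < \<xi>" "\<xi> < r" "v r - v 0 = (r - 0) * v1 \<xi>"
    proof -
      have "continuous_on {0..r} v"
        by (rule continuous_on_subset[OF w_cont]) (use r in auto)
      then have "\<exists>l z. 0 < z \<and> z < r \<and> (v has_real_derivative l) (at z) \<and> v r - v 0 = (r - 0) * l"
        using r w_der by (intro MVT) (auto simp: real_differentiable_def intro: less_trans)
      then show ?thesis
        using that w_der r DERIV_unique by (metis less_trans)
    qed
    have "\<bar>v1 \<xi>\<bar> \<le> M * \<xi> powr (1 + \<alpha>)" using M \<xi> r by simp
    also have "\<dots> \<le> M * \<xi> powr 1"
      using \<xi> r \<alpha>_nonneg M0 by (intro mult_left_mono powr_mono') auto
    also have "\<dots> \<le> M * r"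
      using \<xi> M0 by (intro mult_left_mono) auto
    finally have "r * \<bar>v1 \<xi>\<bar> \<le> r * (M * r)"
      using r by (intro mult_left_mono) auto
    then show ?thesis
      using \<xi> r by (simp add: abs_mult power2_eq_square mult_ac)
  qed
  have g0: "(g has_derivative (\<lambda>h. 0 \<bullet> h)) (at 0)"
    unfolding has_derivative_at
  proof (intro conjI)
    show "bounded_linear (\<lambda>h::real^'n. 0 \<bullet> h)" by simp
    have lim: "((\<lambda>h. M * norm h) \<longlongrightarrow> 0) (at (0::real^'n))"
      by (intro tendsto_mult_right_zero tendsto_norm_zero tendsto_ident_at)
    show "(\<lambda>h. norm (g (0 + h) - g 0 - 0 \<bullet> h) / norm h) \<midarrow>0\<rightarrow> 0"
    proof (rule Lim_null_comparison[OF _ lim])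
      show "\<forall>\<^sub>F h in at 0. norm (norm (g (0 + h) - g 0 - 0 \<bullet> h) / norm h) \<le> M * norm h"
        unfolding eventually_at
      proof (intro exI[of _ 1] conjI ballI impI)
        fix h :: "real^'n" assume h: "h \<noteq> 0 \<and> dist h 0 < 1"
        then have "\<bar>g h - g 0\<bar> \<le> M * (norm h)\<^sup>2"
          using quadratic[of "norm h"] g[of h] g[of 0] by simp
        then have "\<bar>g h - g 0\<bar> / norm h \<le> M * (norm h)\<^sup>2 / norm h"
          by (rule divide_right_mono) simp
        then show "norm (norm (g (0 + h) - g 0 - 0 \<bullet> h) / norm h) \<le> M * norm h"
          using h by (simp add: power2_eq_square)
      qed auto
    qed
  qed
  have grad0: "grad g 0 = 0" by (rule grad_eqI[OF g0])
  have hess0: "(grad g has_derivative (\<lambda>h. (q0 *\<^sub>R mat 1) *v h)) (at 0)"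
    unfolding has_derivative_at
  proof (intro conjI)
    show "bounded_linear (\<lambda>h. (q0 *\<^sub>R mat 1 :: real^'n^'n) *v h)"
      by (rule matrix_vector_mul_bounded_linear)
    have "((\<lambda>h::real^'n. \<bar>v1 (norm h) / norm h - q0\<bar>) \<longlongrightarrow> \<bar>q0 - q0\<bar>) (at 0)"
      by (intro tendsto_intros filterlim_compose[OF q at0])
    then have lim: "((\<lambda>h::real^'n. \<bar>v1 (norm h) / norm h - q0\<bar>) \<longlongrightarrow> 0) (at 0)" by simp
    show "(\<lambda>h. norm (grad g (0 + h) - grad g 0 - (q0 *\<^sub>R mat 1) *v h) / norm h) \<midarrow>0\<rightarrow> 0"
    proof (rule Lim_null_comparison[OF _ lim])
      show "\<forall>\<^sub>F h in at 0. norm (norm (grad g (0 + h) - grad g 0 - (q0 *\<^sub>R mat 1) *v h) / norm h)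
          \<le> \<bar>v1 (norm h) / norm h - q0\<bar>"
        unfolding eventually_at
      proof (intro exI[of _ 1] conjI ballI impI)
        fix h :: "real^'n" assume h: "h \<noteq> 0 \<and> dist h 0 < 1"
        then have "grad g (0 + h) - grad g 0 - (q0 *\<^sub>R mat 1) *v h = (v1 (norm h) / norm h - q0) *\<^sub>R h"
          using D(2)[of h] grad0 by (simp add: scaleR_matrix_vector_assoc[symmetric] scaleR_left_diff_distrib)
        then show "norm (norm (grad g (0 + h) - grad g 0 - (q0 *\<^sub>R mat 1) *v h) / norm h)
          \<le> \<bar>v1 (norm h) / norm h - q0\<bar>"
          using h by simp
      qed auto
    qed
  qed
  have hess0_eq: "hess g 0 = q0 *\<^sub>R mat 1" by (rule hess_eqI[OF hess0])
  let ?s = "\<lambda>r. - (?N - 1) * (v1 r / r) - r powr \<alpha> * (l * v r)"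
  have hess_eq: "hess g y = radial_hess (v1 (norm y) / norm y) (?s (norm y)) y"
    if "y \<in> ball 0 1 - {0}" for y
    using D(4)[of y] that by simp
  have "isCont (hess g) x" if x: "x \<in> ball 0 1" for x
  proof (cases "x = 0")
    case True
    have "((\<lambda>y::real^'n. \<bar>v1 (norm y) / norm y - q0\<bar> * norm (mat 1 :: real^'n^'n)
        + \<bar>- ?N * (v1 (norm y) / norm y) - norm y powr \<alpha> * (l * v (norm y))\<bar>) \<longlongrightarrow>
        \<bar>q0 - q0\<bar> * norm (mat 1 :: real^'n^'n) + \<bar>- ?N * q0 - (- ?N * q0)\<bar>) (at 0)"
      by (intro tendsto_intros filterlim_compose[OF q at0] filterlim_compose[OF k at0])
    then have lim: "((\<lambda>y::real^'n. \<bar>v1 (norm y) / norm y - q0\<bar> * norm (mat 1 :: real^'n^'n)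
        + \<bar>- ?N * (v1 (norm y) / norm y) - norm y powr \<alpha> * (l * v (norm y))\<bar>) \<longlongrightarrow> 0) (at 0)"
      by simp
    have "((\<lambda>y. hess g y - hess g 0) \<longlongrightarrow> 0) (at 0)"
    proof (rule Lim_null_comparison[OF _ lim])
      show "\<forall>\<^sub>F y in at 0. norm (hess g y - hess g 0)
        \<le> \<bar>v1 (norm y) / norm y - q0\<bar> * norm (mat 1 :: real^'n^'n)
          + \<bar>- ?N * (v1 (norm y) / norm y) - norm y powr \<alpha> * (l * v (norm y))\<bar>"
        unfolding eventually_at
      proof (intro exI[of _ 1] conjI ballI impI)
        fix y :: "real^'n" assume y: "y \<noteq> 0 \<and> dist y 0 < 1"
        let ?c = "- ?N * (v1 (norm y) / norm y) - norm y powr \<alpha> * (l * v (norm y))"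
        define q where "q = v1 (norm y) / norm y"
        define s where "s = norm y powr \<alpha> * (l * v (norm y))"
        have "hess g y = radial_hess q (- (?N - 1) * q - s) y"
          using hess_eq[of y] y by (simp add: q_def s_def)
        moreover have "- (?N - 1) * q - s - q = - ?N * q - s"
          by (simp add: algebra_simps)
        ultimately have "hess g y - hess g 0 = (q - q0) *\<^sub>R mat 1
            + ((- ?N * q - s) / (norm y)\<^sup>2) *\<^sub>R outer_square y"
          unfolding hess0_eq radial_hess_def by (simp only: scaleR_left_diff_distrib) simp
        then have "hess g y - hess g 0 = (v1 (norm y) / norm y - q0) *\<^sub>R mat 1
            + (?c / (norm y)\<^sup>2) *\<^sub>R outer_square y"
          by (simp only: q_def s_def)
        moreover have "norm ((?c / (norm y)\<^sup>2) *\<^sub>R outer_square y) = \<bar>?c\<bar>"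
          using y by (simp add: norm_outer_square abs_divide)
        ultimately show "norm (hess g y - hess g 0)
            \<le> \<bar>v1 (norm y) / norm y - q0\<bar> * norm (mat 1 :: real^'n^'n) + \<bar>?c\<bar>"
          by (metis norm_scaleR norm_triangle_ineq)
      qed auto
    qed
    then show ?thesis
      using True by (simp add: isCont_def LIM_zero_iff)
  next
    case False
    have op: "open (ball 0 1 - {0::real^'n})" by auto
    have rng: "norm y \<in> {0<..<1}" if "y \<in> ball 0 1 - {0::real^'n}" for y
      using that by auto
    have "continuous_on (ball 0 1 - {0::real^'n}) (\<lambda>y. v (norm y))"
      by (rule continuous_on_compose2[OF w_cont]) (auto intro!: continuous_intros)
    moreover have "continuous_on (ball 0 1 - {0::real^'n}) (\<lambda>y. v1 (norm y))"
      by (rule continuous_on_compose2[OF w1_cont]) (auto intro!: continuous_intros)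
    moreover have "continuous_on (ball 0 1 - {0::real^'n}) outer_square"
      unfolding outer_square_def[abs_def] by (intro continuous_intros)
    ultimately have "continuous_on (ball 0 1 - {0::real^'n})
        (\<lambda>y. radial_hess (v1 (norm y) / norm y) (?s (norm y)) y)"
      unfolding radial_hess_def by (intro continuous_intros) auto
    then have "continuous_on (ball 0 1 - {0}) (hess g)"
      using hess_eq by (subst continuous_on_cong) auto
    then show ?thesis
      using False x op by (simp add: continuous_on_eq_continuous_at)
  qed
  then have "continuous_on (ball 0 1) (hess g)"
    by (intro continuous_at_imp_continuous_on) auto
  moreover have "g differentiable (at x) \<and> grad g differentiable (at x)" if "x \<in> ball 0 1" for x
  proof (cases "x = 0")
    case True
    then show ?thesis
      using differentiableI[OF g0] differentiableI[OF hess0] by simp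
  next
    case False
    then show ?thesis
      using D(1)[of x] D(3)[of x] that by simp
  qed
  ultimately show ?thesis by (auto simp: C2_on_def)
qed

lemma C2_on_cmult:
  fixes f :: "real^'n \<Rightarrow> real"
  assumes f: "C2_on S f" and S: "open S"
  shows "C2_on S (\<lambda>x. c * f x)"
proof -
  have df: "(f has_derivative (\<lambda>h. grad f x \<bullet> h)) (at x)" if "x \<in> S" for x
    using f that by (intro has_derivative_grad) (auto simp: C2_on_def)
  have d: "((\<lambda>x. c * f x) has_derivative (\<lambda>h. (c *\<^sub>R grad f x) \<bullet> h)) (at x)" if "x \<in> S" for x
    using has_derivative_mult_right[OF df[OF that], of c] by simp
  have g: "grad (\<lambda>x. c * f x) x = c *\<^sub>R grad f x" if "x \<in> S" for x
    using d[OF that] by (rule grad_eqI)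
  have dg: "(grad (\<lambda>x. c * f x) has_derivative (\<lambda>h. (c *\<^sub>R hess f x) *v h)) (at x)" if x: "x \<in> S" for x
  proof -
    have "(grad f has_derivative (\<lambda>h. hess f x *v h)) (at x)"
      using f x unfolding C2_on_def jacobian_works hess_def by blast
    then have "((\<lambda>x. c *\<^sub>R grad f x) has_derivative (\<lambda>h. c *\<^sub>R (hess f x *v h))) (at x)"
      by (rule has_derivative_scaleR_right)
    then have "(grad (\<lambda>x. c * f x) has_derivative (\<lambda>h. c *\<^sub>R (hess f x *v h))) (at x)"
      by (rule has_derivative_transform_within_open[where s = S]) (use S x g in auto)
    then show ?thesis by (simp add: scaleR_matrix_vector_assoc)
  qed
  have "continuous_on S (\<lambda>x. c *\<^sub>R hess f x)"
    using f by (auto simp: C2_on_def intro!: continuous_intros)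
  then have "continuous_on S (hess (\<lambda>x. c * f x))"
    by (rule continuous_on_eq) (use dg hess_eqI in metis)
  moreover have "(\<lambda>x. c * f x) differentiable (at x)" "grad (\<lambda>x. c * f x) differentiable (at x)"
    if "x \<in> S" for x
    using differentiableI[OF d[OF that]] differentiableI[OF dg[OF that]] by simp_all
  ultimately show ?thesis
    by (simp add: C2_on_def)
qed

section \<open>The limit profile of the Henon equation\<close>

text \<open>The powers of \<open>z\<close> and \<open>|x|\<close> in front of the Bessel function cancel its factor \<open>r\<^sup>\<beta>\<close>, and the Gamma factor cancels its leading
  coefficient. What remains is continuous at the origin, so \<open>Lim\<close> is evaluated there.\<close>

lemma henon_profile_eq:
  fixes x :: "real^'n"
  assumes N: "2 \<le> CARD('n)" and \<alpha>: "0 \<le> \<alpha>" and m: "1 \<le> m"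
  shows "henon_profile \<alpha> m x = linear_profile (real CARD('n)) \<alpha>
    (kth_smallest (linear_zeros (real CARD('n)) \<alpha>) m * norm x)"
proof -
  let ?n = "real CARD('n)" and ?b = "2 + \<alpha>"
  let ?\<beta> = "(?n - 2) / ?b"
  define s where "s = kth_smallest (linear_zeros ?n \<alpha>) m"
  have n: "2 \<le> ?n" using N by simp
  have \<beta>: "0 \<le> ?\<beta>" using n \<alpha> by simp
  have s: "0 < s"
    using kth_linear_zero(1)[OF n \<alpha> m] by (simp add: s_def linear_zeros_def)
  have formula: "henon_profile_formula \<alpha> m y = linear_profile ?n \<alpha> (s * norm y)"
    if y: "y \<noteq> 0" for y :: "real^'n"
  proof -
    define z where "z = s powr (?b / 2) / (?b / 2)"
    define r where "r = norm y"
    have r: "0 < r" using y by (simp add: r_def)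
    have z: "bessel_zero (henon_order CARD('n) \<alpha>) m = z"
      unfolding henon_order_def z_def s_def by (rule bessel_zero_eq[OF n \<alpha> m])
    have zpos: "0 < z" using s \<alpha> by (simp add: z_def)
    have G: "Gamma ((?n + \<alpha>) / ?b) = Gamma (1 + ?\<beta>)"
    proof -
      have "(?n + \<alpha>) / ?b = 1 + ?\<beta>" using \<alpha> by (simp add: field_simps)
      then show ?thesis by simp
    qed
    have Gpos: "0 < Gamma (1 + ?\<beta>)" using \<beta> by (intro Gamma_real_pos) auto
    have arg: "z * r powr (?b / 2) > 0" using zpos r by simp
    have "rpow (z * r powr (?b / 2)) ?\<beta> = (z * r powr (?b / 2)) powr ?\<beta>"
      using arg unfolding rpow_def by (metis powr_zero_eq_one less_irrefl)
    also have "\<dots> = z powr ?\<beta> * r powr ((?n - 2) / 2)"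
    proof -
      have half: "x / 2 * (y / x) = y / 2" if "x \<noteq> 0" for x y :: real
        using that by simp
      have "?b / 2 * ?\<beta> = (?n - 2) / 2" by (rule half) (use \<alpha> in simp)
      then have "(r powr (?b / 2)) powr ?\<beta> = r powr ((?n - 2) / 2)" by (simp only: powr_powr)
      then show ?thesis using zpos r by (simp add: powr_mult)
    qed
    finally have rp: "rpow (z * r powr (?b / 2)) ?\<beta> = z powr ?\<beta> * r powr ((?n - 2) / 2)" .
    have sq: "(z * r powr (?b / 2))\<^sup>2 / 4 = (s * r) powr ?b / ?b\<^sup>2"
    proof -
      have half: "(t powr (?b / 2))\<^sup>2 = t powr ?b" for t :: real
        using powr_add[of t "?b / 2" "?b / 2"] by (simp only: field_sum_of_halves power2_eq_square)
      have "(z * r powr (?b / 2))\<^sup>2 / 4 = (s powr (?b / 2))\<^sup>2 * (r powr (?b / 2))\<^sup>2 / ?b\<^sup>2"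
        by (simp add: z_def power_mult_distrib power_divide)
      then show ?thesis using s r by (simp add: half powr_mult)
    qed
    have cancel: "z powr (- ?\<beta>) * z powr ?\<beta> = 1" "r powr (- ((?n - 2) / 2)) * r powr ((?n - 2) / 2) = 1"
      using zpos r by (simp_all flip: powr_add)
    have "henon_profile_formula \<alpha> m y
       = z powr (- ?\<beta>) * Gamma (1 + ?\<beta>) * r powr (- ((?n - 2) / 2)) *
          (z powr ?\<beta> * r powr ((?n - 2) / 2) / Gamma (1 + ?\<beta>) * bessel_series ?\<beta> ((s * r) powr ?b / ?b\<^sup>2))"
      unfolding henon_profile_formula_def Let_def z unfolding henon_order_def G r_def[symmetric]
        bessel_J_series[OF \<beta>] rp sq ..
    also have "\<dots> = (z powr (- ?\<beta>) * z powr ?\<beta>) * (r powr (- ((?n - 2) / 2)) * r powr ((?n - 2) / 2))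
         * bessel_series ?\<beta> ((s * r) powr ?b / ?b\<^sup>2)"
      using Gpos by simp
    also have "\<dots> = linear_profile ?n \<alpha> (s * r)"
      unfolding cancel linear_profile_def by simp
    finally show ?thesis by (simp add: r_def)
  qed
  show ?thesis
  proof (cases "x = 0")
    case False
    then show ?thesis using formula by (simp add: henon_profile_def s_def)
  next
    case True
    interpret emden_profile ?n \<alpha> 1 1 1 "linear_profile ?n \<alpha>" "linear_profile' ?n \<alpha>"
      by (rule emden_linear_profile[OF n \<alpha>]) simp
    have "((\<lambda>y::real^'n. s * norm y) \<longlongrightarrow> 0) (at 0)"
      by (intro tendsto_mult_right_zero tendsto_norm_zero tendsto_ident_at)
    moreover have "eventually (\<lambda>y::real^'n. s * norm y \<in> {0..1} \<and> s * norm y \<noteq> 0) (at 0)"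
      unfolding eventually_at
      using s by (intro exI[of _ "1 / s"]) (auto simp: field_simps)
    ultimately have "filterlim (\<lambda>y::real^'n. s * norm y) (at 0 within {0..1}) (at 0)"
      unfolding filterlim_at by (auto elim: eventually_mono)
    moreover have "(linear_profile ?n \<alpha> \<longlongrightarrow> linear_profile ?n \<alpha> 0) (at 0 within {0..1})"
      using w_cont by (simp add: continuous_on_def)
    ultimately have "((\<lambda>y::real^'n. linear_profile ?n \<alpha> (s * norm y)) \<longlongrightarrow> linear_profile ?n \<alpha> 0) (at 0)"
      by (rule filterlim_compose[rotated])
    then have "((henon_profile_formula \<alpha> m :: real^'n \<Rightarrow> real) \<longlongrightarrow> linear_profile ?n \<alpha> 0) (at 0)"
      by (rule Lim_transform_eventually) (auto simp: eventually_at formula intro!: exI[of _ 1])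
    then have "Lim (at 0) (henon_profile_formula \<alpha> m :: real^'n \<Rightarrow> real) = linear_profile ?n \<alpha> 0"
      by (intro tendsto_Lim) auto
    then show ?thesis using True by (simp add: henon_profile_def)
  qed
qed

text \<open>The weight \<open>r\<^sup>\<alpha>\<close> tends to 1 if \<open>\<alpha> = 0\<close> and to 0 otherwise. In the first case the two limits required at the origin fit
  together because of Bessel's equation at \<open>y = 0\<close>.\<close>

lemma C2_henon_profile:
  assumes N: "2 \<le> CARD('n)" and \<alpha>: "0 \<le> \<alpha>" and s: "0 < s"
    and g: "\<And>x::real^'n. g x = linear_profile (real CARD('n)) \<alpha> (s * norm x)"
  shows "C2_on (ball 0 1) g"
proof -
  let ?n = "real CARD('n)" and ?b = "2 + \<alpha>"
  let ?\<beta> = "(?n - 2) / ?b"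
  have n: "2 \<le> ?n" using N by simp
  have \<beta>: "0 \<le> ?\<beta>" using n \<alpha> by simp
  have lin: "emden_profile ?n \<alpha> 1 1 s (linear_profile ?n \<alpha>) (linear_profile' ?n \<alpha>)"
    by (rule emden_linear_profile[OF n \<alpha> s])
  define a0 :: real where "a0 = (if \<alpha> = 0 then 1 else 0)"
  have a0: "((\<lambda>r. r powr \<alpha>) \<longlongrightarrow> a0) (at_right 0)"
  proof (cases "\<alpha> = 0")
    case True
    then show ?thesis
      by (intro tendsto_eventually) (auto simp: a0_def eventually_at_right_field intro!: exI[of _ 1])
  next
    case False
    then have "((\<lambda>r::real. r powr \<alpha>) \<longlongrightarrow> 0 powr \<alpha>) (at_right 0)"
      using \<alpha> by (intro tendsto_intros) (auto simp: eventually_at_right_field intro!: exI[of _ 1])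
    then show ?thesis using False by (simp add: a0_def)
  qed
  have "((\<lambda>r. (s * r) powr ?b) \<longlongrightarrow> (s * 0) powr ?b) (at_right 0)"
    using \<alpha> s by (intro tendsto_intros) (auto simp: eventually_at_right_field intro!: exI[of _ 1])
  then have "((\<lambda>r. (s * r) powr ?b / ?b\<^sup>2) \<longlongrightarrow> 0 / ?b\<^sup>2) (at_right 0)"
    using \<alpha> by (intro tendsto_divide tendsto_const) auto
  then have y: "((\<lambda>r. (s * r) powr ?b / ?b\<^sup>2) \<longlongrightarrow> 0) (at_right 0)" by simp
  define c where "c = bessel_series' ?\<beta> 0"
  have B0: "((\<lambda>r. linear_profile ?n \<alpha> (s * r)) \<longlongrightarrow> 1) (at_right 0)"
    unfolding linear_profile_def
    using isCont_tendsto_compose[OF DERIV_isCont[OF DERIV_bessel_series(1)[OF \<beta>]] y] bessel_series_0[OF \<beta>]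
    by simp
  have B1: "((\<lambda>r. bessel_series' ?\<beta> ((s * r) powr ?b / ?b\<^sup>2)) \<longlongrightarrow> c) (at_right 0)"
    unfolding c_def
    using isCont_tendsto_compose[OF DERIV_isCont[OF DERIV_bessel_series(2)[OF \<beta>]] y] by simp
  define q0 where "q0 = s powr ?b * c * a0 / ?b"
  show ?thesis
  proof (rule radial_linear_C2[OF emden_profile_unit[OF lin], of g q0])
    show "\<And>y. y \<in> ball 0 1 \<Longrightarrow> g y = linear_profile ?n \<alpha> (s * norm y)" by (rule g)
    have "((\<lambda>r. s powr ?b * bessel_series' ?\<beta> ((s * r) powr ?b / ?b\<^sup>2) * r powr \<alpha> / ?b) \<longlongrightarrow> q0) (at_right 0)"
      unfolding q0_def using \<alpha> by (intro tendsto_intros B1 a0) auto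
    then show "((\<lambda>r. s * linear_profile' ?n \<alpha> (s * r) / r) \<longlongrightarrow> q0) (at_right 0)"
    proof (rule Lim_transform_eventually)
      have "s powr ?b * bessel_series' ?\<beta> ((s * r) powr ?b / ?b\<^sup>2) * r powr \<alpha> / ?b
          = s * linear_profile' ?n \<alpha> (s * r) / r" if "0 < r" for r
        using that s by (simp add: linear_profile'_def powr_mult powr_add power2_eq_square)
      then show "\<forall>\<^sub>F r in at_right 0. s powr ?b * bessel_series' ?\<beta> ((s * r) powr ?b / ?b\<^sup>2) * r powr \<alpha> / ?b
          = s * linear_profile' ?n \<alpha> (s * r) / r"
        by (auto simp: eventually_at_right_field intro!: exI[of _ 1])
    qed
    have "((\<lambda>r. r powr \<alpha> * (s powr ?b * linear_profile ?n \<alpha> (s * r))) \<longlongrightarrow> a0 * (s powr ?b * 1)) (at_right 0)"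
      by (intro tendsto_intros a0 B0)
    moreover have "a0 * (s powr ?b * 1) = - ?n * q0"
    proof (cases "\<alpha> = 0")
      case True
      have "(1 + ?\<beta>) * c + 1 = 0"
        using bessel_series_ode[OF \<beta>, of 0] bessel_series_0[OF \<beta>] by (simp add: c_def)
      then have "?n * c = - 2" using True by (simp add: field_simps)
      moreover have "- ?n * q0 = - (?n * c) * (s powr ?b * a0 / ?b)"
        by (simp add: q0_def)
      ultimately show ?thesis using True by (simp add: a0_def)
    qed (simp add: a0_def q0_def)
    ultimately show "((\<lambda>r. r powr \<alpha> * (s powr ?b * linear_profile ?n \<alpha> (s * r))) \<longlongrightarrow> - ?n * q0) (at_right 0)"
      by simp
  qed
qed

section \<open>Solutions with a given number of nodal zones\<close>

text \<open>The restriction of \<open>u\<close> to a line through the origin is even, so its derivative vanishes at 0, and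
  the trace of the radial Hessian turns the Laplacian into the ordinary differential operator.\<close>

lemma radial_solution_profile:
  fixes u :: "real^'n \<Rightarrow> real" and e :: "real^'n"
  assumes sol: "radial_henon_solution \<alpha> p u" and N: "2 \<le> CARD('n)" and \<alpha>: "0 \<le> \<alpha>" and p: "1 < p"
    and e: "norm e = 1"
  defines "v \<equiv> \<lambda>r. u (r *\<^sub>R e)" and "v1 \<equiv> \<lambda>r. grad u (r *\<^sub>R e) \<bullet> e"
  shows "emden_profile (real CARD('n)) \<alpha> 1 p 1 v v1"
    and "\<And>x. x \<in> cball 0 1 \<Longrightarrow> u x = v (norm x)"
    and "v 1 = 0"
proof -
  have C2: "C2_on (ball 0 1) u" and cont: "continuous_on (cball 0 1) u"
    and pde: "\<And>x. x \<in> ball 0 1 \<Longrightarrow> - laplacian u x = rpow (norm x) \<alpha> * \<bar>u x\<bar> powr (p - 1) * u x"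
    and bd: "\<And>x. x \<in> sphere 0 1 \<Longrightarrow> u x = 0"
    and rad: "\<And>x y. x \<in> cball 0 1 \<Longrightarrow> y \<in> cball 0 1 \<Longrightarrow> norm x = norm y \<Longrightarrow> u x = u y"
    using sol unfolding radial_henon_solution_def by blast+
  show u_eq: "u x = v (norm x)" if "x \<in> cball 0 1" for x
    unfolding v_def using that e by (intro rad) auto
  show "v 1 = 0" unfolding v_def using e by (intro bd) auto
  have ray: "((\<lambda>r. r *\<^sub>R e) has_derivative (\<lambda>h. h *\<^sub>R e)) (at r)" for r
    by (auto intro!: derivative_eq_intros)
  have in_ball: "r *\<^sub>R e \<in> ball 0 1" if "\<bar>r\<bar> < 1" for r
    using that e by simp
  have dv: "(v has_real_derivative v1 r) (at r)" if r: "\<bar>r\<bar> < 1" for r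
  proof -
    have "u differentiable (at (r *\<^sub>R e))"
      using C2 in_ball[OF r] by (auto simp: C2_on_def)
    then have "(u has_derivative (\<lambda>h. grad u (r *\<^sub>R e) \<bullet> h)) (at (r *\<^sub>R e))"
      by (rule has_derivative_grad)
    from has_derivative_compose[OF ray this] show ?thesis
      by (simp add: has_field_derivative_def v_def v1_def mult.commute[of _ "grad u (r *\<^sub>R e) \<bullet> e"])
  qed
  define v2 where "v2 = (\<lambda>r. (hess u (r *\<^sub>R e) *v e) \<bullet> e)"
  have dv1: "(v1 has_real_derivative v2 r) (at r)" if r: "\<bar>r\<bar> < 1" for r
  proof -
    have "grad u differentiable (at (r *\<^sub>R e))"
      using C2 in_ball[OF r] by (auto simp: C2_on_def)
    then have "(grad u has_derivative (\<lambda>h. hess u (r *\<^sub>R e) *v h)) (at (r *\<^sub>R e))"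
      unfolding jacobian_works hess_def by simp
    from has_derivative_compose[OF ray this]
    have "((\<lambda>r. grad u (r *\<^sub>R e)) has_derivative (\<lambda>h. hess u (r *\<^sub>R e) *v (h *\<^sub>R e))) (at r)" .
    then have "((\<lambda>r. grad u (r *\<^sub>R e) \<bullet> e) has_derivative (\<lambda>h. (hess u (r *\<^sub>R e) *v (h *\<^sub>R e)) \<bullet> e)) (at r)"
      by (rule has_derivative_inner_left)
    moreover have "(hess u (r *\<^sub>R e) *v (h *\<^sub>R e)) \<bullet> e = v2 r * h" for h
      by (simp add: v2_def matrix_vector_mult_scaleR)
    ultimately show ?thesis
      by (simp add: has_field_derivative_def v1_def)
  qed
  have v1_0: "v1 0 = 0"
  proof -
    have "((\<lambda>r. v (- r)) has_real_derivative v1 (- 0) * (- 1)) (at 0)"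
      by (rule DERIV_chain2[where f = v and g = uminus]) (auto intro!: dv derivative_eq_intros)
    then have "(v has_real_derivative v1 (- 0) * (- 1)) (at 0)"
    proof (rule has_field_derivative_transform_within_open[where S = "{-1<..<1}"])
      fix r :: real assume "r \<in> {-1<..<1}"
      then show "v (- r) = v r"
        unfolding v_def using e by (intro rad) auto
    qed auto
    then have "v1 (- 0) * (- 1) = v1 0"
      using dv[of 0] DERIV_unique by fastforce
    then show ?thesis by simp
  qed
  show "emden_profile (real CARD('n)) \<alpha> 1 p 1 v v1"
  proof
    show "continuous_on {0..1} v"
      unfolding v_def by (rule continuous_on_compose2[OF cont]) (auto intro!: continuous_intros simp: e)
    have "isCont v1 r" if "r \<in> {0..<1}" for r
      using dv1[of r] that by (auto intro: DERIV_isCont)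
    then show "continuous_on {0..<1} v1"
      by (intro continuous_at_imp_continuous_on) auto
    fix r :: real assume r: "0 < r" "r < 1"
    then show "(v has_real_derivative v1 r) (at r)" by (intro dv) auto
    have re: "r *\<^sub>R e \<in> ball 0 1" "r *\<^sub>R e \<noteq> 0" "norm (r *\<^sub>R e) = r"
      using r e by auto
    have "hess u (r *\<^sub>R e) = radial_hess (v1 r / r) (v2 r) (r *\<^sub>R e)"
      using radial_derivatives(4)[of u v v1 v2 "r *\<^sub>R e"] u_eq dv dv1 re by auto
    then have "laplacian u (r *\<^sub>R e) = v2 r + (real CARD('n) - 1) * (v1 r / r)"
      using trace_radial_hess[OF re(2)] by (simp add: laplacian_def)
    moreover have "rpow r \<alpha> = r powr \<alpha>"
      using r by (simp add: rpow_def)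
    moreover have "a * (b / c) = - (- a / c * b)" for a b c :: real
      by simp
    then have "(real CARD('n) - 1) * (v1 r / r) = - (- (real CARD('n) - 1) / r * v1 r)"
      by blast
    ultimately have "v2 r = - (real CARD('n) - 1) / r * v1 r - r powr \<alpha> * (1 * spow p (v r))"
      using pde[OF re(1)] unfolding re(3) v_def spow_def by (simp only: mult.assoc mult_1)
    then show "(v1 has_real_derivative - (real CARD('n) - 1) / r * v1 r - r powr \<alpha> * (1 * spow p (v r))) (at r)"
      using dv1[of r] r by simp
  qed (use N \<alpha> p v1_0 in auto)
qed

text \<open>Each zero \<open>z\<close> is assigned the annulus between the preceding zero and \<open>z\<close>. The value \<open>-1\<close> stands for the predecessor
  of the first zero, so that the innermost annulus is a ball that contains the origin. Annuli are connected in dimension at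
  least 2.\<close>

lemma components_punctured_ball:
  fixes v :: "real \<Rightarrow> real"
  assumes N: "2 \<le> CARD('n)" and v0: "v 0 \<noteq> 0" and v1: "v 1 = 0"
    and fin: "finite {r. 0 < r \<and> r \<le> 1 \<and> v r = 0}"
  shows "card (components {x \<in> ball (0::real^'n) 1. v (norm x) \<noteq> 0}) = card {r. 0 < r \<and> r \<le> 1 \<and> v r = 0}"
proof -
  define Z where "Z = {r. 0 < r \<and> r \<le> 1 \<and> v r = 0}"
  define pred where "pred z = Max (insert (-1) {t \<in> Z. t < z})" for z
  define C where "C z = {x::real^'n. pred z < norm x \<and> norm x < z}" for z
  have finZ: "finite Z" using fin by (simp add: Z_def)
  have Z1: "1 \<in> Z" using v1 by (simp add: Z_def)
  have pred_ge: "t \<le> pred z" if "t \<in> Z" "t < z" for t z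
    unfolding pred_def using finZ that by (intro Max_ge) auto
  have pred_in: "pred z \<in> insert (-1) {t \<in> Z. t < z}" for z
    unfolding pred_def using finZ by (intro Max_in) auto
  have pred_less: "pred z < z" if "z \<in> Z" for z
    using pred_in[of z] that by (auto simp: Z_def)
  have C_props: "open (C z)" "connected (C z)" "C z \<noteq> {}" if z: "z \<in> Z" for z
  proof -
    show "open (C z)"
      unfolding C_def by (intro open_Collect_conj open_Collect_less continuous_intros)
    show "connected (C z)"
      using connected_annulus(1)[of "pred z" "0::real^'n" z] N by (simp add: C_def)
    obtain x :: "real^'n" where "norm x = (max (pred z) 0 + z) / 2"
      using vector_choose_size[of "(max (pred z) 0 + z) / 2"] z by (auto simp: Z_def)
    moreover have "max (pred z) 0 < z" using pred_less[OF z] z by (simp add: Z_def)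
    ultimately have "x \<in> C z" by (auto simp: C_def)
    then show "C z \<noteq> {}" by blast
  qed
  have disj: "C z \<inter> C z' = {}" if "z \<in> Z" "z' \<in> Z" "z < z'" for z z'
    using pred_ge[OF that(1) that(3)] by (auto simp: C_def)
  have disj': "C z \<inter> C z' = {}" if "z \<in> Z" "z' \<in> Z" "z \<noteq> z'" for z z'
    using disj[of z z'] disj[of z' z] that by (cases z z' rule: linorder_cases) auto
  have "inj_on C Z"
  proof (rule inj_onI)
    fix z z' assume "z \<in> Z" "z' \<in> Z" "C z = C z'"
    then show "z = z'" using disj'[of z z'] C_props(3)[of z] by auto
  qed
  have "components {x \<in> ball (0::real^'n) 1. v (norm x) \<noteq> 0} = C ` Z"
  proof (rule components_open_unique)
    show "pairwise disjnt (C ` Z)"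
    proof (rule pairwiseI)
      fix X Y assume "X \<in> C ` Z" "Y \<in> C ` Z" "X \<noteq> Y"
      then show "disjnt X Y" using disj' by (auto simp: disjnt_def)
    qed
    show "\<And>X. X \<in> C ` Z \<Longrightarrow> open X \<and> connected X \<and> X \<noteq> {}"
      using C_props by auto
    show "\<Union> (C ` Z) = {x \<in> ball (0::real^'n) 1. v (norm x) \<noteq> 0}"
    proof (intro equalityI subsetI)
      fix x assume "x \<in> \<Union> (C ` Z)"
      then obtain z where z: "z \<in> Z" "pred z < norm x" "norm x < z"
        by (auto simp: C_def)
      have z1: "z \<le> 1" using z(1) by (simp add: Z_def)
      have "v (norm x) \<noteq> 0"
      proof
        assume "v (norm x) = 0"
        then have "norm x \<in> Z"
          using v0 z(3) z1 by (cases "x = 0") (auto simp: Z_def)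
        then show False using pred_ge[of "norm x" z] z by simp
      qed
      then show "x \<in> {x \<in> ball 0 1. v (norm x) \<noteq> 0}"
        using z(3) z1 by simp
    next
      fix x :: "real^'n" assume x: "x \<in> {x \<in> ball 0 1. v (norm x) \<noteq> 0}"
      let ?A = "{t \<in> Z. norm x < t}"
      have A: "finite ?A" "?A \<noteq> {}" using finZ Z1 x by auto
      define z where "z = Min ?A"
      have z: "z \<in> Z" "norm x < z" using Min_in[OF A] by (auto simp: z_def)
      have least: "z \<le> t" if "t \<in> Z" "norm x < t" for t
        unfolding z_def using A that by (intro Min_le) auto
      have "pred z < norm x"
      proof (cases "pred z = -1")
        case True
        then show ?thesis using norm_ge_zero[of x] by linarith
      next
        case False
        then have p: "pred z \<in> Z" "pred z < z" using pred_in[of z] by auto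
        then have "\<not> norm x < pred z" using least[of "pred z"] by linarith
        moreover have "pred z \<noteq> norm x" using p(1) x by (auto simp: Z_def)
        ultimately show ?thesis by simp
      qed
      then show "x \<in> \<Union> (C ` Z)" using z by (auto simp: C_def)
    qed
  qed
  then show ?thesis
    using card_image[OF \<open>inj_on C Z\<close>] by (simp add: Z_def)
qed

text \<open>
  A solution that vanishes at the origin would vanish identically and have no nodal zone. So one can divide by \<open>u(0)\<close>, and
  stretching the radius by \<open>\<sigma> = |u(0)|\<^bsup>(p-1)/(2+\<alpha>)\<^esup>\<close> makes the coefficient of the equation equal to 1.
\<close>

lemma normalized_solution:
  fixes u :: "real^'n \<Rightarrow> real"
  assumes sol: "radial_henon_solution \<alpha> p u" and card: "card (nodal_zones u) = m" and m: "1 \<le> m"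
    and N: "2 \<le> CARD('n)" and \<alpha>: "0 \<le> \<alpha>" and p: "1 < p"
  shows "\<exists>\<sigma> w w1. 0 < \<sigma> \<and> emden_profile (real CARD('n)) \<alpha> 1 p \<sigma> w w1 \<and> w 0 = 1 \<and> w \<sigma> = 0 \<and>
    sup_norm u powr ((p - 1) / 2) = \<sigma> powr ((2 + \<alpha>) / 2) \<and>
    (\<forall>x\<in>cball 0 1. sgn (u 0) * (u x / sup_norm u) = w (\<sigma> * norm x)) \<and>
    nodal_radii u = (\<lambda>s. s / \<sigma>) ` {s. 0 < s \<and> s \<le> \<sigma> \<and> w s = 0} \<and>
    card {s. 0 < s \<and> s \<le> \<sigma> \<and> w s = 0} = m"
proof -
  define e :: "real^'n" where "e = axis undefined 1"
  have e: "norm e = 1" by (simp add: e_def norm_axis_1)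
  define v where "v = (\<lambda>r. u (r *\<^sub>R e))"
  define v1 where "v1 = (\<lambda>r. grad u (r *\<^sub>R e) \<bullet> e)"
  have prof: "emden_profile (real CARD('n)) \<alpha> 1 p 1 v v1"
    and u: "\<And>x. x \<in> cball 0 1 \<Longrightarrow> u x = v (norm x)" and v_1: "v 1 = 0"
    using radial_solution_profile[OF sol N \<alpha> p e] unfolding v_def v1_def by auto
  interpret emden_profile "real CARD('n)" \<alpha> 1 p 1 v v1 by (rule prof)
  have zones: "nodal_zones u = components {x \<in> ball 0 1. v (norm x) \<noteq> 0}"
    unfolding nodal_zones_def using u by (intro arg_cong[where f = components]) auto
  have v0: "v 0 \<noteq> 0"
  proof
    assume "v 0 = 0"
    then have "v r = 0" if "0 \<le> r" "r < 1" for r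
      using abs_w_le[OF that] by simp
    then have "{x \<in> ball (0::real^'n) 1. v (norm x) \<noteq> 0} = {}" by auto
    then have "nodal_zones u = {}"
      unfolding zones by (simp only: components_empty)
    then show False using card m by simp
  qed
  define Z where "Z = {r. 0 < r \<and> r \<le> 1 \<and> v r = 0}"
  have finZ: "finite Z"
    by (rule finite_subset[OF _ finite_zeros[OF v0]]) (auto simp: Z_def)
  have cardZ: "card Z = m"
    using components_punctured_ball[OF N v0 v_1] finZ card zones unfolding Z_def by simp
  have u0: "u 0 = v 0" using u[of 0] by simp
  have sup: "sup_norm u = \<bar>v 0\<bar>"
    unfolding sup_norm_def
  proof (rule cSup_eq_maximum)
    show "\<bar>v 0\<bar> \<in> (\<lambda>x. \<bar>u x\<bar>) ` ball 0 1"
      using u0 by (intro image_eqI[of _ _ 0]) auto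
    fix y assume "y \<in> (\<lambda>x. \<bar>u x\<bar>) ` ball 0 1"
    then show "y \<le> \<bar>v 0\<bar>" using u abs_w_le by auto
  qed
  define \<mu> where "\<mu> = \<bar>v 0\<bar> powr (p - 1)"
  define \<sigma> where "\<sigma> = \<mu> powr (1 / (2 + \<alpha>))"
  have \<mu>: "0 < \<mu>" using v0 by (simp add: \<mu>_def)
  then have \<sigma>: "0 < \<sigma>" by (simp add: \<sigma>_def)
  have \<sigma>\<mu>: "\<sigma> powr (2 + \<alpha>) = \<mu>"
    using \<mu> \<alpha> by (simp add: \<sigma>_def powr_powr)
  define w where "w = (\<lambda>s. v (s / \<sigma>) / v 0)"
  define w1 where "w1 = (\<lambda>s. v1 (s / \<sigma>) / (\<sigma> * v 0))"
  have "emden_profile (real CARD('n)) \<alpha> (1 * \<bar>v 0\<bar> powr (p - 1) / \<sigma> powr (2 + \<alpha>)) p (\<sigma> * 1) w w1"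
    unfolding w_def w1_def by (rule emden_profile_scale[OF prof v0 \<sigma>])
  moreover have "1 * \<bar>v 0\<bar> powr (p - 1) / \<sigma> powr (2 + \<alpha>) = 1"
    unfolding \<sigma>\<mu> using \<mu> by (simp add: \<mu>_def)
  ultimately have profw: "emden_profile (real CARD('n)) \<alpha> 1 p \<sigma> w w1"
    by (simp only: mult_1_right)
  have wZ: "{s. 0 < s \<and> s \<le> \<sigma> \<and> w s = 0} = (\<lambda>r. \<sigma> * r) ` Z"
  proof (intro equalityI subsetI)
    fix s assume s: "s \<in> {s. 0 < s \<and> s \<le> \<sigma> \<and> w s = 0}"
    then have "s / \<sigma> \<in> Z" using v0 \<sigma> by (simp add: Z_def w_def)
    then show "s \<in> (\<lambda>r. \<sigma> * r) ` Z" using \<sigma> by (intro image_eqI[of _ _ "s / \<sigma>"]) auto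
  next
    fix s assume "s \<in> (\<lambda>r. \<sigma> * r) ` Z"
    then show "s \<in> {s. 0 < s \<and> s \<le> \<sigma> \<and> w s = 0}"
      using \<sigma> by (auto simp: Z_def w_def)
  qed
  have radii: "nodal_radii u = Z"
  proof (intro equalityI subsetI)
    fix r assume r: "r \<in> nodal_radii u"
    then have "u (r *\<^sub>R e) = 0" using e by (simp add: nodal_radii_def)
    then show "r \<in> Z" using r by (simp add: nodal_radii_def Z_def v_def)
  next
    fix r assume "r \<in> Z"
    then show "r \<in> nodal_radii u" using u by (simp add: nodal_radii_def Z_def)
  qed
  show ?thesis
  proof (intro exI conjI ballI)
    show "0 < \<sigma>" by (rule \<sigma>)
    show "emden_profile (real CARD('n)) \<alpha> 1 p \<sigma> w w1" by (rule profw)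
    show "w 0 = 1" "w \<sigma> = 0" using v0 v_1 \<sigma> by (simp_all add: w_def)
    have "\<sigma> powr ((2 + \<alpha>) / 2) = \<mu> powr (1 / 2)"
      using \<alpha> by (simp add: \<sigma>_def powr_powr)
    also have "\<dots> = \<bar>v 0\<bar> powr ((p - 1) / 2)"
      by (simp add: \<mu>_def powr_powr)
    finally show "sup_norm u powr ((p - 1) / 2) = \<sigma> powr ((2 + \<alpha>) / 2)"
      by (simp add: sup)
    fix x :: "real^'n" assume x: "x \<in> cball 0 1"
    have "sgn (v 0) / \<bar>v 0\<bar> = 1 / v 0"
      using v0 by (simp add: sgn_if)
    then have "sgn (v 0) * (v (norm x) / \<bar>v 0\<bar>) = v (norm x) / v 0"
      by (metis mult.commute mult.left_neutral times_divide_eq_left times_divide_eq_right)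
    then show "sgn (u 0) * (u x / sup_norm u) = w (\<sigma> * norm x)"
      using u[OF x] \<sigma> by (simp add: sup u0 w_def)
  next
    show "nodal_radii u = (\<lambda>s. s / \<sigma>) ` {s. 0 < s \<and> s \<le> \<sigma> \<and> w s = 0}"
      unfolding wZ radii image_image using \<sigma> by simp
    have "inj_on (\<lambda>r. \<sigma> * r) Z" using \<sigma> by (intro inj_onI) simp
    then show "card {s. 0 < s \<and> s \<le> \<sigma> \<and> w s = 0} = m"
      unfolding wZ by (simp add: card_image cardZ)
  qed
qed

section \<open>Convergence as the exponent tends to one\<close>

lemma uniform_limit_squeeze:
  fixes f :: "'p \<Rightarrow> 'a \<Rightarrow> 'b :: real_normed_vector"
  assumes B: "(B \<longlongrightarrow> 0) F" and bound: "\<forall>\<^sub>F p in F. \<forall>x\<in>S. norm (f p x - g x) \<le> B p"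
  shows "uniform_limit S f g F"
proof (rule uniform_limitI)
  fix e :: real assume "0 < e"
  then have "\<forall>\<^sub>F p in F. B p < e" using B by (rule order_tendstoD(2)[rotated])
  then show "\<forall>\<^sub>F p in F. \<forall>x\<in>S. dist (f p x) (g x) < e"
    using bound by eventually_elim (auto simp: dist_norm intro: le_less_trans)
qed

theorem theorem1p1:
  fixes u :: "real \<Rightarrow> real^'n \<Rightarrow> real" and \<alpha> :: real and m :: nat
  assumes "2 \<le> CARD('n)" and "0 \<le> \<alpha>" and "1 \<le> m"
    and "\<And>p. henon_exponent CARD('n) \<alpha> p \<Longrightarrow>
           radial_henon_solution \<alpha> p (u p) \<and> card (nodal_zones (u p)) = m"
  shows "((\<lambda>p. sup_norm (u p) powr ((p - 1) / 2)) \<longlongrightarrow>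
            (2 + \<alpha>) / 2 * bessel_zero (henon_order CARD('n) \<alpha>) m) (at_right 1)
    \<and> C2_converges (ball 0 1) (\<lambda>p x. sgn (u p 0) * (u p x / sup_norm (u p)))
        (henon_profile \<alpha> m) (at_right 1)
    \<and> (\<forall>p. henon_exponent CARD('n) \<alpha> p \<longrightarrow>
            card (nodal_radii (u p)) = m \<and> kth_smallest (nodal_radii (u p)) m = 1)
    \<and> (\<forall>i\<in>{1..m - 1}.
          ((\<lambda>p. kth_smallest (nodal_radii (u p)) i) \<longlongrightarrow>
             (bessel_zero (henon_order CARD('n) \<alpha>) i / bessel_zero (henon_order CARD('n) \<alpha>) m)
               powr (2 / (2 + \<alpha>))) (at_right 1))"
proof -
  define n where "n = real CARD('n)"
  define b where "b = 2 + \<alpha>"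
  define adm where "adm = henon_exponent CARD('n) \<alpha>"
  note N = assms(1) and \<alpha> = assms(2) and m = assms(3)
  have n: "2 \<le> n" using N by (simp add: n_def)
  have b: "0 < b" using \<alpha> by (simp add: b_def)
  define s where "s i = kth_smallest (linear_zeros n \<alpha>) i" for i
  have s: "0 < s i" "s i \<in> linear_zeros n \<alpha>" "card {t \<in> linear_zeros n \<alpha>. t \<le> s i} = i" if "1 \<le> i" for i
    using kth_linear_zero[OF n \<alpha> that] unfolding s_def by (auto simp: linear_zeros_def)
  have zero: "bessel_zero (henon_order CARD('n) \<alpha>) i = s i powr (b / 2) / (b / 2)" if "1 \<le> i" for i
    unfolding henon_order_def s_def b_def n_def[symmetric] by (rule bessel_zero_eq[OF n \<alpha> that])
  define props where "props p \<sigma> w w1 \<longleftrightarrow> 0 < \<sigma> \<and> emden_profile n \<alpha> 1 p \<sigma> w w1 \<and> w 0 = 1 \<and> w \<sigma> = 0 \<and>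
    sup_norm (u p) powr ((p - 1) / 2) = \<sigma> powr (b / 2) \<and>
    (\<forall>x\<in>cball 0 1. sgn (u p 0) * (u p x / sup_norm (u p)) = w (\<sigma> * norm x)) \<and>
    nodal_radii (u p) = (\<lambda>s. s / \<sigma>) ` {s. 0 < s \<and> s \<le> \<sigma> \<and> w s = 0} \<and>
    card {s. 0 < s \<and> s \<le> \<sigma> \<and> w s = 0} = m" for p \<sigma> w w1
  \<comment> \<open>A simultaneous choice of the length \<open>\<sigma> p\<close> and the normalized profile \<open>w p\<close> with derivative \<open>w1 p\<close>, for all admissible \<open>p\<close>.\<close>
  define Q where "Q p = (SOME t. props p (fst t) (fst (snd t)) (snd (snd t)))" for p
  define \<sigma> where "\<sigma> p = fst (Q p)" for p
  define w where "w p = fst (snd (Q p))" for p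
  define w1 where "w1 p = snd (snd (Q p))" for p
  have adm_gt: "1 < p" if "adm p" for p
    using that by (simp add: adm_def henon_exponent_def)
  have props: "props p (\<sigma> p) (w p) (w1 p)" if p: "adm p" for p
  proof -
    have "radial_henon_solution \<alpha> p (u p)" "card (nodal_zones (u p)) = m"
      using assms(4) p unfolding adm_def by blast+
    from normalized_solution[OF this m N \<alpha> adm_gt[OF p]]
    obtain t x x1 where "props p t x x1"
      unfolding props_def n_def b_def by blast
    then have "\<exists>t. props p (fst t) (fst (snd t)) (snd (snd t))"
      by (intro exI[of _ "(t, x, x1)"]) simp
    then show ?thesis
      unfolding \<sigma>_def w_def w1_def Q_def by (rule someI_ex)
  qed
  define Z where "Z p = {r. 0 < r \<and> r \<le> \<sigma> p \<and> w p r = 0}" for p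
  have \<sigma>: "0 < \<sigma> p" and prof: "emden_profile n \<alpha> 1 p (\<sigma> p) (w p) (w1 p)" and w0: "w p 0 = 1"
    and w\<sigma>: "w p (\<sigma> p) = 0" and sup: "sup_norm (u p) powr ((p - 1) / 2) = \<sigma> p powr (b / 2)"
    and uw: "\<And>x. x \<in> cball 0 1 \<Longrightarrow> sgn (u p 0) * (u p x / sup_norm (u p)) = w p (\<sigma> p * norm x)"
    and radii: "nodal_radii (u p) = (\<lambda>s. s / \<sigma> p) ` Z p" and cardZ: "card (Z p) = m"
    if "adm p" for p
    using props[OF that] unfolding props_def Z_def by auto
  have ev_adm: "\<forall>\<^sub>F p in at_right 1. adm p"
  proof (cases "3 \<le> CARD('n)")
    case True
    then have "1 < (real CARD('n) + 2 + 2 * \<alpha>) / (real CARD('n) - 2)"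
      using \<alpha> by (simp add: field_simps)
    then show ?thesis
      unfolding eventually_at_right_field adm_def henon_exponent_def by blast
  next
    case False
    then show ?thesis
      unfolding eventually_at_right_field adm_def henon_exponent_def by (intro exI[of _ 2]) auto
  qed
  have transfer: "(k \<longlongrightarrow> c) (at_right 1)"
    if "(h \<longlongrightarrow> c) (at_right 1)" "\<And>p. adm p \<Longrightarrow> h p = k p" for h k :: "real \<Rightarrow> real" and c
    using that(1) by (rule Lim_transform_eventually) (rule eventually_mono[OF ev_adm that(2)])
  have kth_last: "kth_smallest (Z p) m = \<sigma> p" if p: "adm p" for p
  proof (rule kth_smallest_eqI)
    show "\<sigma> p \<in> Z p" using \<sigma>[OF p] w\<sigma>[OF p] by (simp add: Z_def)
    have "{t \<in> Z p. t \<le> \<sigma> p} = Z p" by (auto simp: Z_def)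
    then show "card {t \<in> Z p. t \<le> \<sigma> p} = m" using cardZ[OF p] by simp
  qed (rule m)
  have kth_radii: "kth_smallest (nodal_radii (u p)) i = kth_smallest (Z p) i / \<sigma> p"
    if p: "adm p" and i: "i \<in> {1..m}" for p i
  proof -
    have finZ: "finite (Z p)"
      using cardZ[OF p] m by (intro card_ge_0_finite) simp
    have "{t \<in> Z p. t \<le> \<sigma> p} = Z p" by (auto simp: Z_def)
    then have large: "i \<le> card {t \<in> Z p. t \<le> \<sigma> p}" using cardZ[OF p] i by simp
    have fin: "finite {t \<in> Z p. t \<le> x}" for x
      by (rule finite_subset[OF _ finZ]) auto
    have i1: "1 \<le> i" using i by simp
    show ?thesis
      unfolding radii[OF p]
      using kth_smallest_properties[OF fin large i1] \<sigma>[OF p] i1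
      by (intro kth_smallest_image) (auto intro: divide_strict_right_mono)
  qed
  have p_lim: "((\<lambda>p::real. p - 1) \<longlongrightarrow> 0) (at_right 1)"
    by (rule LIM_zero) (rule tendsto_ident_at)
  \<comment> \<open>All limits take place on \<open>[0,R]\<close>, which exceeds \<open>s m\<close> by the margin that the stability of zeros asks for.\<close>
  define R where "R = s m + 1"
  have R: "0 < R" using s(1)[OF m] by (simp add: R_def)
  define K where "K = exp ((2 * (R + 1) powr \<alpha> + 1) * (R + 1))"
  have close: "\<bar>w p r - linear_profile n \<alpha> r\<bar> \<le> (p - 1) * K"
    if "adm p" "0 \<le> r" "r \<le> \<sigma> p" "r \<le> R" for p r
    unfolding K_def by (rule profile_comparison_uniform(1)[OF prof w0 R]) (use that in auto)
  have close1: "\<bar>w1 p r - linear_profile' n \<alpha> r\<bar> \<le> (p - 1) * K"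
    if "adm p" "0 \<le> r" "r < \<sigma> p" "r \<le> R" for p r
    unfolding K_def by (rule profile_comparison_uniform(2)[OF prof w0 R]) (use that in auto)
  have zeros_near: "\<forall>\<^sub>F p in at_right 1. \<forall>i\<in>{1..m}. \<bar>kth_smallest (Z p) i - s i\<bar> < \<epsilon>" if \<epsilon>: "0 < \<epsilon>" for \<epsilon>
  proof -
    have derV: "(linear_profile n \<alpha> has_real_derivative linear_profile' n \<alpha> t) (at t)" if "0 < t" for t
      by (rule emden_profile.w_der[OF emden_linear_profile[OF n \<alpha>, of "t + 1"]]) (use that in auto)
    have V0: "linear_profile n \<alpha> 0 \<noteq> 0" using linear_profile_0[OF n \<alpha>] by simp
    obtain \<delta> where \<delta>: "0 < \<delta>" and stable: "\<And>S w w1. 0 < S \<Longrightarrow> continuous_on {0..S} w \<Longrightarrow>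
        (\<forall>r. 0 < r \<and> r < S \<longrightarrow> (w has_real_derivative w1 r) (at r)) \<Longrightarrow> w S = 0 \<Longrightarrow>
        card {r. 0 < r \<and> r \<le> S \<and> w r = 0} = m \<Longrightarrow>
        (\<forall>r. 0 \<le> r \<and> r \<le> S \<and> r \<le> R \<longrightarrow> \<bar>w r - linear_profile n \<alpha> r\<bar> < \<delta>) \<Longrightarrow>
        (\<forall>r. 0 \<le> r \<and> r < S \<and> r \<le> R \<longrightarrow> \<bar>w1 r - linear_profile' n \<alpha> r\<bar> < \<delta>) \<Longrightarrow>
        (\<forall>i\<in>{1..m}. \<bar>kth_smallest {r. 0 < r \<and> r \<le> S \<and> w r = 0} i - s i\<bar> < \<epsilon>)"
      using simple_zeros_stable[where V = "linear_profile n \<alpha>" and ?V1.0 = "linear_profile' n \<alpha>"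
          and sm = "s m" and m = m and \<epsilon> = \<epsilon>, folded linear_zeros_def,
          OF V0 finite_linear_zeros[OF n \<alpha>] linear_zeros_simple[OF n \<alpha>] derV
          continuous_linear_profile[OF n \<alpha>] s(2,3)[OF m] \<epsilon>]
      unfolding R_def s_def by blast
    have "((\<lambda>p. (p - 1) * K) \<longlongrightarrow> 0) (at_right 1)"
      by (rule tendsto_mult_left_zero[OF p_lim])
    then have "\<forall>\<^sub>F p in at_right 1. (p - 1) * K < \<delta>"
      using \<delta> by (rule order_tendstoD)
    then show ?thesis
      using ev_adm
    proof eventually_elim
      case (elim p)
      interpret emden_profile n \<alpha> 1 p "\<sigma> p" "w p" "w1 p" by (rule prof) (rule elim)
      have "card {r. 0 < r \<and> r \<le> \<sigma> p \<and> w p r = 0} = m"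
        using cardZ elim(2) by (simp add: Z_def)
      moreover have "\<bar>w p r - linear_profile n \<alpha> r\<bar> < \<delta>" if "0 \<le> r" "r \<le> \<sigma> p" "r \<le> R" for r
        using close[OF elim(2) that] elim(1) by linarith
      moreover have "\<bar>w1 p r - linear_profile' n \<alpha> r\<bar> < \<delta>" if "0 \<le> r" "r < \<sigma> p" "r \<le> R" for r
        using close1[OF elim(2) that] elim(1) by linarith
      ultimately show ?case
        unfolding Z_def
        using w\<sigma>[OF elim(2)] w_cont w_der S_pos
        by (intro stable[of "\<sigma> p" "w p" "w1 p"]) auto
    qed
  qed
  have kth_lim: "((\<lambda>p. kth_smallest (Z p) i) \<longlongrightarrow> s i) (at_right 1)" if "i \<in> {1..m}" for i
  proof (rule tendstoI)
    fix e :: real assume "0 < e"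
    then show "\<forall>\<^sub>F p in at_right 1. dist (kth_smallest (Z p) i) (s i) < e"
      using zeros_near[of e] that by (auto elim!: eventually_mono simp: dist_real_def)
  qed
  have \<sigma>_lim: "(\<sigma> \<longlongrightarrow> s m) (at_right 1)"
    by (rule transfer[OF kth_lim]) (use m kth_last in auto)
  have sm: "0 < s m" by (rule s(1)[OF m])

  have norm_lim': "((\<lambda>p. \<sigma> p powr (b / 2)) \<longlongrightarrow> s m powr (b / 2)) (at_right 1)"
    using sm by (intro tendsto_intros \<sigma>_lim) auto
  have sm_eq: "s m powr (b / 2) = (2 + \<alpha>) / 2 * bessel_zero (henon_order CARD('n) \<alpha>) m"
    using zero[OF m] b by (simp add: b_def)
  have norm_lim: "((\<lambda>p. sup_norm (u p) powr ((p - 1) / 2)) \<longlongrightarrow>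
            (2 + \<alpha>) / 2 * bessel_zero (henon_order CARD('n) \<alpha>) m) (at_right 1)"
    by (rule transfer[OF norm_lim'[unfolded sm_eq]]) (rule sup[symmetric])

  have counts: "card (nodal_radii (u p)) = m \<and> kth_smallest (nodal_radii (u p)) m = 1"
    if p: "henon_exponent CARD('n) \<alpha> p" for p
  proof
    have p': "adm p" using p by (simp add: adm_def)
    have "inj_on (\<lambda>s. s / \<sigma> p) (Z p)" using \<sigma>[OF p'] by (intro inj_onI) simp
    then show "card (nodal_radii (u p)) = m"
      unfolding radii[OF p'] by (simp add: card_image cardZ[OF p'])
    show "kth_smallest (nodal_radii (u p)) m = 1"
      using kth_radii[OF p', of m] kth_last[OF p'] \<sigma>[OF p'] m by simp
  qed

  have radii_lim: "((\<lambda>p. kth_smallest (nodal_radii (u p)) i) \<longlongrightarrow>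
             (bessel_zero (henon_order CARD('n) \<alpha>) i / bessel_zero (henon_order CARD('n) \<alpha>) m)
               powr (2 / (2 + \<alpha>))) (at_right 1)" if i: "i \<in> {1..m - 1}" for i
  proof -
    have i': "i \<in> {1..m}" "1 \<le> i" using i by auto
    have lim: "((\<lambda>p. kth_smallest (Z p) i / \<sigma> p) \<longlongrightarrow> s i / s m) (at_right 1)"
      using sm by (intro tendsto_divide kth_lim i' \<sigma>_lim) auto
    have quotient: "s i / s m = (bessel_zero (henon_order CARD('n) \<alpha>) i / bessel_zero (henon_order CARD('n) \<alpha>) m)
               powr (2 / (2 + \<alpha>))"
    proof -
      have "bessel_zero (henon_order CARD('n) \<alpha>) i / bessel_zero (henon_order CARD('n) \<alpha>) m
          = (s i / s m) powr (b / 2)"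
        using zero[OF i'(2)] zero[OF m] b s(1)[OF i'(2)] sm by (simp add: powr_divide)
      moreover have "((s i / s m) powr (b / 2)) powr (2 / b) = s i / s m"
        using b s(1)[OF i'(2)] sm by (simp add: powr_powr)
      ultimately show ?thesis by (simp add: b_def)
    qed
    show ?thesis
      by (rule transfer[OF lim[unfolded quotient]]) (rule kth_radii[symmetric, OF _ i'(1)])
  qed

  obtain L where L: "\<And>x y. x \<in> {0..R} \<Longrightarrow> y \<in> {0..R} \<Longrightarrow>
      \<bar>linear_profile n \<alpha> x - linear_profile n \<alpha> y\<bar> \<le> L * \<bar>x - y\<bar>"
    using linear_profile_lipschitz[OF n \<alpha>, of R] by blast
  have L0: "0 \<le> L"
    using L[of 0 R] R by (simp add: zero_le_mult_iff) (smt (verit) abs_ge_zero mult_neg_pos)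
  \<comment> \<open>Bounds for the distance of the normalized solution from the limit (\<open>E\<close>) and for that of the right-hand sides of their equations (\<open>D\<close>).\<close>
  define E where "E p = (p - 1) * K + L * \<bar>\<sigma> p - s m\<bar>" for p
  define D where "D p = \<bar>\<sigma> p powr b - s m powr b\<bar> + s m powr b * ((p - 1) + E p)" for p
  have dist0: "((\<lambda>p. \<bar>\<sigma> p - s m\<bar>) \<longlongrightarrow> 0) (at_right 1)"
    by (intro tendsto_rabs_zero LIM_zero \<sigma>_lim)
  have E0: "(E \<longlongrightarrow> 0) (at_right 1)"
    unfolding E_def[abs_def]
    by (intro tendsto_add_zero tendsto_mult_left_zero tendsto_mult_right_zero p_lim dist0)
  have D0: "(D \<longlongrightarrow> 0) (at_right 1)"
  proof -
    have "((\<lambda>p. \<sigma> p powr b) \<longlongrightarrow> s m powr b) (at_right 1)"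
      using sm by (intro tendsto_intros \<sigma>_lim) auto
    then have "((\<lambda>p. \<bar>\<sigma> p powr b - s m powr b\<bar>) \<longlongrightarrow> 0) (at_right 1)"
      by (intro tendsto_rabs_zero LIM_zero)
    then show ?thesis
      unfolding D_def[abs_def]
      by (intro tendsto_add_zero tendsto_mult_right_zero p_lim E0)
  qed
  define f where "f p x = sgn (u p 0) * (u p x / sup_norm (u p))" for p x
  define g where "g x = linear_profile n \<alpha> (s m * norm x)" for x :: "real^'n"
  have g: "henon_profile \<alpha> m = g"
    unfolding g_def s_def n_def by (rule ext) (rule henon_profile_eq[OF N \<alpha> m])
  have C2g: "C2_on (ball 0 1) g"
    by (rule C2_henon_profile[OF N \<alpha> sm]) (simp add: g_def n_def)
  have C2f: "C2_on (ball 0 1) (f p)" if "adm p" for p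
  proof -
    have "C2_on (ball 0 1) (u p)"
      using assms(4) that by (simp add: adm_def radial_henon_solution_def)
    then have "C2_on (ball 0 1) (\<lambda>x. sgn (u p 0) / sup_norm (u p) * u p x)"
      by (rule C2_on_cmult) simp
    then show ?thesis by (simp add: f_def[abs_def])
  qed
  have fw: "f p x = w p (\<sigma> p * norm x)" if "adm p" "x \<in> ball 0 1" for p x
    using uw[of p x] that by (simp add: f_def)
  have profg: "emden_profile n \<alpha> (s m powr b) 1 1 (\<lambda>r. linear_profile n \<alpha> (s m * r)) (\<lambda>r. s m * linear_profile' n \<alpha> (s m * r))"
    unfolding b_def by (rule emden_profile_unit[OF emden_linear_profile[OF n \<alpha> sm]])
  have ev: "\<forall>\<^sub>F p in at_right 1. adm p \<and> \<sigma> p < R"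
    using ev_adm order_tendstoD(2)[OF \<sigma>_lim, of R] by (auto simp: R_def intro: eventually_conj)
  have profile_dist: "\<bar>w p (\<sigma> p * r) - linear_profile n \<alpha> (s m * r)\<bar> \<le> E p"
    if p: "adm p" "\<sigma> p < R" and r: "0 \<le> r" "r < 1" for p r
  proof -
    have \<sigma>r: "0 \<le> \<sigma> p * r" "\<sigma> p * r \<le> \<sigma> p" "0 \<le> s m * r" "s m * r \<le> s m"
      using \<sigma>[OF p(1)] sm r by (auto simp: mult_le_cancel_left2)
    have "\<bar>linear_profile n \<alpha> (\<sigma> p * r) - linear_profile n \<alpha> (s m * r)\<bar> \<le> L * \<bar>\<sigma> p * r - s m * r\<bar>"
      using \<sigma>r p by (intro L) (auto simp: R_def)
    also have "\<bar>\<sigma> p * r - s m * r\<bar> = \<bar>\<sigma> p - s m\<bar> * r"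
      using r by (simp add: abs_mult flip: left_diff_distrib)
    also have "L * (\<bar>\<sigma> p - s m\<bar> * r) \<le> L * (\<bar>\<sigma> p - s m\<bar> * 1)"
      using r L0 by (intro mult_left_mono) auto
    finally have "\<bar>linear_profile n \<alpha> (\<sigma> p * r) - linear_profile n \<alpha> (s m * r)\<bar> \<le> L * \<bar>\<sigma> p - s m\<bar>"
      by simp
    moreover have "\<bar>w p (\<sigma> p * r) - linear_profile n \<alpha> (\<sigma> p * r)\<bar> \<le> (p - 1) * K"
      using \<sigma>r p by (intro close) auto
    ultimately show ?thesis unfolding E_def by linarith
  qed
  have forces: "\<bar>\<sigma> p powr b * spow p (w p (\<sigma> p * r)) - s m powr b * spow 1 (linear_profile n \<alpha> (s m * r))\<bar> \<le> D p"
    if p: "adm p" "\<sigma> p < R" and r: "0 < r" "r < 1" for p r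
  proof -
    define y where "y = w p (\<sigma> p * r)"
    have "\<sigma> p * r < \<sigma> p" using \<sigma>[OF p(1)] r by simp
    then have y: "\<bar>y\<bar> \<le> 1"
      using emden_profile.abs_w_le[OF prof[OF p(1)], of "\<sigma> p * r"] w0[OF p(1)] \<sigma>[OF p(1)] r
      by (simp add: y_def)
    have p1: "1 \<le> p" using adm_gt[OF p(1)] by simp
    have "\<bar>spow p y\<bar> \<le> 1" using abs_spow_le[OF p1 y] by simp
    then have 1: "\<bar>(\<sigma> p powr b - s m powr b) * spow p y\<bar> \<le> \<bar>\<sigma> p powr b - s m powr b\<bar> * 1"
      unfolding abs_mult by (intro mult_left_mono) auto
    have "\<bar>spow p y - linear_profile n \<alpha> (s m * r)\<bar> \<le> (p - 1) + E p"
      using spow_near_identity[OF p1 y] profile_dist[OF p, of r] r unfolding y_def by linarith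
    then have 2: "\<bar>s m powr b * (spow p y - linear_profile n \<alpha> (s m * r))\<bar> \<le> s m powr b * ((p - 1) + E p)"
      unfolding abs_mult by (intro mult_mono) auto
    have split: "\<sigma> p powr b * spow p y - s m powr b * spow 1 (linear_profile n \<alpha> (s m * r))
       = (\<sigma> p powr b - s m powr b) * spow p y + s m powr b * (spow p y - linear_profile n \<alpha> (s m * r))"
      by (simp add: algebra_simps)
    show ?thesis
      unfolding y_def[symmetric] D_def split
      using order_trans[OF abs_triangle_ineq add_mono[OF 1 2]] by simp
  qed
  define C where "C = norm (mat 1 :: real^'n^'n) + n + 1"
  have derivs: "norm (grad (f p) x - grad g x) \<le> D p" "norm (hess (f p) x - hess g x) \<le> C * D p"
    if p: "adm p" "\<sigma> p < R" and x: "x \<in> ball 0 1" for p x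
  proof -
    have proff: "emden_profile n \<alpha> (\<sigma> p powr b) p 1 (\<lambda>r. w p (\<sigma> p * r)) (\<lambda>r. \<sigma> p * w1 p (\<sigma> p * r))"
      unfolding b_def by (rule emden_profile_unit[OF prof[OF p(1)]])
    note R = radial_C2_close[of \<alpha> "\<sigma> p powr b" p "\<lambda>r. w p (\<sigma> p * r)" "\<lambda>r. \<sigma> p * w1 p (\<sigma> p * r)" "f p"
        "s m powr b" 1 "\<lambda>r. linear_profile n \<alpha> (s m * r)" "\<lambda>r. s m * linear_profile' n \<alpha> (s m * r)" g "D p" x,
        folded n_def, OF proff fw[OF p(1)] profg g_def C2f[OF p(1)] C2g forces[OF p] x]
    show "norm (grad (f p) x - grad g x) \<le> D p" by (rule R(1))
    show "norm (hess (f p) x - hess g x) \<le> C * D p" unfolding C_def by (rule R(2))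
  qed
  have "C2_converges (ball 0 1) f g (at_right 1)"
    unfolding C2_converges_def
  proof (intro conjI)
    show "\<forall>\<^sub>F p in at_right 1. C2_on (ball 0 1) (f p)"
      using ev_adm C2f by (rule eventually_mono)
    show "C2_on (ball 0 1) g" by (rule C2g)
    show "uniform_limit (ball 0 1) f g (at_right 1)"
    proof (rule uniform_limit_squeeze[OF E0])
      show "\<forall>\<^sub>F p in at_right 1. \<forall>x\<in>ball 0 1. norm (f p x - g x) \<le> E p"
        using ev
      proof eventually_elim
        case (elim p)
        then show ?case
          using profile_dist[of p] by (auto simp: fw g_def)
      qed
    qed
    show "uniform_limit (ball 0 1) (\<lambda>p. grad (f p)) (grad g) (at_right 1)"
      by (rule uniform_limit_squeeze[OF D0]) (use ev derivs in \<open>auto elim!: eventually_mono\<close>)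
    show "uniform_limit (ball 0 1) (\<lambda>p. hess (f p)) (hess g) (at_right 1)"
      by (rule uniform_limit_squeeze[OF tendsto_mult_right_zero[OF D0, of C]])
        (use ev derivs in \<open>auto elim!: eventually_mono\<close>)
  qed
  then have "C2_converges (ball 0 1) (\<lambda>p x. sgn (u p 0) * (u p x / sup_norm (u p)))
        (henon_profile \<alpha> m) (at_right 1)"
    unfolding g f_def[abs_def] .
  with norm_lim counts radii_lim show ?thesis by blast
qed

end
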